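(* Let $s\ge-\tfrac12$ and let $k\ge1$ be an integer. The set $\tilde{\mathcal P}_{s,k}(\mathbb R^{+k})$ is closed with respect to weak convergence and with respect to the ordinary convolution $\ast$ on $\mathbb R^k$, and for every $\mathbf G\in\mathcal P(\mathbb R^{+k})$ $$\hat{\mathbf G}(\mathbf t)=\mathcal F(F_{s,k}(\mathbf G))(\mathbf t),\qquad \mathbf t\in\mathbb R^{+k},$$ where $\mathcal F(\mathbf K)$ denotes the ordinary characteristic function (Fourier transform) of a probability measure $\mathbf K$ on $\mathbb R^k$. Therefore, for any $\mathbf G_1,\mathbf G_2\in\mathcal P(\mathbb R^{+k})$, $$F_{s,k}(\mathbf G_1)\ast F_{s,k}(\mathbf G_2)=F_{s,k}(\mathbf G_1\bigcirc_{s,k}\mathbf G_2),$$ and the map $F_{s,k}$ commutes with convex combinations of distributions and with scale changes $T_c$, $c>0$. Moreover, $$F_{s,k}(\Sigma_{s,k})=N(\mathbf 0,2(s+1)\mathbf I),$$ where $\Sigma_{s,k}$ is the $k$-dimensional Rayleigh distribution and $N(\mathbf 0,2(s+1)\mathbf I)$ is the symmetric normal distribution on $\mathbb R^k$ with variance operator $R=2(s+1)\mathbf I$, $\mathbf I$ being the identity operator. Consequently, every $k$-dimensional Kingman convolution algebra $(\mathcal P(\mathbb R^{+k}),\bigcirc_{s,k})$ is embedded in the ordinary convolution algebra $(\tilde{\mathcal P}_{s,k}(\mathbb R^{+k}),\ast)$, and the map $F_{s,k}:\mathcal P(\mathbb R^{+k})\to\tilde{\mathcal P}_{s,k}(\mathbb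 R^{+k})$ is a homeomorphism.
   Context: Notation. $\mathbb R^+=[0,\infty)$, $\mathbb R^{+k}=[0,\infty)^k$, and $\mathcal P(E)$ is the set of Borel probability measures on $E$ with the topology of weak convergence. $\delta_z$ is the unit mass at $z$, and $\times$ between measures is the product measure. For a real number $c$ and the distribution $\mathbf G$ of a random vector (or variable) $\mathbf X$, $T_c\mathbf G$ is the distribution of $c\mathbf X$. Kingman convolution. For $s>-\tfrac12$ and $\mu,\nu\in\mathcal P(\mathbb R^+)$, $\mu\circ_s\nu\in\mathcal P(\mathbb R^+)$ is defined by: for every bounded continuous $f$ on $\mathbb R^+$, $$\int_0^\infty f\,d(\mu\circ_s\nu)=\frac{\Gamma(s+1)}{\sqrt\pi\,\Gamma(s+\frac12)}\int_0^\infty\!\int_0^\infty\!\int_{-1}^1 f\big((x^2+2uxy+y^2)^{1/2}\big)(1-u^2)^{s-1/2}\,du\,\mu(dx)\,\nu(dy).$$ For $s=-\tfrac12$ the probability measure $\frac{\Gamma(s+1)}{\sqrt\pi\Gamma(s+1/2)}(1-u^2)^{s-1/2}du$ is replaced by its weak limit $\frac12(\delta_{-1}+\delta_1)$. $k$-dimensional Kingman convolution. For $\mathbf x,\mathbf y\in\mathbb R^{+k}$, put $\delta_{\mathbf x}\bigcirc_{s,k}\delta_{\mathbf y}=(\delta_{x_1}\circ_s\delta_{y_1})\times\cdots\times(\delta_{x_k}\circ_s\delta_{y_k})$. For $\mathbf G_1,\mathbf G_2\in\mathcal P(\mathbb R^{+k})$, put $\mathbf G_1\bigcirc_{s,k}\mathbf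 G_2=\iint(\delta_{\mathbf x}\bigcirc_{s,k}\delta_{\mathbf y})\,\mathbf G_1(d\mathbf x)\,\mathbf G_2(d\mathbf y)$. Kernel and radial characteristic function. $\Lambda_s(x)=\Gamma(s+1)J_s(x)/(x/2)^s=\sum_{n\ge0}\frac{(-1)^n\Gamma(s+1)}{n!\,\Gamma(s+n+1)}(x/2)^{2n}$, where $J_s$ is the Bessel function of the first kind. $F_s$ denotes the symmetric probability measure on $[-1,1]$ whose ordinary characteristic function is $\Lambda_s$, i.e. $\Lambda_s(t)=\int_{-1}^1\cos(tx)\,F_s(dx)$ (such a measure is known to exist). For $\mathbf G\in\mathcal P(\mathbb R^{+k})$ the radial characteristic function is $\hat{\mathbf G}(\mathbf t)=\int_{\mathbb R^{+k}}\prod_{j=1}^k\Lambda_s(t_jx_j)\,\mathbf G(d\mathbf x)$, $\mathbf t\in\mathbb R^{+k}$. The map $F_{s,k}$. $F_{s,k}:\mathcal P(\mathbb R^{+k})\to\mathcal P(\mathbb R^k)$ is defined by $F_{s,k}(\mathbf G)=\int_{\mathbb R^{+k}}(T_{c_1}F_s)\times(T_{c_2}F_s)\times\cdots\times(T_{c_k}F_s)\,\mathbf G(d\mathbf c)$. Its range is denoted $\tilde{\mathcal P}_{s,k}(\mathbb R^{+k})\subset\mathcal P(\mathbb R^k)$. Rayleigh distribution. $\sigma_s$ is the probability measure on $\mathbb R^+$ with density $\frac{2(s+1)^{s+1}}{\Gamma(s+1)}x^{2s+1}\exp\{-(s+1)x^2\}$, $x>0$, and $\Sigma_{s,k}=\sigma_s\times\cdots\times\sigma_s$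 ($k$ times).
   Formalization: The normal law is taken with covariance (1/(2(s+1)))I instead of variance operator 2(s+1)I: with the given normalisations the image of the Rayleigh distribution has coordinate variance 1/(2(s+1)), so the stated formula is false for s > -1/2; both agree at s = -1/2. *)

theory Defs
  imports "HOL-Probability.Probability" "HOL-Algebra.Group"
begin

section \<open>Borel probability measures and the topology of weak convergence\<close>

abbreviation borel_on :: "'a::topological_space set \<Rightarrow> 'a measure" where
  "borel_on E \<equiv> restrict_space borel E"

definition prob_measures :: "'a::topological_space set \<Rightarrow> 'a measure set" where
  "prob_measures E = {M. prob_space M \<and> sets M = sets (borel_on E)}"

text \<open>The coarsest topology making \<open>M \<mapsto> \<integral>f dM\<close> continuous for all bounded continuous \<open>f\<close> on \<open>E\<close>.\<close>

definition weak_topology :: "'a::topological_space set \<Rightarrow> 'a measure topology" where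
  "weak_topology E = topology_generated_by
     {{M \<in> prob_measures E. (\<integral>x. f x \<partial>M) \<in> U} | (f :: 'a \<Rightarrow> real) U.
        continuous_on E f \<and> bounded (f ` E) \<and> open U}"

definition orthant :: "(real ^ 'k) set" where
  "orthant = {x. \<forall>i. 0 \<le> x $ i}"

text \<open>\<open>T\<^sub>c\<close>: the sets \<open>E\<close> in use (\<open>\<real>\<close>, \<open>\<real>\<^sup>k\<close>, and for \<open>c \<ge> 0\<close> the orthant) are mapped
  into themselves by \<open>x \<mapsto> c x\<close>, so the image measure lives on the space of \<open>M\<close>.\<close>

definition dilate :: "real \<Rightarrow> 'a::real_vector measure \<Rightarrow> 'a measure" where
  "dilate c M = distr M M (\<lambda>x. c *\<^sub>R x)"

text \<open>\<open>M\<^sub>1 \<times> \<dots> \<times> M\<^sub>k\<close>, as a measure on the Borel subset \<open>E\<close> of \<open>\<real>\<^sup>k\<close>.\<close>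

definition product_measure :: "(real ^ 'k) set \<Rightarrow> ('k \<Rightarrow> real measure) \<Rightarrow> (real ^ 'k) measure" where
  "product_measure E M = distr (Pi\<^sub>M UNIV M) (borel_on E) (\<lambda>f. \<chi> i. f i)"

definition convex_combination ::
    "'a::topological_space set \<Rightarrow> nat \<Rightarrow> (nat \<Rightarrow> real) \<Rightarrow> (nat \<Rightarrow> 'a measure) \<Rightarrow> 'a measure" where
  "convex_combination E n a M =
     measure_of E (sets (borel_on E)) (\<lambda>A. \<Sum>i<n. ennreal (a i) * emeasure (M i) A)"

definition char_fun :: "'a::euclidean_space measure \<Rightarrow> 'a \<Rightarrow> complex" where
  "char_fun M t = (CLINT x|M. iexp (t \<bullet> x))"

text \<open>The normal law with mean \<open>0\<close> and (positive definite) covariance matrix \<open>R\<close>.\<close>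

definition centred_normal :: "real ^ 'k ^ 'k \<Rightarrow> (real ^ 'k) measure" where
  "centred_normal R = density lborel
     (\<lambda>x. ennreal (exp (- (x \<bullet> (matrix_inv R *v x)) / 2) / sqrt ((2 * pi) ^ CARD('k) * det R)))"


section \<open>Kingman convolution\<close>

definition kingman_const :: "real \<Rightarrow> real" where
  "kingman_const s = Gamma (s + 1) / (sqrt pi * Gamma (s + 1/2))"

text \<open>The law of \<open>u\<close> on \<open>[-1,1]\<close>; for \<open>s = -1/2\<close> it is \<open>(\<delta>\<^sub>-\<^sub>1 + \<delta>\<^sub>1)/2\<close>.\<close>

definition kingman_angle :: "real \<Rightarrow> real measure" where
  "kingman_angle s =
     (if s = -1/2 then distr (uniform_count_measure {-1, 1}) (borel_on {-1..1}) (\<lambda>u. u)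
      else density (restrict_space lborel {-1..1})
             (\<lambda>u. ennreal (kingman_const s * (1 - u\<^sup>2) powr (s - 1/2))))"

text \<open>The measure whose integrals are given by the usual triple-integral formula; see
  \<open>integral_kingman_conv\<close> and \<open>integral_kingman_conv_neg_half\<close> below.\<close>

definition kingman_conv :: "real \<Rightarrow> real measure \<Rightarrow> real measure \<Rightarrow> real measure" where
  "kingman_conv s \<mu> \<nu> = distr (\<mu> \<Otimes>\<^sub>M (\<nu> \<Otimes>\<^sub>M kingman_angle s)) (borel_on {0..})
     (\<lambda>(x, y, u). sqrt (x\<^sup>2 + 2 * u * x * y + y\<^sup>2))"

definition kingman_conv_point :: "real \<Rightarrow> real ^ 'k \<Rightarrow> real ^ 'k \<Rightarrow> (real ^ 'k) measure" where
  "kingman_conv_point s x y = product_measure orthant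
     (\<lambda>i. kingman_conv s (return (borel_on {0..}) (x $ i)) (return (borel_on {0..}) (y $ i)))"

definition kingman_conv_vec ::
    "real \<Rightarrow> (real ^ 'k) measure \<Rightarrow> (real ^ 'k) measure \<Rightarrow> (real ^ 'k) measure" where
  "kingman_conv_vec s G1 G2 = (G1 \<Otimes>\<^sub>M G2) \<bind> (\<lambda>(x, y). kingman_conv_point s x y)"


section \<open>Radial characteristic function, the map into ordinary measures, Rayleigh laws\<close>

text \<open>\<open>\<Gamma>(s+1) J\<^sub>s(x) / (x/2)\<^sup>s\<close>, through its power series (so that \<open>\<Lambda>\<^sub>s(0) = 1\<close>).\<close>

definition Lambda_fun :: "real \<Rightarrow> real \<Rightarrow> real" where
  "Lambda_fun s x =
     (\<Sum>n. (-1) ^ n * Gamma (s + 1) / (fact n * Gamma (s + real n + 1)) * (x / 2) ^ (2 * n))"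

definition F_law :: "real \<Rightarrow> real measure" where
  "F_law s = (THE M. M \<in> prob_measures UNIV \<and> emeasure M (- {-1..1}) = 0 \<and>
                dilate (-1) M = M \<and> (\<forall>t. char M t = complex_of_real (Lambda_fun s t)))"

definition radial_char_fun :: "real \<Rightarrow> (real ^ 'k) measure \<Rightarrow> real ^ 'k \<Rightarrow> real" where
  "radial_char_fun s G t = (\<integral>x. (\<Prod>j\<in>UNIV. Lambda_fun s (t $ j * x $ j)) \<partial>G)"

definition F_map :: "real \<Rightarrow> (real ^ 'k) measure \<Rightarrow> (real ^ 'k) measure" where
  "F_map s G = G \<bind> (\<lambda>c. product_measure UNIV (\<lambda>i. dilate (c $ i) (F_law s)))"

definition F_range :: "real \<Rightarrow> (real ^ 'k) measure set" where
  "F_range s = F_map s ` prob_measures orthant"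

definition rayleigh :: "real \<Rightarrow> real measure" where
  "rayleigh s = density (restrict_space lborel {0..})
     (\<lambda>x. ennreal (2 * (s + 1) powr (s + 1) / Gamma (s + 1) * x powr (2 * s + 1) * exp (- (s + 1) * x\<^sup>2)))"

text \<open>The second moment of \<open>rayleigh s\<close> is \<open>1\<close>, and \<open>F_law s\<close> has variance
  \<open>1 / (2 (s + 1))\<close>; so \<open>F_map s\<close> sends the product law below to the centred normal law with
  covariance \<open>I / (2 (s + 1))\<close>, whose density is proportional to \<open>exp (- (s + 1) |x|\<^sup>2)\<close>.\<close>

definition rayleigh_vec :: "real \<Rightarrow> (real ^ 'k) measure" where
  "rayleigh_vec s = product_measure orthant (\<lambda>_. rayleigh s)"

definition kingman_algebra :: "real \<Rightarrow> (real ^ 'k) measure monoid" where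
  "kingman_algebra s = \<lparr>carrier = prob_measures orthant, mult = kingman_conv_vec s,
                        one = return (borel_on orthant) 0\<rparr>"

definition convolution_algebra :: "real \<Rightarrow> (real ^ 'k) measure monoid" where
  "convolution_algebra s = \<lparr>carrier = F_range s, mult = convolution, one = return borel 0\<rparr>"


section \<open>The integral formula for the Kingman convolution\<close>

lemma prob_space_kingman_angle:
  assumes "s \<ge> -1/2"
  shows "prob_space (kingman_angle s)"
proof (cases "s = -1/2")
  case True
  interpret prob_space "uniform_count_measure {-1, 1 :: real}"
    by (rule prob_space_uniform_count_measure) auto
  show ?thesis unfolding kingman_angle_def using True
    by (auto intro!: prob_space_distr simp: measurable_def space_restrict_space space_uniform_count_measure sets_uniform_count_measure)
next
  case False
  with assms have s: "s > -1/2" by simp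
  have C: "kingman_const s > 0" using s by (simp add: kingman_const_def)
  have "((\<lambda>t. t powr (s - 1/2) * (1 - t) powr (s - 1/2)) has_integral Beta (s + 1/2) (s + 1/2)) {0..1}"
    using has_integral_Beta_real[of "s + 1/2" "s + 1/2"] s by simp
  from nn_integral_has_integral_lebesgue[OF _ this]
  have B: "(\<integral>\<^sup>+t. ennreal (indicator {0..1} t * (t powr (s - 1/2) * (1 - t) powr (s - 1/2))) \<partial>lborel)
      = ennreal (Beta (s + 1/2) (s + 1/2))"
    by (simp add: mult_ac ennreal_mult' ennreal_indicator)
  have eq: "ennreal (kingman_const s * (1 - (-1 + 2 * t)\<^sup>2) powr (s - 1/2)) * indicator {-1..1} (-1 + 2 * t)
     = ennreal (kingman_const s * 4 powr (s - 1/2)) *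
        ennreal (indicator {0..1} t * (t powr (s - 1/2) * (1 - t) powr (s - 1/2)))" for t
  proof -
    have "1 - (-1 + 2 * t)\<^sup>2 = 4 * (t * (1 - t))" by (simp add: power2_eq_square algebra_simps)
    moreover have "(4 * (t * (1 - t))) powr (s - 1/2) = 4 powr (s - 1/2) * (t powr (s - 1/2) * (1 - t) powr (s - 1/2))"
      if "t \<in> {0..1}" using that by (simp only: powr_mult)
    moreover have "-1 + 2 * t \<in> {-1..1} \<longleftrightarrow> t \<in> {0..1}" by auto
    ultimately show ?thesis using C
      by (cases "t \<in> {0..1}") (simp_all only: indicator_simps mult_1 mult_1_right mult_zero_left mult_zero_right
          ennreal_mult[symmetric] ennreal_0 mult.assoc, auto simp: ennreal_mult[symmetric] mult_ac)
  qed
  have dup: "Gamma (s + 1/2) * Gamma (s + 1) = 2 powr (- 2 * s) * sqrt pi * Gamma (2 * s + 1)"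
  proof -
    have "complex_of_real (s + 1/2) \<notin> \<int>\<^sub>\<le>\<^sub>0" "complex_of_real (s + 1/2) + 1/2 \<notin> \<int>\<^sub>\<le>\<^sub>0"
      using s by (auto elim!: nonpos_Ints_cases simp: complex_eq_iff)
    from Gamma_legendre_duplication[OF this]
    have "complex_of_real (Gamma (s + 1/2) * Gamma (s + 1)) =
        complex_of_real (exp (- 2 * s * ln 2) * sqrt pi * Gamma (2 * s + 1))"
      by (simp add: Gamma_complex_of_real[symmetric] exp_of_real[symmetric] algebra_simps)
    then have "Gamma (s + 1/2) * Gamma (s + 1) = exp (- 2 * s * ln 2) * sqrt pi * Gamma (2 * s + 1)"
      by (simp only: of_real_eq_iff)
    then show ?thesis by (simp add: powr_def)
  qed
  have val: "2 * (kingman_const s * 4 powr (s - 1/2) * Beta (s + 1/2) (s + 1/2)) = 1"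
  proof -
    have 4: "(4::real) powr (s - 1/2) = 2 powr (2 * s) / 2"
    proof -
      have "(4::real) powr (s - 1/2) = (2 powr 2) powr (s - 1/2)" by simp
      also have "\<dots> = 2 powr (2 * s - 1)" by (subst powr_powr) (simp add: algebra_simps)
      finally show ?thesis by (simp add: powr_diff)
    qed
    have pos: "Gamma (s + 1/2) > 0" "Gamma (s + 1) > 0" "Gamma (2 * s + 1) > 0"
      using s by auto
    have sum: "(s + 1/2) + (s + 1/2) = 2 * s + 1" by simp
    have "2 * (kingman_const s * 4 powr (s - 1/2) * Beta (s + 1/2) (s + 1/2))
       = 2 powr (2 * s) * (Gamma (s + 1/2) * Gamma (s + 1)) / (sqrt pi * Gamma (2 * s + 1))"
      using pos unfolding 4 kingman_const_def Beta_def sum by (simp add: divide_simps)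
    also have "\<dots> = 1" unfolding dup using pos by (simp add: powr_minus field_simps)
    finally show ?thesis .
  qed
  have "emeasure (kingman_angle s) (space (kingman_angle s))
      = (\<integral>\<^sup>+u. ennreal (kingman_const s * (1 - u\<^sup>2) powr (s - 1/2)) * indicator {-1..1} u \<partial>lborel)"
  proof -
    have m: "(\<lambda>u. ennreal (kingman_const s * (1 - u\<^sup>2) powr (s - 1/2))) \<in> borel_measurable (restrict_space lborel {-1..1})"
      by (rule measurable_restrict_space1) simp
    have "emeasure (kingman_angle s) (space (kingman_angle s))
        = (\<integral>\<^sup>+u. ennreal (kingman_const s * (1 - u\<^sup>2) powr (s - 1/2)) \<partial>restrict_space lborel {-1..1})"
      using False unfolding kingman_angle_def
      by (simp only: if_False space_density emeasure_density[OF m sets.top] nn_set_integral_space)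
    then show ?thesis by (simp add: nn_integral_restrict_space)
  qed
  also have "\<dots> = 2 * (\<integral>\<^sup>+t. ennreal (kingman_const s * (1 - (-1 + 2 * t)\<^sup>2) powr (s - 1/2)) * indicator {-1..1} (-1 + 2 * t) \<partial>lborel)"
    by (subst nn_integral_real_affine[of _ 2 "-1"]) auto
  also have "\<dots> = 2 * (ennreal (kingman_const s * 4 powr (s - 1/2)) * ennreal (Beta (s + 1/2) (s + 1/2)))"
    unfolding eq by (subst nn_integral_cmult) (auto simp only: B, measurable)
  also have "\<dots> = ennreal (2 * (kingman_const s * 4 powr (s - 1/2) * Beta (s + 1/2) (s + 1/2)))"
  proof -
    have "ennreal (2 * (a * b)) = 2 * (ennreal a * ennreal b)" if "a \<ge> 0" "b \<ge> 0" for a b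
      using that by (simp add: ennreal_mult)
    moreover have "Beta (s + 1/2) (s + 1/2) \<ge> 0" "kingman_const s * 4 powr (s - 1/2) \<ge> 0"
      using C s by (auto simp: Beta_def)
    ultimately show ?thesis by simp
  qed
  also have "\<dots> = 1" by (simp only: val ennreal_1)
  finally show ?thesis by (rule prob_spaceI)
qed

lemma sets_kingman_angle [measurable_cong]: "sets (kingman_angle s) = sets (borel_on {-1..1})"
  by (simp add: kingman_angle_def sets_restrict_space)

lemma space_kingman_angle: "space (kingman_angle s) = {-1..1}"
  using sets_eq_imp_space_eq[OF sets_kingman_angle] by (simp add: space_restrict_space)

lemma kingman_arg_nonneg:
  fixes u x y :: real
  assumes "u \<in> {-1..1}" "x \<ge> 0" "y \<ge> 0"
  shows "x\<^sup>2 + 2 * u * x * y + y\<^sup>2 \<ge> 0"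
proof -
  have "- (x * y) \<le> u * (x * y)"
    using assms mult_right_mono[of "-1" u "x * y"] by simp
  moreover have "(x - y)\<^sup>2 \<ge> 0" by simp
  ultimately show ?thesis by (simp add: power2_diff mult_ac)
qed

lemma integral_kingman_conv_aux:
  fixes f :: "real \<Rightarrow> real"
  assumes s: "s \<ge> -1/2" and \<mu>: "\<mu> \<in> prob_measures {0..}" and \<nu>: "\<nu> \<in> prob_measures {0..}"
    and f: "continuous_on {0..} f" "bounded (f ` {0..})"
  shows "(\<integral>z. f z \<partial>kingman_conv s \<mu> \<nu>) =
    (\<integral>x. (\<integral>y. (\<integral>u. f (sqrt (x\<^sup>2 + 2 * u * x * y + y\<^sup>2)) \<partial>kingman_angle s) \<partial>\<nu>) \<partial>\<mu>)"
proof -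
  note [measurable_cong] = \<mu>[unfolded prob_measures_def, simplified, THEN conjunct2]
    \<nu>[unfolded prob_measures_def, simplified, THEN conjunct2]
  interpret M: prob_space \<mu> using \<mu> by (simp add: prob_measures_def)
  interpret N: prob_space \<nu> using \<nu> by (simp add: prob_measures_def)
  interpret A: prob_space "kingman_angle s" using s by (rule prob_space_kingman_angle)
  interpret NA: pair_prob_space \<nu> "kingman_angle s" ..
  interpret MNA: pair_prob_space \<mu> "\<nu> \<Otimes>\<^sub>M kingman_angle s" ..
  have sp: "space \<mu> = {0..}" "space \<nu> = {0..}"
    using \<mu> \<nu> by (auto simp: prob_measures_def space_restrict_space dest: sets_eq_imp_space_eq)
  let ?h = "\<lambda>(x, y, u). sqrt (x\<^sup>2 + 2 * u * x * y + y\<^sup>2 :: real)"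
  have id: "(\<lambda>x. x) \<in> borel_measurable \<mu>" "(\<lambda>x. x) \<in> borel_measurable \<nu>"
      "(\<lambda>x. x) \<in> borel_measurable (kingman_angle s)"
    using \<mu> \<nu> by (auto simp: prob_measures_def sets_kingman_angle measurable_restrict_space1
        cong: measurable_cong_sets)
  let ?P = "\<mu> \<Otimes>\<^sub>M (\<nu> \<Otimes>\<^sub>M kingman_angle s)"
  have coord: "(\<lambda>p. fst p) \<in> borel_measurable ?P" "(\<lambda>p. fst (snd p)) \<in> borel_measurable ?P"
      "(\<lambda>p. snd (snd p)) \<in> borel_measurable ?P"
    using measurable_compose[OF measurable_fst id(1)]
      measurable_compose[OF measurable_compose[OF measurable_snd measurable_fst] id(2)]
      measurable_compose[OF measurable_compose[OF measurable_snd measurable_snd] id(3)] by blast+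
  have h: "?h \<in> measurable (\<mu> \<Otimes>\<^sub>M (\<nu> \<Otimes>\<^sub>M kingman_angle s)) (borel_on {0..})"
  proof (rule measurable_restrict_space2)
    show "?h \<in> space (\<mu> \<Otimes>\<^sub>M (\<nu> \<Otimes>\<^sub>M kingman_angle s)) \<rightarrow> {0..}"
      by (auto simp: space_pair_measure sp space_kingman_angle kingman_arg_nonneg)
    show "?h \<in> borel_measurable (\<mu> \<Otimes>\<^sub>M (\<nu> \<Otimes>\<^sub>M kingman_angle s))"
      unfolding split_beta'
      by (intro measurable_compose[OF _ borel_measurable_continuous_onI[of sqrt]] continuous_intros borel_measurable_add borel_measurable_times
          borel_measurable_power borel_measurable_const coord)
  qed
  have fm: "f \<in> borel_measurable (borel_on {0..})"
    using f(1) by (rule borel_measurable_continuous_on_restrict)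
  obtain B where B: "\<And>z. z \<ge> 0 \<Longrightarrow> \<bar>f z\<bar> \<le> B"
    using f(2) by (auto simp: bounded_iff)
  have fh: "(\<lambda>p. f (?h p)) \<in> borel_measurable (\<mu> \<Otimes>\<^sub>M (\<nu> \<Otimes>\<^sub>M kingman_angle s))"
    using h fm by (rule measurable_compose)
  have int: "integrable (\<mu> \<Otimes>\<^sub>M (\<nu> \<Otimes>\<^sub>M kingman_angle s)) (\<lambda>p. f (?h p))"
    by (rule MNA.P.integrable_const_bound[where B = B, OF AE_I2 fh])
       (auto simp: space_pair_measure sp space_kingman_angle kingman_arg_nonneg intro!: B)
  have "(\<integral>z. f z \<partial>kingman_conv s \<mu> \<nu>) = (\<integral>p. f (?h p) \<partial>(\<mu> \<Otimes>\<^sub>M (\<nu> \<Otimes>\<^sub>M kingman_angle s)))"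
    unfolding kingman_conv_def by (rule integral_distr[OF h fm])
  also have "\<dots> = (\<integral>x. (\<integral>q. f (?h (x, q)) \<partial>(\<nu> \<Otimes>\<^sub>M kingman_angle s)) \<partial>\<mu>)"
    using MNA.integral_fst[of "\<lambda>x q. f (?h (x, q))"] int by (simp add: split_beta')
  also have "\<dots> = (\<integral>x. (\<integral>y. (\<integral>u. f (?h (x, y, u)) \<partial>kingman_angle s) \<partial>\<nu>) \<partial>\<mu>)"
  proof (rule Bochner_Integration.integral_cong[OF refl])
    fix x assume x: "x \<in> space \<mu>"
    have fx: "(\<lambda>q. f (?h (x, q))) \<in> borel_measurable (\<nu> \<Otimes>\<^sub>M kingman_angle s)"
      using measurable_compose[OF measurable_Pair1'[OF x] fh] by simp
    have "integrable (\<nu> \<Otimes>\<^sub>M kingman_angle s) (\<lambda>q. f (?h (x, q)))"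
      by (rule NA.P.integrable_const_bound[where B = B, OF AE_I2 fx])
         (use x in \<open>auto simp: space_pair_measure sp space_kingman_angle kingman_arg_nonneg intro!: B\<close>)
    then show "(\<integral>q. f (?h (x, q)) \<partial>(\<nu> \<Otimes>\<^sub>M kingman_angle s))
        = (\<integral>y. (\<integral>u. f (?h (x, y, u)) \<partial>kingman_angle s) \<partial>\<nu>)"
      using NA.integral_fst[of "\<lambda>y u. f (?h (x, y, u))"] by (simp add: split_beta')
  qed
  finally show ?thesis by simp
qed

lemma integral_kingman_conv:
  fixes f :: "real \<Rightarrow> real"
  assumes s: "s > -1/2" and \<mu>: "\<mu> \<in> prob_measures {0..}" and \<nu>: "\<nu> \<in> prob_measures {0..}"
    and f: "continuous_on {0..} f" "bounded (f ` {0..})"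
  shows "(\<integral>z. f z \<partial>kingman_conv s \<mu> \<nu>) = Gamma (s + 1) / (sqrt pi * Gamma (s + 1/2)) *
    (\<integral>x. (\<integral>y. (LINT u:{-1..1}|lborel.
       f (sqrt (x\<^sup>2 + 2 * u * x * y + y\<^sup>2)) * (1 - u\<^sup>2) powr (s - 1/2)) \<partial>\<nu>) \<partial>\<mu>)"
proof -
  have sp: "space \<mu> = {0..}" "space \<nu> = {0..}"
    using \<mu> \<nu> by (auto simp: prob_measures_def space_restrict_space dest: sets_eq_imp_space_eq)
  have C: "kingman_const s > 0" using s by (simp add: kingman_const_def)
  have inner: "(\<integral>u. f (sqrt (x\<^sup>2 + 2 * u * x * y + y\<^sup>2)) \<partial>kingman_angle s) =
      kingman_const s * (LINT u:{-1..1}|lborel. f (sqrt (x\<^sup>2 + 2 * u * x * y + y\<^sup>2)) * (1 - u\<^sup>2) powr (s - 1/2))"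
    if "x \<ge> 0" "y \<ge> 0" for x y
  proof -
    have m: "(\<lambda>u. f (sqrt (x\<^sup>2 + 2 * u * x * y + y\<^sup>2))) \<in> borel_measurable (restrict_space lborel {-1..1})"
    proof -
      have "continuous_on {-1..1} (\<lambda>u. f (sqrt (x\<^sup>2 + 2 * u * x * y + y\<^sup>2)))"
        by (rule continuous_on_compose2[OF f(1)])
           (use that in \<open>auto intro!: continuous_intros simp: kingman_arg_nonneg\<close>)
      from borel_measurable_continuous_on_restrict[OF this] show ?thesis
        by (simp add: sets_restrict_space cong: measurable_cong_sets)
    qed
    have "(\<integral>u. f (sqrt (x\<^sup>2 + 2 * u * x * y + y\<^sup>2)) \<partial>kingman_angle s)
        = (\<integral>u. (kingman_const s * (1 - u\<^sup>2) powr (s - 1/2)) *\<^sub>R f (sqrt (x\<^sup>2 + 2 * u * x * y + y\<^sup>2)) \<partial>restrict_space lborel {-1..1})"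
    proof -
      have "(\<lambda>u. kingman_const s * (1 - u\<^sup>2) powr (s - 1/2)) \<in> borel_measurable (restrict_space lborel {-1..1})"
        by (rule measurable_restrict_space1) simp
      moreover have "AE u in restrict_space lborel {-1..1}. 0 \<le> kingman_const s * (1 - u\<^sup>2) powr (s - 1/2)"
        using C by simp
      moreover have "kingman_angle s = density (restrict_space lborel {-1..1})
          (\<lambda>u. ennreal (kingman_const s * (1 - u\<^sup>2) powr (s - 1/2)))"
        using s by (simp add: kingman_angle_def)
      ultimately show ?thesis using integral_density[OF m] by simp
    qed
    also have "\<dots> = (\<integral>u. kingman_const s * (indicator {-1..1} u *\<^sub>R (f (sqrt (x\<^sup>2 + 2 * u * x * y + y\<^sup>2)) * (1 - u\<^sup>2) powr (s - 1/2))) \<partial>lborel)"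
      by (subst integral_restrict_space) (auto simp: mult_ac)
    finally show ?thesis by (simp add: set_lebesgue_integral_def)
  qed
  have "(\<integral>z. f z \<partial>kingman_conv s \<mu> \<nu>) =
    (\<integral>x. (\<integral>y. (\<integral>u. f (sqrt (x\<^sup>2 + 2 * u * x * y + y\<^sup>2)) \<partial>kingman_angle s) \<partial>\<nu>) \<partial>\<mu>)"
    using s by (intro integral_kingman_conv_aux \<mu> \<nu> f) simp
  also have "\<dots> = (\<integral>x. (\<integral>y. kingman_const s * (LINT u:{-1..1}|lborel. f (sqrt (x\<^sup>2 + 2 * u * x * y + y\<^sup>2)) * (1 - u\<^sup>2) powr (s - 1/2)) \<partial>\<nu>) \<partial>\<mu>)"
    by (intro Bochner_Integration.integral_cong refl inner) (auto simp: sp)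
  finally show ?thesis by (simp add: kingman_const_def)
qed

lemma integral_kingman_conv_neg_half:
  fixes f :: "real \<Rightarrow> real"
  assumes \<mu>: "\<mu> \<in> prob_measures {0..}" and \<nu>: "\<nu> \<in> prob_measures {0..}"
    and f: "continuous_on {0..} f" "bounded (f ` {0..})"
  shows "(\<integral>z. f z \<partial>kingman_conv (-1/2) \<mu> \<nu>) =
    (\<integral>x. (\<integral>y. (f \<bar>x - y\<bar> + f (x + y)) / 2 \<partial>\<nu>) \<partial>\<mu>)"
proof -
  have sp: "space \<mu> = {0..}" "space \<nu> = {0..}"
    using \<mu> \<nu> by (auto simp: prob_measures_def space_restrict_space dest: sets_eq_imp_space_eq)
  have inner: "(\<integral>u. f (sqrt (x\<^sup>2 + 2 * u * x * y + y\<^sup>2)) \<partial>kingman_angle (-1/2)) = (f \<bar>x - y\<bar> + f (x + y)) / 2"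
    if xy: "x \<ge> 0" "y \<ge> 0" for x y
  proof -
    have sq: "x\<^sup>2 - 2 * x * y + y\<^sup>2 = (x - y)\<^sup>2" "x\<^sup>2 + 2 * x * y + y\<^sup>2 = (x + y)\<^sup>2"
      by (simp_all add: power2_diff power2_sum)
    have m: "(\<lambda>u. f (sqrt (x\<^sup>2 + 2 * u * x * y + y\<^sup>2))) \<in> borel_measurable (borel_on {-1..1})"
      by (rule borel_measurable_continuous_on_restrict, rule continuous_on_compose2[OF f(1)])
         (use that in \<open>auto intro!: continuous_intros simp: kingman_arg_nonneg\<close>)
    have "(\<integral>u. f (sqrt (x\<^sup>2 + 2 * u * x * y + y\<^sup>2)) \<partial>kingman_angle (-1/2))
       = (\<integral>u. f (sqrt (x\<^sup>2 + 2 * u * x * y + y\<^sup>2)) \<partial>uniform_count_measure {-1, 1})"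
    proof -
      have "(\<lambda>u. u) \<in> measurable (uniform_count_measure {-1, 1}) (borel_on {-1..1 :: real})"
        by (auto simp: measurable_def space_restrict_space space_uniform_count_measure sets_uniform_count_measure)
      moreover have "kingman_angle (-1/2) = distr (uniform_count_measure {-1, 1}) (borel_on {-1..1}) (\<lambda>u. u)"
        by (simp add: kingman_angle_def)
      ultimately show ?thesis by (simp only: integral_distr[OF _ m])
    qed
    also have "\<dots> = (f \<bar>x - y\<bar> + f (x + y)) / 2"
      using xy by (subst integral_uniform_count_measure) (simp_all add: sq)
    finally show ?thesis .
  qed
  have "(\<integral>z. f z \<partial>kingman_conv (-1/2) \<mu> \<nu>) =
    (\<integral>x. (\<integral>y. (\<integral>u. f (sqrt (x\<^sup>2 + 2 * u * x * y + y\<^sup>2)) \<partial>kingman_angle (-1/2)) \<partial>\<nu>) \<partial>\<mu>)"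
    by (intro integral_kingman_conv_aux \<mu> \<nu> f) simp
  also have "\<dots> = (\<integral>x. (\<integral>y. (f \<bar>x - y\<bar> + f (x + y)) / 2 \<partial>\<nu>) \<partial>\<mu>)"
    by (intro Bochner_Integration.integral_cong refl inner) (auto simp: sp)
  finally show ?thesis .
qed

end

theory Submission
  imports Defs
begin

text \<open>The law \<open>F_law s\<close> is the Kingman angle law itself: its moments satisfy a two-term recursion
  (integration by parts), which gives Poisson's integral for \<open>\<Lambda>\<^sub>s\<close>, and Vandermonde's identity
  for the coefficients of \<open>\<Lambda>\<^sub>s\<close> gives the product formula that makes \<open>F_map\<close> multiplicative.

  The topological part rests on the fact that a Rayleigh mixture of the functions
  \<open>c \<mapsto> \<Prod> \<Lambda>\<^sub>s(t\<^sub>j c\<^sub>j)\<close> is Gaussian. Hence integrals of monomials in \<open>exp (- c\<^sub>j\<^sup>2)\<close> against \<open>G\<close> are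
  integrals of bounded continuous functions against \<open>F_map s G\<close>, and by Stone--Weierstrass the weak
  topology on the image controls the one on the source. For closedness, a point of the closure is
  approximated along a sequence on countably many test functions; the sources, transported to the
  unit cube by \<open>c \<mapsto> exp (- c\<^sub>j\<^sup>2)\<close>, have a convergent subsequence, and no mass escapes to the
  face \<open>z\<^sub>j = 0\<close> that corresponds to infinity. Compactness on the cube is reduced to Helly's theorem on
  the line by a space-filling curve with a Borel section.\<close>


section \<open>The Kingman angle law\<close>

text \<open>Every algebraic claim becomes an identity between products of characteristic functions,
  and uniqueness on R^k is derived from uniqueness on the line. The two-point angle law at s = -1/2
  is treated apart only in the integration by parts and the first moment; from the moment recursion
  on, the argument is uniform in s. The obstacle in the topological part is that mass of G may run
  to infinity while the image law shows G only through averages. The coordinates exp(- c_j^2) map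
  the orthant homeomorphically onto (0,1]^k, and their integer powers are Gaussians, which the image
  law can see. Near a given law on the orthant the integral of one cutoff function already controls
  the lost mass; this suffices for the inverse map. For closedness no such law is given in advance:
  there small powers 1/(n+1) of the coordinates detect mass on the missing faces, and cosines and
  sines at countably many frequencies identify the limit. The weak topology is given by a subbase,
  so passing to sequences has to be paid for by fixing a countable family of test functions
  beforehand.\<close>

lemma borel_on_UNIV: "borel_on UNIV = borel"
  by (rule measure_eqI) (auto simp: sets_restrict_space emeasure_restrict_space)

text \<open>The angle law is moved from [-1,1] to the whole line, where it is a
  \<open>real_distribution\<close> and the one-dimensional theory of \<open>char\<close>
  applies.\<close>

definition angle_law :: "real \<Rightarrow> real measure" where
  "angle_law s = distr (kingman_angle s) borel (\<lambda>u. u)"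

lemma measurable_id_kingman_angle [measurable]: "(\<lambda>u. u) \<in> borel_measurable (kingman_angle s)"
  by (simp add: measurable_restrict_space1 sets_kingman_angle cong: measurable_cong_sets)

lemma real_distribution_angle_law: "s \<ge> -1/2 \<Longrightarrow> real_distribution (angle_law s)"
  unfolding angle_law_def real_distribution_def real_distribution_axioms_def
  by (auto intro!: prob_space.prob_space_distr prob_space_kingman_angle)

lemma sets_angle_law [simp, measurable_cong]: "sets (angle_law s) = sets borel"
  by (simp add: angle_law_def)

lemma space_angle_law [simp]: "space (angle_law s) = UNIV"
  by (simp add: angle_law_def)

lemma measure_angle_law_UNIV [simp]: assumes "s \<ge> -1/2" shows "measure (angle_law s) UNIV = 1"
proof -
  interpret real_distribution "angle_law s" by (rule real_distribution_angle_law[OF assms])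
  show ?thesis using prob_space by simp
qed

lemma AE_angle_law: "AE u in angle_law s. u \<in> {-1..1}"
  unfolding angle_law_def by (subst AE_distr_iff) (auto simp: space_kingman_angle)

lemma integrable_angle_law:
  fixes f :: "real \<Rightarrow> 'a::{banach, second_countable_topology}"
  assumes s: "s \<ge> -1/2" and f: "f \<in> borel_measurable borel" and B: "\<And>u. u \<in> {-1..1} \<Longrightarrow> norm (f u) \<le> B"
  shows "integrable (angle_law s) f"
proof -
  interpret real_distribution "angle_law s" by (rule real_distribution_angle_law[OF s])
  show ?thesis
    by (rule integrable_const_bound[where B = B]) (use AE_angle_law[of s] f B in \<open>auto cong: measurable_cong_sets\<close>)
qed

lemma integral_angle_law:
  fixes f :: "real \<Rightarrow> 'a::{banach, second_countable_topology}"
  assumes f: "f \<in> borel_measurable borel"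
  shows "integral\<^sup>L (angle_law s) f = integral\<^sup>L (kingman_angle s) f"
  unfolding angle_law_def by (subst integral_distr) (use f in auto)

lemma integral_angle_law_neg_half:
  fixes f :: "real \<Rightarrow> real"
  assumes [measurable]: "f \<in> borel_measurable borel"
  shows "(\<integral>u. f u \<partial>angle_law (-1/2)) = (f (-1) + f 1) / 2"
proof -
  have 1: "(\<lambda>u. u) \<in> measurable (uniform_count_measure {-1, 1}) (borel_on {-1..1 :: real})"
    by (auto simp: measurable_def space_restrict_space space_uniform_count_measure sets_uniform_count_measure)
  have 2: "f \<in> borel_measurable (borel_on {-1..1})" by (rule measurable_restrict_space1) simp
  have "(\<integral>u. f u \<partial>angle_law (-1/2)) = (\<integral>u. f u \<partial>uniform_count_measure {-1, 1})"
    unfolding integral_angle_law[OF assms] kingman_angle_def using integral_distr[OF 1 2] by simp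
  also have "\<dots> = (f (-1) + f 1) / 2"
    by (subst integral_uniform_count_measure) simp_all
  finally show ?thesis .
qed

text \<open>The density may be unbounded near the endpoints. The gauge-integral form is the one to
  which the fundamental theorem of calculus applies directly.\<close>

lemma integral_angle_law_density:
  fixes f :: "real \<Rightarrow> real"
  assumes s: "s > -1/2" and f[measurable]: "f \<in> borel_measurable borel" and B: "\<And>u. u \<in> {-1..1} \<Longrightarrow> norm (f u) \<le> B"
  shows "((\<lambda>u. kingman_const s * (1 - u\<^sup>2) powr (s - 1/2) * f u) has_integral (\<integral>u. f u \<partial>angle_law s)) {-1..1}"
proof -
  have C: "kingman_const s > 0" using s by (simp add: kingman_const_def)
  let ?d = "\<lambda>u. kingman_const s * (1 - u\<^sup>2) powr (s - 1/2)"
  have d: "?d \<in> borel_measurable (restrict_space lborel {-1..1})"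
    by (rule measurable_restrict_space1) simp
  have f': "f \<in> borel_measurable (restrict_space lborel {-1..1})"
    by (rule measurable_restrict_space1) simp
  have ae: "AE u in restrict_space lborel {-1..1}. 0 \<le> ?d u" using C by simp
  have K: "kingman_angle s = density (restrict_space lborel {-1..1}) (\<lambda>u. ennreal (?d u))"
    using s by (simp add: kingman_angle_def)
  have "integrable (angle_law s) f" using s by (intro integrable_angle_law[OF _ f B]) auto
  then have "integrable (kingman_angle s) f"
    unfolding angle_law_def by (subst (asm) integrable_distr_eq) auto
  then have i: "integrable (restrict_space lborel {-1..1}) (\<lambda>u. ?d u *\<^sub>R f u)"
    unfolding K using integrable_density[OF f' d ae] by simp
  have "(\<integral>u. f u \<partial>angle_law s) = (\<integral>u. ?d u *\<^sub>R f u \<partial>restrict_space lborel {-1..1})"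
    unfolding integral_angle_law[OF f] K using integral_density[OF f' d ae] by simp
  also have "\<dots> = (LINT u:{-1..1}|lborel. ?d u * f u)"
    by (subst integral_restrict_space) (auto simp: set_lebesgue_integral_def)
  finally have e: "(\<integral>u. f u \<partial>angle_law s) = (LINT u:{-1..1}|lborel. ?d u * f u)" .
  have "set_integrable lborel {-1..1} (\<lambda>u. ?d u * f u)"
    using i by (subst (asm) integrable_restrict_space) (auto simp: set_integrable_def)
  from integrable_integral[OF set_borel_integral_eq_integral(1)[OF this]]
  show ?thesis unfolding e set_borel_integral_eq_integral(2)[OF \<open>set_integrable lborel {-1..1} (\<lambda>u. ?d u * f u)\<close>] .
qed

text \<open>The integrand, times the density, is the derivative of \<open>u\<^sup>l (1 - u\<^sup>2)\<^bsup>s + 1/2\<^esup>\<close>.\<close>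
lemma angle_law_integral_by_parts:
  assumes s: "s \<ge> -1/2"
  shows "(\<integral>u. real l * u ^ (l - 1) * (1 - u\<^sup>2) - (2 * s + 1) * u ^ (l + 1) \<partial>angle_law s) = 0"
proof (cases "s = -1/2")
  \<comment> \<open>At the atoms -1 and 1 the factor 1 - u^2 vanishes, and 2 * s + 1 is zero as
    well.\<close>
  case True
  have [measurable]: "(\<lambda>u::real. real l * u ^ (l - 1) * (1 - u\<^sup>2) - (2 * s + 1) * u ^ (l + 1)) \<in> borel_measurable borel" by simp
  show ?thesis using integral_angle_law_neg_half[of "\<lambda>u. real l * u ^ (l - 1) * (1 - u\<^sup>2) - (2 * s + 1) * u ^ (l + 1)"] True
    by (simp)
next
  case False
  with s have s': "s > -1/2" by simp
  \<comment> \<open>For l = 0 the truncated exponent \<open>l - 1\<close> does no harm, since its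
    coefficient is 0.\<close>
  let ?q = "\<lambda>u::real. real l * u ^ (l - 1) * (1 - u\<^sup>2) - (2 * s + 1) * u ^ (l + 1)"
  let ?C = "kingman_const s"
  have "compact (?q ` {-1..1})" by (intro compact_continuous_image continuous_intros) auto
  then obtain B where B: "\<And>u. u \<in> {-1..1} \<Longrightarrow> norm (?q u) \<le> B"
    using compact_imp_bounded bounded_iff by (metis (no_types, lifting) imageI)
  have 1: "((\<lambda>u. ?C * (1 - u\<^sup>2) powr (s - 1/2) * ?q u) has_integral (\<integral>u. ?q u \<partial>angle_law s)) {-1..1}"
    by (rule integral_angle_law_density[OF s' _ B]) auto
  let ?g = "\<lambda>u::real. ?C * (u ^ l * (1 - u\<^sup>2) powr (s + 1/2))"
  \<comment> \<open>\<open>?g\<close> is continuous on the closed interval, but for s < 1/2 the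
    factor (1 - u^2)^(s - 1/2) of its derivative blows up near the ends. The interior version of the
    theorem asks for the derivative only inside.\<close>
  have 2: "((\<lambda>u. ?C * (1 - u\<^sup>2) powr (s - 1/2) * ?q u) has_integral (?g 1 - ?g (-1))) {-1..1}"
  proof (rule fundamental_theorem_of_calculus_interior)
    show "continuous_on {-1..1} ?g"
      using s' by (intro continuous_intros continuous_on_powr') (auto simp: abs_square_le_1 abs_le_iff)
    fix u :: real assume u: "u \<in> {-1<..<1}"
    then have u2: "1 - u\<^sup>2 > 0" by (simp add: abs_square_less_1 abs_less_iff)
    have p: "(1 - u\<^sup>2) powr (s + 1/2) = (1 - u\<^sup>2) powr (s - 1/2) * (1 - u\<^sup>2)"
    proof -
      have "s + 1/2 = (s - 1/2) + 1" by simp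
      then show ?thesis using u2 by (simp only: powr_add powr_one)
    qed
    have "(?g has_real_derivative ?C * (real l * u ^ (l - 1) * (1 - u\<^sup>2) powr (s + 1/2)
         + u ^ l * ((s + 1/2) * (1 - u\<^sup>2) powr (s - 1/2) * (- 2 * u)))) (at u)"
      using u2 by (auto intro!: derivative_eq_intros simp: field_simps)
    also have "?C * (real l * u ^ (l - 1) * (1 - u\<^sup>2) powr (s + 1/2)
         + u ^ l * ((s + 1/2) * (1 - u\<^sup>2) powr (s - 1/2) * (- 2 * u))) = ?C * (1 - u\<^sup>2) powr (s - 1/2) * ?q u"
      unfolding p by (simp add: algebra_simps)
    finally show "(?g has_vector_derivative ?C * (1 - u\<^sup>2) powr (s - 1/2) * ?q u) (at u)"
      by (simp add: has_real_derivative_iff_has_vector_derivative)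
  qed simp
  have "?g 1 - ?g (-1) = 0" using s' by simp
  with has_integral_unique[OF 1 2] show ?thesis by simp
qed

section \<open>Moments of the angle law\<close>

definition angle_moment :: "real \<Rightarrow> nat \<Rightarrow> real" where
  "angle_moment s l = (\<integral>u. u ^ l \<partial>angle_law s)"

lemma integrable_power_angle_law: "s \<ge> -1/2 \<Longrightarrow> integrable (angle_law s) (\<lambda>u. u ^ l)"
  by (rule integrable_angle_law[where B = 1]) (auto simp: power_abs intro!: power_le_one)

lemma angle_moment_0: assumes "s \<ge> -1/2" shows "angle_moment s 0 = 1"
  using assms by (simp add: angle_moment_def)

text \<open>For l = 0 integration by parts gives (2s + 1) m_1 = 0, which says nothing at s = -1/2;
  there the two atoms cancel.\<close>

lemma angle_moment_1: assumes "s \<ge> -1/2" shows "angle_moment s (Suc 0) = 0"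
proof (cases "s = -1/2")
  case True then show ?thesis using integral_angle_law_neg_half[of "\<lambda>u. u"] by (simp add: angle_moment_def)
next
  case False
  with assms show ?thesis using angle_law_integral_by_parts[of s 0] by (simp add: angle_moment_def)
qed

text \<open>Integration by parts with \<open>Suc l\<close>, after collecting the powers l and l + 2
  of u.\<close>

lemma angle_moment_Suc_Suc:
  assumes s: "s \<ge> -1/2"
  shows "(real l + 2 * s + 2) * angle_moment s (Suc (Suc l)) = (real l + 1) * angle_moment s l"
proof -
  have "(\<lambda>u. real (l+1) * u ^ l - (real l + 2 * s + 2) * u ^ (Suc (Suc l)))
      = (\<lambda>u::real. real (Suc l) * u ^ (Suc l - 1) * (1 - u\<^sup>2) - (2 * s + 1) * u ^ (Suc l + 1))"
    by (rule ext) (simp add: algebra_simps power2_eq_square)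
  then have "0 = (\<integral>u. real (l+1) * u ^ l - (real l + 2 * s + 2) * u ^ (Suc (Suc l)) \<partial>angle_law s)"
    using angle_law_integral_by_parts[OF s, of "Suc l"] by (simp only:)
  also have "\<dots> = real (l+1) * angle_moment s l - (real l + 2 * s + 2) * angle_moment s (Suc (Suc l))"
    unfolding angle_moment_def
    by (subst Bochner_Integration.integral_diff)
       (auto intro!: integrable_mult_right integrable_power_angle_law s simp del: power_Suc)
  finally have "real (l+1) * angle_moment s l - (real l + 2 * s + 2) * angle_moment s (Suc (Suc l)) = 0" by (rule sym)
  then show ?thesis by (simp only: right_minus_eq of_nat_add of_nat_1)
qed

lemma angle_moment_odd: assumes s: "s \<ge> -1/2" shows "angle_moment s (2 * m + 1) = 0"
proof (induction m)
  case 0 then show ?case using angle_moment_1[OF s] by simp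
next
  case (Suc m)
  have "Suc (Suc (2 * m + 1)) = 2 * Suc m + 1" by simp
  with angle_moment_Suc_Suc[OF s, of "2 * m + 1"] Suc
  have "(real (2 * m + 1) + 2 * s + 2) * angle_moment s (2 * Suc m + 1) = 0" by (simp only: mult_zero_right)
  moreover have "real (2 * m + 1) + 2 * s + 2 > 0" using s by linarith
  ultimately show ?case by (metis mult_eq_0_iff less_irrefl)
qed

text \<open>For l = 2m the factor in the recursion is 2 (s + m + 1), which the functional equation
  of Gamma absorbs.\<close>

lemma angle_moment_even:
  assumes s: "s \<ge> -1/2"
  shows "angle_moment s (2 * m) = Gamma (s + 1) * fact (2 * m) / (4 ^ m * fact m * Gamma (s + real m + 1))"
proof (induction m)
  case 0
  have "Gamma (s + 1) > 0" using s by (intro Gamma_real_pos) simp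
  then show ?case using angle_moment_0[OF s] by simp
next
  case (Suc m)
  have g: "Gamma (s + real (Suc m) + 1) = (s + real m + 1) * Gamma (s + real m + 1)"
  proof -
    have z: "s + real m + 1 \<notin> \<int>\<^sub>\<le>\<^sub>0" using s by (auto elim!: nonpos_Ints_cases)
    have "s + real (Suc m) + 1 = (s + real m + 1) + 1" by simp
    then show ?thesis using Gamma_plus1[OF z] by (simp only:)
  qed
  have p: "Gamma (s + real m + 1) > 0" using s by (intro Gamma_real_pos) simp
  have p2: "s + real m + 1 > 0" using s by simp
  have "2 * (s + real m + 1) * angle_moment s (2 * Suc m) = (2 * real m + 1) * angle_moment s (2 * m)"
    using angle_moment_Suc_Suc[OF s, of "2 * m"] by (simp add: algebra_simps)
  then have "angle_moment s (2 * Suc m) = (2 * real m + 1) * angle_moment s (2 * m) / (2 * (s + real m + 1))"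
    using p2 by (simp add: field_simps)
  also have "\<dots> = Gamma (s + 1) * fact (2 * Suc m) / (4 ^ Suc m * fact (Suc m) * Gamma (s + real (Suc m) + 1))"
    unfolding Suc g using p p2 by (simp add: divide_simps) (simp add: algebra_simps)
  finally show ?case .
qed

section \<open>The power series of the kernel and Poisson's integral\<close>

definition Lambda_coeff :: "real \<Rightarrow> nat \<Rightarrow> real" where
  "Lambda_coeff s n = (-1) ^ n * Gamma (s + 1) / (4 ^ n * fact n * Gamma (s + real n + 1))"

text \<open>Coefficient by coefficient this is Poisson's integral: the cosine coefficients weighted
  with the moments of the angle law.\<close>

lemma Lambda_coeff_moment:
  assumes "s \<ge> -1/2"
  shows "Lambda_coeff s n = (-1) ^ n / fact (2 * n) * angle_moment s (2 * n)"
  unfolding angle_moment_even[OF assms] Lambda_coeff_def by simp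

lemma Lambda_fun_coeff: "Lambda_fun s x = (\<Sum>n. Lambda_coeff s n * x ^ (2 * n))"
  unfolding Lambda_fun_def Lambda_coeff_def
  by (intro suminf_cong) (simp add: power_divide power_mult)

lemma abs_angle_moment_le:
  assumes s: "s \<ge> -1/2" shows "\<bar>angle_moment s l\<bar> \<le> 1"
proof -
  interpret real_distribution "angle_law s" by (rule real_distribution_angle_law[OF s])
  have "\<bar>angle_moment s l\<bar> \<le> (\<integral>u. 1 \<partial>angle_law s)"
    unfolding angle_moment_def
    by (rule order_trans[OF integral_abs_bound], rule integral_mono_AE)
       (insert AE_angle_law[of s], rule integrable_abs[OF integrable_power_angle_law[OF s]], simp, erule eventually_mono,
        auto simp: power_abs intro!: power_le_one)
  then show ?thesis using s by simp
qed

lemma summable_exp_even: "summable (\<lambda>n. \<bar>x::real\<bar> ^ (2 * n) / fact (2 * n))"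
proof (rule summable_comparison_test'[OF summable_exp[of "x\<^sup>2"], of 0])
  fix n
  have "\<bar>x\<bar> ^ (2 * n) / fact (2 * n) \<le> (x\<^sup>2) ^ n / fact n"
    by (simp add: power_mult frac_le fact_mono)
  then show "norm (\<bar>x\<bar> ^ (2 * n) / fact (2 * n)) \<le> inverse (fact n) * (x\<^sup>2) ^ n" by (simp add: field_simps)
qed

text \<open>The moments are at most 1 in absolute value, so the series of cosh dominates.\<close>

lemma summable_Lambda:
  assumes s: "s \<ge> -1/2" shows "summable (\<lambda>n. \<bar>Lambda_coeff s n * x ^ (2 * n)\<bar>)"
proof (rule summable_comparison_test'[OF summable_exp_even[of x], of 0])
  fix n
  have "\<bar>angle_moment s (2 * n)\<bar> * (\<bar>x\<bar> ^ (2 * n) / fact (2 * n)) \<le> 1 * (\<bar>x\<bar> ^ (2 * n) / fact (2 * n))"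
    by (intro mult_right_mono abs_angle_moment_le s) simp
  then show "norm \<bar>Lambda_coeff s n * x ^ (2 * n)\<bar> \<le> \<bar>x\<bar> ^ (2 * n) / fact (2 * n)"
    unfolding Lambda_coeff_moment[OF s] by (simp add: abs_mult power_abs mult_ac)
qed

text \<open>Almost surely |u| <= 1, so absolutely summable coefficients are enough for termwise
  integration. The exponents \<open>e n\<close> are left free to serve both the cosine and the sine
  series.\<close>

lemma angle_law_power_series_sums:
  assumes s: "s \<ge> -1/2" and a: "summable (\<lambda>n. \<bar>a n\<bar>)"
  shows "(\<lambda>n. a n * angle_moment s (e n)) sums (\<integral>u. (\<Sum>n. a n * u ^ e n) \<partial>angle_law s)"
proof -
  let ?f = "\<lambda>n u. a n * u ^ e n"
  have i: "integrable (angle_law s) (?f n)" for n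
    by (intro integrable_mult_right integrable_power_angle_law s)
  have le: "norm (?f n u) \<le> \<bar>a n\<bar>" if "u \<in> {-1..1}" for n u
    using that by (auto simp: abs_mult power_abs intro!: mult_left_le power_le_one)
  have "(\<lambda>n. integral\<^sup>L (angle_law s) (?f n)) sums (\<integral>u. (\<Sum>n. ?f n u) \<partial>angle_law s)"
  proof (rule sums_integral[OF i])
    show "AE u in angle_law s. summable (\<lambda>n. norm (?f n u))"
      using AE_angle_law[of s]
    proof (rule eventually_mono)
      fix u :: real assume "u \<in> {-1..1}"
      then show "summable (\<lambda>n. norm (?f n u))"
        by (intro summable_comparison_test'[OF a, of 0]) (simp only: real_norm_def abs_abs le[unfolded real_norm_def])
    qed
    show "summable (\<lambda>n. \<integral>u. norm (?f n u) \<partial>angle_law s)"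
    proof (rule summable_comparison_test'[OF a, of 0])
      fix n
      have "(\<integral>u. norm (?f n u) \<partial>angle_law s) \<le> (\<integral>u. \<bar>a n\<bar> \<partial>angle_law s)"
      proof (rule integral_mono_AE)
        show "integrable (angle_law s) (\<lambda>u. \<bar>a n\<bar>)" by (rule integrable_angle_law[OF s]) auto
        show "AE u in angle_law s. norm (?f n u) \<le> \<bar>a n\<bar>"
          using AE_angle_law[of s] by (rule eventually_mono) (rule le)
      qed (rule integrable_norm[OF i])
      then show "norm (\<integral>u. norm (?f n u) \<partial>angle_law s) \<le> \<bar>a n\<bar>" using s by simp
    qed
  qed
  then show ?thesis by (simp add: angle_moment_def)
qed

lemma integral_cos_angle_law:
  assumes s: "s \<ge> -1/2" shows "(\<integral>u. cos (t * u) \<partial>angle_law s) = Lambda_fun s t"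
proof -
  let ?a = "\<lambda>n. (-1) ^ n / fact (2 * n) * t ^ (2 * n)"
  have "(\<Sum>n. ?a n * u ^ (2 * n)) = cos (t * u)" for u
    using cos_paired[of "t * u"] by (simp add: sums_iff power_mult_distrib mult.assoc)
  moreover have "summable (\<lambda>n. \<bar>?a n\<bar>)" using summable_exp_even[of t] by (simp add: abs_mult power_abs)
  moreover have "?a n * angle_moment s (2 * n) = Lambda_coeff s n * t ^ (2 * n)" for n
    by (simp add: Lambda_coeff_moment[OF s])
  ultimately show ?thesis
    using angle_law_power_series_sums[OF s, of ?a "\<lambda>n. 2 * n"] by (simp only: Lambda_fun_coeff sums_iff)
qed

lemma integral_sin_angle_law:
  assumes s: "s \<ge> -1/2" shows "(\<integral>u. sin (t * u) \<partial>angle_law s) = 0"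
proof -
  let ?a = "\<lambda>n. (-1) ^ n / fact (2 * n + 1) * t ^ (2 * n + 1)"
  have "(\<Sum>n. ?a n * u ^ (2 * n + 1)) = sin (t * u)" for u
    using sin_paired[of "t * u"] by (simp add: sums_iff power_mult_distrib mult_ac)
  moreover have "summable (\<lambda>n. \<bar>?a n\<bar>)"
  proof (rule summable_comparison_test'[OF summable_mult[OF summable_exp_even[of t], of "\<bar>t\<bar>"], of 0])
    fix n
    have "\<bar>t\<bar> ^ (2 * n + 1) / fact (2 * n + 1) \<le> \<bar>t\<bar> ^ (2 * n + 1) / fact (2 * n)"
      by (intro divide_left_mono fact_mono mult_pos_pos) auto
    then show "norm \<bar>?a n\<bar> \<le> \<bar>t\<bar> * (\<bar>t\<bar> ^ (2 * n) / fact (2 * n))" by (simp add: abs_mult power_abs)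
  qed
  ultimately show ?thesis
    using angle_law_power_series_sums[OF s, of ?a "\<lambda>n. 2 * n + 1"]
    by (simp only: angle_moment_odd[OF s] mult_zero_right sums_iff suminf_zero)
qed

lemma char_angle_law:
  assumes s: "s \<ge> -1/2" shows "char (angle_law s) t = complex_of_real (Lambda_fun s t)"
proof -
  have i: "integrable (angle_law s) (\<lambda>u. complex_of_real (cos (t * u)))" "integrable (angle_law s) (\<lambda>u. \<i> * complex_of_real (sin (t * u)))"
    by (rule integrable_angle_law[OF s, where B=1]; simp add: norm_mult)+
  have "char (angle_law s) t = (CLINT u|angle_law s. complex_of_real (cos (t * u)) + \<i> * complex_of_real (sin (t * u)))"
    unfolding char_def by (intro Bochner_Integration.integral_cong refl) (simp add: exp_Euler cos_of_real sin_of_real flip: of_real_mult)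
  also have "\<dots> = (CLINT u|angle_law s. complex_of_real (cos (t * u))) + (CLINT u|angle_law s. \<i> * complex_of_real (sin (t * u)))"
    by (rule Bochner_Integration.integral_add[OF i])
  finally show ?thesis by (simp add: integral_cos_angle_law[OF s] integral_sin_angle_law[OF s])
qed

section \<open>Identification of F_s with the angle law\<close>

lemma Lambda_fun_minus: "Lambda_fun s (- x) = Lambda_fun s x"
  by (simp add: Lambda_fun_def)

lemma Lambda_fun_0: assumes "s \<ge> -1/2" shows "Lambda_fun s 0 = 1"
  using integral_cos_angle_law[OF assms, of 0] angle_moment_0[OF assms] by (simp add: angle_moment_def)

lemma abs_Lambda_fun_le:
  assumes s: "s \<ge> -1/2" shows "\<bar>Lambda_fun s x\<bar> \<le> 1"
proof -
  interpret real_distribution "angle_law s" by (rule real_distribution_angle_law[OF s])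
  show ?thesis using cmod_char_le_1[of x] by (simp add: char_angle_law[OF s])
qed

lemma continuous_Lambda_fun:
  assumes s: "s \<ge> -1/2" shows "continuous_on UNIV (Lambda_fun s)"
proof -
  interpret real_distribution "angle_law s" by (rule real_distribution_angle_law[OF s])
  have "isCont (\<lambda>x. Re (char (angle_law s) x)) x" for x by (intro isCont_Re isCont_char)
  then show ?thesis by (simp add: char_angle_law[OF s] continuous_on_eq_continuous_at)
qed

text \<open>Existence comes from Poisson's integral and uniqueness from Levy's theorem; the symmetry
  follows because \<open>Lambda_fun s\<close> is even.\<close>

lemma F_law_eq:
  assumes s: "s \<ge> -1/2" shows "F_law s = angle_law s"
proof -
  interpret R: real_distribution "angle_law s" by (rule real_distribution_angle_law[OF s])
  show ?thesis unfolding F_law_def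
  proof (rule the_equality, intro conjI allI)
    show "angle_law s \<in> prob_measures UNIV" by (simp add: prob_measures_def borel_on_UNIV R.prob_space_axioms)
    show "emeasure (angle_law s) (- {-1..1}) = 0"
      using AE_angle_law[of s] by (subst (asm) AE_iff_measurable[OF _ refl]) (auto simp: Compl_eq)
    show char: "char (angle_law s) t = complex_of_real (Lambda_fun s t)" for t by (rule char_angle_law[OF s])
    show "dilate (- 1) (angle_law s) = angle_law s"
    proof (rule Levy_uniqueness)
      show "real_distribution (dilate (- 1) (angle_law s))"
        unfolding dilate_def real_distribution_def real_distribution_axioms_def
        by (auto intro!: R.prob_space_distr)
      have "char (dilate (- 1) (angle_law s)) t = char (angle_law s) (- t)" for t
        unfolding char_def dilate_def by (subst integral_distr) auto
      then show "char (dilate (- 1) (angle_law s)) = char (angle_law s)"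
        by (auto simp: char Lambda_fun_minus)
    qed (rule real_distribution_angle_law[OF s])
  next
    fix M assume M: "M \<in> prob_measures UNIV \<and> emeasure M (- {-1..1}) = 0 \<and>
                dilate (-1) M = M \<and> (\<forall>t. char M t = complex_of_real (Lambda_fun s t))"
    then have "real_distribution M"
      by (auto simp: prob_measures_def borel_on_UNIV real_distribution_def real_distribution_axioms_def)
    moreover have "char M = char (angle_law s)" using M by (auto simp: char_angle_law[OF s])
    ultimately show "M = angle_law s" by (intro Levy_uniqueness real_distribution_angle_law s)
  qed
qed


section \<open>The product formula\<close>

text \<open>The absolute value only matters for \<open>u\<close> outside \<open>[-1,1]\<close>, where it makes the radius a
  nonnegative Borel function on the whole line.\<close>

definition kingman_radius :: "real \<Rightarrow> real \<Rightarrow> real \<Rightarrow> real" where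
  "kingman_radius x y u = sqrt \<bar>x\<^sup>2 + 2 * u * x * y + y\<^sup>2\<bar>"

lemma kingman_radius_eq:
  assumes "x \<ge> 0" "y \<ge> 0" "u \<in> {-1..1}"
  shows "kingman_radius x y u = sqrt (x\<^sup>2 + 2 * u * x * y + y\<^sup>2)"
  using kingman_arg_nonneg[OF assms(3,1,2)] by (simp add: kingman_radius_def)

lemma kingman_radius_le:
  assumes "x \<ge> 0" "y \<ge> 0" "u \<in> {-1..1}"
  shows "kingman_radius x y u \<le> x + y"
proof -
  have "u * (x * y) \<le> 1 * (x * y)" using assms by (intro mult_right_mono) auto
  then have "x\<^sup>2 + 2 * u * x * y + y\<^sup>2 \<le> (x + y)\<^sup>2" by (simp add: power2_sum mult_ac)
  then show ?thesis unfolding kingman_radius_eq[OF assms] using assms by (intro real_le_lsqrt) auto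
qed

lemma kingman_radius_power:
  assumes "x \<ge> 0" "y \<ge> 0" "u \<in> {-1..1}"
  shows "kingman_radius x y u ^ (2 * n) = (x\<^sup>2 + y\<^sup>2 + 2 * u * x * y) ^ n"
  using kingman_arg_nonneg[OF assms(3,1,2)] by (simp add: kingman_radius_def power_mult add_ac)

text \<open>Vandermonde's identity for the binomial coefficient \<open>i + (s + j)\<close> over \<open>j\<close>.\<close>
lemma Gamma_Vandermonde:
  assumes s: "s \<ge> -1/2"
  shows "(\<Sum>m\<le>min i j. 1 / (fact (i - m) * fact (j - m) * fact m * Gamma (s + real m + 1)))
     = Gamma (s + real (i + j) + 1) / (fact i * Gamma (s + real i + 1) * (fact j * Gamma (s + real j + 1)))"
proof -
  have gch: "(s + real j) gchoose (j - m) = Gamma (s + real j + 1) / (fact (j - m) * Gamma (s + real m + 1))"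
    if "m \<le> j" for m j
  proof -
    have z: "s + real j + 1 \<notin> \<int>\<^sub>\<le>\<^sub>0" using s by (auto elim!: nonpos_Ints_cases)
    have "s + real j - real (j - m) + 1 = s + real m + 1" using that by (simp add: of_nat_diff)
    then show ?thesis using gbinomial_Gamma[OF z, of "j - m"] by simp
  qed
  have p: "Gamma (s + real m + 1) > 0" for m using s by (intro Gamma_real_pos) simp
  have "(s + real (i + j)) gchoose j = (\<Sum>m = 0..j. (real i gchoose m) * ((s + real j) gchoose (j - m)))"
    using gbinomial_Vandermonde[of "real i" "s + real j" j] by (simp add: algebra_simps)
  also have "\<dots> = (\<Sum>m = 0..j. (if m \<le> i then fact i / (fact m * fact (i - m)) else 0) *
      (Gamma (s + real j + 1) / (fact (j - m) * Gamma (s + real m + 1))))"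
    by (intro sum.cong refl) (simp add: gch binomial_gbinomial[symmetric] binomial_fact binomial_eq_0)
  also have "\<dots> = (\<Sum>m\<le>min i j. fact i * Gamma (s + real j + 1) * (1 / (fact (i - m) * fact (j - m) * fact m * Gamma (s + real m + 1))))"
    by (intro sum.mono_neutral_cong_right) (auto simp: field_simps)
  also have "\<dots> = fact i * Gamma (s + real j + 1) * (\<Sum>m\<le>min i j. 1 / (fact (i - m) * fact (j - m) * fact m * Gamma (s + real m + 1)))"
    by (simp add: sum_distrib_left)
  \<comment> \<open>The left side of Vandermonde's identity is \<open>gch\<close> with m = i and
    with j replaced by i + j, since (i + j) - i = j.\<close>
  finally have "fact i * Gamma (s + real j + 1) * (\<Sum>m\<le>min i j. 1 / (fact (i - m) * fact (j - m) * fact m * Gamma (s + real m + 1)))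
     = Gamma (s + real (i + j) + 1) / (fact j * Gamma (s + real i + 1))"
    using gch[of i "i + j"] by simp
  then have "(\<Sum>m\<le>min i j. 1 / (fact (i - m) * fact (j - m) * fact m * Gamma (s + real m + 1)))
     = Gamma (s + real (i + j) + 1) / (fact j * Gamma (s + real i + 1)) / (fact i * Gamma (s + real j + 1))"
    using p[of j] by (subst nonzero_eq_divide_eq) (simp, simp only: mult.commute)
  then show ?thesis by (simp add: mult_ac)
qed

text \<open>The exponent of c is the outer index because c = 2 u x y will carry the angle variable:
  integration turns its power into a moment.\<close>

lemma trinomial:
  fixes a b c :: real
  shows "(a + b + c) ^ n = (\<Sum>l\<le>n. \<Sum>p\<le>n - l. fact n / (fact l * fact p * fact (n - l - p)) * a ^ p * b ^ (n - l - p) * c ^ l)"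
proof -
  have "(c + (a + b)) ^ n = (\<Sum>l\<le>n. of_nat (n choose l) * c ^ l * (\<Sum>p\<le>n - l. of_nat ((n - l) choose p) * a ^ p * b ^ (n - l - p)))"
    unfolding binomial_ring[of c "a + b"] binomial_ring[of a b] ..
  also have "\<dots> = (\<Sum>l\<le>n. \<Sum>p\<le>n - l. fact n / (fact l * fact p * fact (n - l - p)) * a ^ p * b ^ (n - l - p) * c ^ l)"
    unfolding sum_distrib_left by (intro sum.cong refl) (simp add: binomial_fact field_simps)
  finally show ?thesis by (simp add: add_ac)
qed

text \<open>After trinomial expansion and integration the odd powers of u vanish. Collecting the
  rest by half the exponent of x leaves an inner sum that Vandermonde's identity evaluates. The
  right side is the degree-n part of a Cauchy product.\<close>

lemma Lambda_coeff_convolution: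
  assumes s: "s \<ge> -1/2"
  shows "Lambda_coeff s n * (\<integral>u. (x\<^sup>2 + y\<^sup>2 + 2 * u * x * y) ^ n \<partial>angle_law s)
     = (\<Sum>i\<le>n. (Lambda_coeff s i * x ^ (2 * i)) * (Lambda_coeff s (n - i) * y ^ (2 * (n - i))))"
proof -
  have p: "Gamma (s + real m + 1) > 0" for m using s by (intro Gamma_real_pos) simp
  have p0: "Gamma (s + 1) > 0" using p[of 0] by simp
  let ?g = "\<lambda>p m q. fact n / (fact (2 * m) * fact p * fact q) * x ^ (2 * (p + m)) * y ^ (2 * (q + m)) * (2 ^ (2 * m) * angle_moment s (2 * m))"
  have "(\<integral>u. (x\<^sup>2 + y\<^sup>2 + 2 * u * x * y) ^ n \<partial>angle_law s) =
     (\<integral>u. (\<Sum>l\<le>n. \<Sum>p\<le>n - l. fact n / (fact l * fact p * fact (n - l - p)) * (x\<^sup>2) ^ p * (y\<^sup>2) ^ (n - l - p) * (2 * x * y) ^ l * u ^ l) \<partial>angle_law s)"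
    unfolding trinomial by (simp add: power_mult_distrib mult_ac)
  also have "\<dots> = (\<Sum>l\<le>n. \<Sum>p\<le>n - l. fact n / (fact l * fact p * fact (n - l - p)) * (x\<^sup>2) ^ p * (y\<^sup>2) ^ (n - l - p) * (2 * x * y) ^ l * angle_moment s l)"
    unfolding angle_moment_def
    by (subst Bochner_Integration.integral_sum,
        intro Bochner_Integration.integrable_sum integrable_mult_right integrable_power_angle_law s,
        intro sum.cong refl, subst Bochner_Integration.integral_sum,
        intro integrable_mult_right integrable_power_angle_law s,
        simp only: Bochner_Integration.integral_mult_right_zero)
  also have "\<dots> = (\<Sum>(l, p)\<in>Sigma {..n} (\<lambda>l. {..n - l}). fact n / (fact l * fact p * fact (n - l - p)) * (x\<^sup>2) ^ p * (y\<^sup>2) ^ (n - l - p) * (2 * x * y) ^ l * angle_moment s l)"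
    by (subst sum.Sigma) auto
  also have "\<dots> = (\<Sum>(l, p)\<in>{(l, p) \<in> Sigma {..n} (\<lambda>l. {..n - l}). even l}. fact n / (fact l * fact p * fact (n - l - p)) * (x\<^sup>2) ^ p * (y\<^sup>2) ^ (n - l - p) * (2 * x * y) ^ l * angle_moment s l)"
  proof (intro sum.mono_neutral_right ballI)
    fix a assume "a \<in> Sigma {..n} (\<lambda>l. {..n - l}) - {(l, p) \<in> Sigma {..n} (\<lambda>l. {..n - l}). even l}"
    then obtain l p where "a = (l, p)" "odd l" by auto
    then obtain m where "a = (2 * m + 1, p)" by (auto elim: oddE)
    then show "(case a of (l, p) \<Rightarrow> fact n / (fact l * fact p * fact (n - l - p)) * (x\<^sup>2) ^ p * (y\<^sup>2) ^ (n - l - p) * (2 * x * y) ^ l * angle_moment s l) = 0"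
      by (simp only: prod.case angle_moment_odd[OF s] mult_zero_right)
  qed auto
  \<comment> \<open>New indices: l = 2m and p = i - m, so that x has exponent 2i and y has exponent
    2(n - i). The bounds 0 <= p and p <= n - l become m <= i and m <= n - i.\<close>
  also have "\<dots> = (\<Sum>(i, m)\<in>Sigma {..n} (\<lambda>i. {..min i (n - i)}). ?g (i - m) m (n - i - m))"
  proof (rule sum.reindex_bij_witness[where
        j = "\<lambda>(l, p). (p + l div 2, l div 2)" and i = "\<lambda>(i, m). (2 * m, i - m)"])
    show "(case (case a of (l, p) \<Rightarrow> (p + l div 2, l div 2)) of (i, m) \<Rightarrow> ?g (i - m) m (n - i - m)) =
      (case a of (l, p) \<Rightarrow> fact n / (fact l * fact p * fact (n - l - p)) * (x\<^sup>2) ^ p * (y\<^sup>2) ^ (n - l - p) * (2 * x * y) ^ l * angle_moment s l)"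
      if "a \<in> {(l, p) \<in> Sigma {..n} (\<lambda>l. {..n - l}). even l}" for a
    proof -
      from that obtain m p where a: "a = (2 * m, p)" and "2 * m \<le> n" "p \<le> n - 2 * m"
        by (auto elim!: evenE)
      have "n - (p + m) - m = n - 2 * m - p" by simp
      then show ?thesis unfolding a
        by (simp add: power_mult_distrib power_mult[symmetric] power_add distrib_left)
    qed
  qed (auto elim!: evenE)
  also have "\<dots> = (\<Sum>i\<le>n. \<Sum>m\<le>min i (n - i). ?g (i - m) m (n - i - m))"
    by (subst sum.Sigma) auto
  finally have e: "(\<integral>u. (x\<^sup>2 + y\<^sup>2 + 2 * u * x * y) ^ n \<partial>angle_law s) = (\<Sum>i\<le>n. \<Sum>m\<le>min i (n - i). ?g (i - m) m (n - i - m))" .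
  show ?thesis unfolding e sum_distrib_left
  proof (intro sum.cong refl)
    fix i assume "i \<in> {..n}"
    then have i: "i \<le> n" by simp
    have "(\<Sum>m\<le>min i (n - i). Lambda_coeff s n * ?g (i - m) m (n - i - m))
       = (\<Sum>m\<le>min i (n - i). Lambda_coeff s n * fact n * x ^ (2 * i) * y ^ (2 * (n - i)) * Gamma (s + 1) *
           (1 / (fact (i - m) * fact (n - i - m) * fact m * Gamma (s + real m + 1))))"
    proof (intro sum.cong refl)
      fix m assume m: "m \<in> {..min i (n - i)}"
      have 1: "2 * (i - m + m) = 2 * i" "2 * (n - i - m + m) = 2 * (n - i)" using m by auto
      have 2: "(2::real) ^ (2 * m) = 4 ^ m" by (simp add: power_mult)
      show "Lambda_coeff s n * ?g (i - m) m (n - i - m) = Lambda_coeff s n * fact n * x ^ (2 * i) * y ^ (2 * (n - i)) * Gamma (s + 1) *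
           (1 / (fact (i - m) * fact (n - i - m) * fact m * Gamma (s + real m + 1)))"
        unfolding angle_moment_even[OF s] 1 2 by simp
    qed
    also have "\<dots> = Lambda_coeff s n * fact n * x ^ (2 * i) * y ^ (2 * (n - i)) * Gamma (s + 1) *
        (Gamma (s + real n + 1) / (fact i * Gamma (s + real i + 1) * (fact (n - i) * Gamma (s + real (n - i) + 1))))"
      unfolding sum_distrib_left[symmetric] Gamma_Vandermonde[OF s] using i by simp
    also have "\<dots> = (Lambda_coeff s i * x ^ (2 * i)) * (Lambda_coeff s (n - i) * y ^ (2 * (n - i)))"
    proof -
      \<comment> \<open>Vandermonde's identity contributed the factor Gamma (s + n + 1), which
        cancels against the denominator of \<open>Lambda_coeff s n\<close>; the sign and the power
        of 4 then split along n = i + (n - i).\<close>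
      have c: "Lambda_coeff s n * fact n * Gamma (s + real n + 1) = (-1) ^ n * Gamma (s + 1) / 4 ^ n"
        unfolding Lambda_coeff_def using p[of n] by (simp add: field_simps)
      have "(-1::real) ^ n = (-1) ^ i * (-1) ^ (n - i)" "(4::real) ^ n = 4 ^ i * 4 ^ (n - i)"
        using i by (simp_all flip: power_add)
      with c have "Lambda_coeff s n * fact n * Gamma (s + real n + 1) = (-1) ^ i * (-1) ^ (n - i) * Gamma (s + 1) / (4 ^ i * 4 ^ (n - i))" by simp
      note c' = this
      let ?D = "fact i * Gamma (s + real i + 1) * (fact (n - i) * Gamma (s + real (n - i) + 1))"
      have "Lambda_coeff s n * fact n * x ^ (2 * i) * y ^ (2 * (n - i)) * Gamma (s + 1) * (Gamma (s + real n + 1) / ?D)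
          = (Lambda_coeff s n * fact n * Gamma (s + real n + 1)) * (x ^ (2 * i) * y ^ (2 * (n - i)) * Gamma (s + 1) / ?D)"
        by (simp add: divide_inverse mult_ac)
      also have "\<dots> = (Lambda_coeff s i * x ^ (2 * i)) * (Lambda_coeff s (n - i) * y ^ (2 * (n - i)))"
        unfolding c' Lambda_coeff_def[of s i] Lambda_coeff_def[of s "n - i"] by (simp add: divide_inverse mult_ac)
      finally show ?thesis .
    qed
    finally show "(\<Sum>m\<le>min i (n - i). Lambda_coeff s n * ?g (i - m) m (n - i - m)) = (Lambda_coeff s i * x ^ (2 * i)) * (Lambda_coeff s (n - i) * y ^ (2 * (n - i)))" .
  qed
qed

lemma measurable_kingman_radius [measurable]:
  "kingman_radius x y \<in> borel_measurable borel"
  unfolding kingman_radius_def by measurable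

text \<open>Summed over all degrees, the previous identity is the Cauchy product of the two series.
  This is the classical Gegenbauer product formula for normalised Bessel functions.\<close>

lemma Lambda_fun_product:
  assumes s: "s \<ge> -1/2" and xy: "x \<ge> 0" "y \<ge> 0"
  shows "(\<integral>u. Lambda_fun s (t * kingman_radius x y u) \<partial>angle_law s) = Lambda_fun s (t * x) * Lambda_fun s (t * y)"
proof -
  interpret real_distribution "angle_law s" by (rule real_distribution_angle_law[OF s])
  let ?f = "\<lambda>n u. Lambda_coeff s n * (t * kingman_radius x y u) ^ (2 * n)"
  have b: "\<bar>kingman_radius x y u\<bar> \<le> x + y" if "u \<in> {-1..1}" for u
    using kingman_radius_le[OF xy that] by (simp add: kingman_radius_def)
  \<comment> \<open>The radius never exceeds x + y, so the series at x + y dominates.\<close>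
  have bf: "\<bar>?f n u\<bar> \<le> \<bar>Lambda_coeff s n * (t * (x + y)) ^ (2 * n)\<bar>" if "u \<in> {-1..1}" for n u
    using b[OF that] xy by (simp add: abs_mult power_abs power_mult_distrib mult_left_mono power_mono)
  have i: "integrable (angle_law s) (?f n)" for n
    by (rule integrable_angle_law[OF s _ bf[unfolded real_norm_def[symmetric]]]) auto
  have "(\<lambda>n. integral\<^sup>L (angle_law s) (?f n)) sums (\<integral>u. (\<Sum>n. ?f n u) \<partial>angle_law s)"
  proof (rule sums_integral[OF i])
    show "AE u in angle_law s. summable (\<lambda>n. norm (?f n u))"
      using summable_Lambda[OF s] by auto
    show "summable (\<lambda>n. \<integral>u. norm (?f n u) \<partial>angle_law s)"
    proof (rule summable_comparison_test'[OF summable_Lambda[OF s, of "t * (x + y)"], of 0])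
      fix n
      have "(\<integral>u. norm (?f n u) \<partial>angle_law s) \<le> (\<integral>u. \<bar>Lambda_coeff s n * (t * (x + y)) ^ (2 * n)\<bar> \<partial>angle_law s)"
        by (rule integral_mono_AE)
           (insert AE_angle_law[of s], rule integrable_norm[OF i], simp, erule eventually_mono,
            simp only: real_norm_def bf)
      also have "\<dots> = \<bar>Lambda_coeff s n * (t * (x + y)) ^ (2 * n)\<bar>" using s by simp
      finally show "norm (\<integral>u. norm (?f n u) \<partial>angle_law s) \<le> \<bar>Lambda_coeff s n * (t * (x + y)) ^ (2 * n)\<bar>" by simp
    qed
  qed
  moreover have "integral\<^sup>L (angle_law s) (?f n) =
      (\<Sum>i\<le>n. (Lambda_coeff s i * (t * x) ^ (2 * i)) * (Lambda_coeff s (n - i) * (t * y) ^ (2 * (n - i))))" for n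
  proof -
    have "integral\<^sup>L (angle_law s) (?f n) = (\<integral>u. Lambda_coeff s n * ((t * x)\<^sup>2 + (t * y)\<^sup>2 + 2 * u * (t * x) * (t * y)) ^ n \<partial>angle_law s)"
    proof (rule integral_cong_AE)
      have q: "(t * kingman_radius x y u) ^ (2 * n) = ((t * x)\<^sup>2 + (t * y)\<^sup>2 + 2 * u * (t * x) * (t * y)) ^ n" if "u \<in> {-1..1}" for u
      proof -
        have "(t * kingman_radius x y u) ^ (2 * n) = (t\<^sup>2 * (x\<^sup>2 + y\<^sup>2 + 2 * u * x * y)) ^ n"
          unfolding power_mult_distrib kingman_radius_power[OF xy that] by (simp add: power_mult)
        also have "t\<^sup>2 * (x\<^sup>2 + y\<^sup>2 + 2 * u * x * y) = (t * x)\<^sup>2 + (t * y)\<^sup>2 + 2 * u * (t * x) * (t * y)"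
          by (simp add: algebra_simps power2_eq_square)
        finally show ?thesis .
      qed
      show "AE u in angle_law s. ?f n u = Lambda_coeff s n * ((t * x)\<^sup>2 + (t * y)\<^sup>2 + 2 * u * (t * x) * (t * y)) ^ n"
        by (rule eventually_mono[OF AE_angle_law[of s]]) (simp only: q)
    qed auto
    also have "\<dots> = Lambda_coeff s n * (\<integral>u. ((t * x)\<^sup>2 + (t * y)\<^sup>2 + 2 * u * (t * x) * (t * y)) ^ n \<partial>angle_law s)"
      by simp
    finally show ?thesis unfolding Lambda_coeff_convolution[OF s] .
  qed
  ultimately have "(\<lambda>n. \<Sum>i\<le>n. (Lambda_coeff s i * (t * x) ^ (2 * i)) * (Lambda_coeff s (n - i) * (t * y) ^ (2 * (n - i))))
     sums (\<integral>u. Lambda_fun s (t * kingman_radius x y u) \<partial>angle_law s)"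
    unfolding Lambda_fun_coeff by simp
  moreover have "(\<lambda>n. \<Sum>i\<le>n. (Lambda_coeff s i * (t * x) ^ (2 * i)) * (Lambda_coeff s (n - i) * (t * y) ^ (2 * (n - i))))
     sums (Lambda_fun s (t * x) * Lambda_fun s (t * y))"
    unfolding Lambda_fun_coeff
    by (rule Cauchy_product_sums) (use summable_Lambda[OF s] in \<open>simp_all only: real_norm_def\<close>)
  ultimately show ?thesis by (rule sums_unique2)
qed


section \<open>Moments of the Rayleigh law\<close>

lemma sets_rayleigh: "sets (rayleigh s) = sets (borel_on {0..})"
  by (simp add: rayleigh_def sets_restrict_space)

text \<open>Euler's integral for Gamma under the substitution y = b x^2. With b = s + 1 every even
  moment of the Rayleigh law has this form.\<close>

lemma nn_integral_Gamma_substitution: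
  fixes a b :: real
  assumes a: "a > 0" and b: "b > 0"
  shows "(\<integral>\<^sup>+x. ennreal (2 * b powr a * x powr (2 * a - 1) * exp (- b * x\<^sup>2)) * indicator {0<..} x \<partial>lborel) = ennreal (Gamma a)"
proof -
  let ?f = "\<lambda>y::real. y powr (a - 1) / exp y"
  let ?g = "\<lambda>x::real. b * x\<^sup>2"
  have G: "(?f has_integral Gamma a) {0<..}"
  proof -
    have "((\<lambda>y. if y \<in> {0<..} then ?f y else 0) has_integral Gamma a) {0..}"
      by (rule has_integral_spike[OF negligible_sing[of 0] _ Gamma_integral_real[OF a]]) auto
    then show ?thesis by (subst (asm) has_integral_restrict) auto
  qed
  then have A: "?f absolutely_integrable_on {0<..}" "integral {0<..} ?f = Gamma a"
    by (auto intro!: nonnegative_absolutely_integrable_1 integral_unique)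
  have im: "?g ` {0<..} = {0<..}"
  proof safe
    fix y :: real assume "y > 0"
    then show "y \<in> ?g ` {0<..}" using b by (intro image_eqI[of _ _ "sqrt (y / b)"]) auto
  qed (use b in auto)
  have "(\<lambda>x. \<bar>2 * b * x\<bar> * ?f (?g x)) absolutely_integrable_on {0<..} \<and>
       integral {0<..} (\<lambda>x. \<bar>2 * b * x\<bar> * ?f (?g x)) = Gamma a"
  proof (subst has_absolute_integral_change_of_variables_1'[where g = ?g and g' = "\<lambda>x. 2 * b * x"])
    show "inj_on ?g {0<..}" using b by (auto simp: inj_on_def)
  qed (use A im in \<open>auto intro!: derivative_eq_intros\<close>)
  then have "((\<lambda>x. \<bar>2 * b * x\<bar> * ?f (?g x)) has_integral Gamma a) {0<..}"
    by (auto simp: absolutely_integrable_on_def has_integral_integral)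
  then have "((\<lambda>x. 2 * b powr a * x powr (2 * a - 1) * exp (- b * x\<^sup>2)) has_integral Gamma a) {0<..}"
  proof (rule has_integral_eq[rotated])
    fix x :: real assume x: "x \<in> {0<..}"
    have 1: "b powr a = b * b powr (a - 1)" using b powr_add[of b 1 "a - 1"] by simp
    have 2: "x powr (2 * a - 1) = x * x powr (2 * (a - 1))"
      using x powr_add[of x 1 "2 * (a - 1)"] by simp
    have "x\<^sup>2 powr (a - 1) = x powr (2 * (a - 1))"
      using x powr_powr[of x 2 "a - 1"] by simp
    then have 3: "(b * x\<^sup>2) powr (a - 1) = b powr (a - 1) * x powr (2 * (a - 1))"
      using x b by (simp add: powr_mult)
    show "\<bar>2 * b * x\<bar> * ?f (?g x) = 2 * b powr a * x powr (2 * a - 1) * exp (- b * x\<^sup>2)"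
      unfolding 1 2 3 using x b by (simp add: exp_minus abs_mult divide_inverse)
  qed
  from nn_integral_has_integral_lebesgue[OF _ this] show ?thesis
    by (simp add: mult_ac ennreal_mult' ennreal_indicator)
qed

lemma nn_integral_rayleigh:
  assumes s: "s \<ge> -1/2" and f[measurable]: "f \<in> borel_measurable borel"
  shows "(\<integral>\<^sup>+x. f x \<partial>rayleigh s) = (\<integral>\<^sup>+x. ennreal (2 * (s + 1) powr (s + 1) / Gamma (s + 1) * x powr (2 * s + 1) * exp (- (s + 1) * x\<^sup>2)) * f x * indicator {0<..} x \<partial>lborel)"
proof -
  let ?d = "\<lambda>x. ennreal (2 * (s + 1) powr (s + 1) / Gamma (s + 1) * x powr (2 * s + 1) * exp (- (s + 1) * x\<^sup>2))"
  have "(\<integral>\<^sup>+x. f x \<partial>rayleigh s) = (\<integral>\<^sup>+x. ?d x * f x \<partial>restrict_space lborel {0..})"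
    unfolding rayleigh_def by (rule nn_integral_density) (rule measurable_restrict_space1, simp)+
  also have "\<dots> = (\<integral>\<^sup>+x. ?d x * f x * indicator {0..} x \<partial>lborel)"
    by (subst nn_integral_restrict_space) auto
  also have "\<dots> = (\<integral>\<^sup>+x. ?d x * f x * indicator {0<..} x \<partial>lborel)"
    using AE_lborel_singleton[of 0] by (intro nn_integral_cong_AE) (auto split: split_indicator elim!: eventually_mono)
  finally show ?thesis .
qed

text \<open>The factor x^(2n) shifts the Gamma parameter from s + 1 to s + 1 + n; the case n = 0 is
  the normalisation.\<close>

lemma nn_integral_rayleigh_even_moment:
  assumes s: "s \<ge> -1/2"
  shows "(\<integral>\<^sup>+x. ennreal (x ^ (2 * n)) \<partial>rayleigh s) = ennreal (Gamma (s + real n + 1) / (Gamma (s + 1) * (s + 1) ^ n))"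
proof -
  have p: "Gamma (s + 1) > 0" "s + 1 > 0" using s by (auto intro!: Gamma_real_pos)
  have "(\<integral>\<^sup>+x. ennreal (x ^ (2 * n)) \<partial>rayleigh s) =
     (\<integral>\<^sup>+x. ennreal (1 / (Gamma (s + 1) * (s + 1) ^ n)) * (ennreal (2 * (s + 1) powr (s + 1 + n) * x powr (2 * (s + 1 + n) - 1) * exp (- (s + 1) * x\<^sup>2)) * indicator {0<..} x) \<partial>lborel)"
  proof (subst nn_integral_rayleigh[OF s], simp, intro nn_integral_cong)
    fix x :: real
    have "2 * (s + 1) powr (s + 1) / Gamma (s + 1) * x powr (2 * s + 1) * exp (- (s + 1) * x\<^sup>2) * x ^ (2 * n) =
       (1 / (Gamma (s + 1) * (s + 1) ^ n)) * (2 * (s + 1) powr (s + 1 + n) * x powr (2 * (s + 1 + n) - 1) * exp (- (s + 1) * x\<^sup>2))"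
      if "x > 0"
    proof -
      have "x powr (2 * (s + 1 + n) - 1) = x powr (2 * s + 1) * x ^ (2 * n)"
      proof -
        have "2 * (s + 1 + n) - 1 = (2 * s + 1) + real (2 * n)" by simp
        then show ?thesis using that by (simp only: powr_add powr_realpow)
      qed
      moreover have "(s + 1) powr (s + 1 + n) = (s + 1) powr (s + 1) * (s + 1) ^ n"
        using p by (simp only: powr_add powr_realpow)
      moreover have "(s + 1) ^ n \<noteq> 0" using p by simp
      ultimately show ?thesis by (simp only:) (simp add: divide_inverse)
    qed
    moreover have "1 / (Gamma (s + 1) * (s + 1) ^ n) \<ge> 0" "x ^ (2 * n) \<ge> 0" using p by simp_all
    ultimately show "ennreal (2 * (s + 1) powr (s + 1) / Gamma (s + 1) * x powr (2 * s + 1) * exp (- (s + 1) * x\<^sup>2)) * ennreal (x ^ (2 * n)) * indicator {0<..} x =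
       ennreal (1 / (Gamma (s + 1) * (s + 1) ^ n)) * (ennreal (2 * (s + 1) powr (s + 1 + n) * x powr (2 * (s + 1 + n) - 1) * exp (- (s + 1) * x\<^sup>2)) * indicator {0<..} x)"
      by (cases "x > 0") (simp_all only: ennreal_mult''[symmetric] ennreal_mult'[symmetric] indicator_simps greaterThan_iff mult_1_right mult_zero_right not_False_eq_True)
  qed
  also have "\<dots> = ennreal (1 / (Gamma (s + 1) * (s + 1) ^ n)) * ennreal (Gamma (s + 1 + n))"
    using nn_integral_Gamma_substitution[of "s + 1 + n" "s + 1"] p by (subst nn_integral_cmult) auto
  also have "\<dots> = ennreal (Gamma (s + real n + 1) / (Gamma (s + 1) * (s + 1) ^ n))"
    using p by (subst ennreal_mult[symmetric]) (auto simp: add_ac intro!: less_imp_le[OF Gamma_real_pos])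
  finally show ?thesis .
qed

lemma prob_space_rayleigh:
  assumes s: "s \<ge> -1/2" shows "prob_space (rayleigh s)"
proof
  have "Gamma (s + 1) > 0" using s by (auto intro!: Gamma_real_pos)
  then show "emeasure (rayleigh s) (space (rayleigh s)) = 1"
    using nn_integral_rayleigh_even_moment[OF s, of 0] by simp
qed

lemma rayleigh_even_moment:
  assumes s: "s \<ge> -1/2"
  shows "integrable (rayleigh s) (\<lambda>x. x ^ (2 * n))"
    and "(\<integral>x. x ^ (2 * n) \<partial>rayleigh s) = Gamma (s + real n + 1) / (Gamma (s + 1) * (s + 1) ^ n)"
proof -
  have "0 \<le> Gamma (s + real n + 1) / (Gamma (s + 1) * (s + 1) ^ n)"
    using s by (intro divide_nonneg_nonneg mult_nonneg_nonneg less_imp_le[OF Gamma_real_pos]) auto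
  moreover have "(\<lambda>x::real. x ^ (2 * n)) \<in> borel_measurable (borel_on {0..})"
    by (rule measurable_restrict_space1) simp
  then have "(\<lambda>x. x ^ (2 * n)) \<in> borel_measurable (rayleigh s)"
    by (simp only: measurable_cong_sets[OF sets_rayleigh refl])
  ultimately have "(\<integral>\<^sup>+x. ennreal (x ^ (2 * n)) \<partial>rayleigh s) = ennreal (Gamma (s + real n + 1) / (Gamma (s + 1) * (s + 1) ^ n))
    \<longleftrightarrow> integrable (rayleigh s) (\<lambda>x. x ^ (2 * n)) \<and> (\<integral>x. x ^ (2 * n) \<partial>rayleigh s) = Gamma (s + real n + 1) / (Gamma (s + 1) * (s + 1) ^ n)"
    by (intro nn_integral_eq_integrable) simp_all
  then show "integrable (rayleigh s) (\<lambda>x. x ^ (2 * n))"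
    "(\<integral>x. x ^ (2 * n) \<partial>rayleigh s) = Gamma (s + real n + 1) / (Gamma (s + 1) * (s + 1) ^ n)"
    by (simp_all only: nn_integral_rayleigh_even_moment[OF s, of n] simp_thms)
qed

text \<open>The moment of order 2n carries the factor Gamma (s + n + 1) that
  \<open>Lambda_coeff s n\<close> has in its denominator. They cancel, and the termwise integrals
  form an exponential series.\<close>

lemma integral_Lambda_rayleigh:
  assumes s: "s \<ge> -1/2"
  shows "(\<integral>x. Lambda_fun s (t * x) \<partial>rayleigh s) = exp (- t\<^sup>2 / (4 * (s + 1)))"
proof -
  have p: "Gamma (s + real n + 1) > 0" for n using s by (auto intro!: Gamma_real_pos)
  have p1: "Gamma (s + 1) > 0" "s + 1 > 0" using p[of 0] s by auto
  let ?f = "\<lambda>n x. Lambda_coeff s n * (t * x) ^ (2 * n)"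
  let ?q = "t\<^sup>2 / (4 * (s + 1))"
  have i: "integrable (rayleigh s) (?f n)" for n
    unfolding power_mult_distrib by (intro integrable_mult_right rayleigh_even_moment s)
  have e: "(\<integral>x. ?f n x \<partial>rayleigh s) = (- ?q) ^ n /\<^sub>R fact n" for n
  proof -
    have "(- ?q) ^ n = (-1) ^ n * (t ^ (2 * n) / (4 ^ n * (s + 1) ^ n))"
      by (subst power_minus) (simp only: power_divide power_mult_distrib flip: power_mult)
    moreover have "(\<integral>x. ?f n x \<partial>rayleigh s) = Lambda_coeff s n * t ^ (2 * n) * (Gamma (s + real n + 1) / (Gamma (s + 1) * (s + 1) ^ n))"
      by (simp only: power_mult_distrib Bochner_Integration.integral_mult_right_zero rayleigh_even_moment(2)[OF s] mult.assoc)
    moreover have "Gamma (s + real n + 1) \<noteq> 0" "Gamma (s + 1) \<noteq> 0" using p[of n] p1(1) by (metis less_irrefl)+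
    ultimately show ?thesis unfolding Lambda_coeff_def by (simp only:) (simp add: field_simps)
  qed
  have "(\<lambda>n. integral\<^sup>L (rayleigh s) (?f n)) sums (\<integral>x. (\<Sum>n. ?f n x) \<partial>rayleigh s)"
  proof (rule sums_integral[OF i])
    show "AE u in rayleigh s. summable (\<lambda>n. norm (?f n u))"
      using summable_Lambda[OF s] by auto
    \<comment> \<open>The n-th term has the sign (-1)^n, so the integrals of the absolute values are
      the terms of the exponential series at \<open>?q\<close> instead of
      \<open>- ?q\<close>.\<close>
    have "(\<integral>x. norm (?f n x) \<partial>rayleigh s) = norm ((- ?q) ^ n /\<^sub>R fact n)" for n
    proof -
      have "(\<integral>x. norm (?f n x) \<partial>rayleigh s) = (\<integral>x. (-1) ^ n * ?f n x \<partial>rayleigh s)"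
      proof (intro Bochner_Integration.integral_cong refl)
        fix x
        define d where "d = Gamma (s + 1) / (4 ^ n * fact n * Gamma (s + real n + 1))"
        have d: "d \<ge> 0" unfolding d_def using p[of n] p1 by (intro divide_nonneg_nonneg mult_nonneg_nonneg) simp_all
        have c: "Lambda_coeff s n = (-1) ^ n * d" by (simp only: d_def Lambda_coeff_def times_divide_eq_right)
        have "(t * x) ^ (2 * n) \<ge> 0" by simp
        moreover have "\<bar>(-1::real) ^ n\<bar> = 1" "(-1::real) ^ n * (-1) ^ n = 1" by (simp_all add: power_abs flip: power_mult_distrib)
        ultimately show "norm (?f n x) = (-1) ^ n * ?f n x"
          unfolding c real_norm_def abs_mult using d by (simp only: abs_of_nonneg mult_1_left flip: mult.assoc)
      qed
      also have "\<dots> = (-1) ^ n * ((- ?q) ^ n /\<^sub>R fact n)" unfolding e[symmetric] by simp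
      also have "\<dots> = norm ((- ?q) ^ n /\<^sub>R fact n)"
      proof -
        have q: "?q \<ge> 0" using p1 by simp
        have "(-1) ^ n * ((- ?q) ^ n /\<^sub>R fact n) = ((-1) * (- ?q)) ^ n /\<^sub>R fact n"
          by (simp only: power_mult_distrib mult_scaleR_right)
        also have "(-1) * (- ?q) = \<bar>- ?q\<bar>" using q by (simp only: abs_minus_cancel abs_of_nonneg mult_minus_left mult_minus_right minus_minus mult_1_left)
        also have "\<bar>- ?q\<bar> ^ n /\<^sub>R fact n = norm ((- ?q) ^ n /\<^sub>R fact n)"
          by (subst norm_scaleR, subst norm_power) simp
        finally show ?thesis .
      qed
      finally show ?thesis .
    qed
    then show "summable (\<lambda>n. \<integral>u. norm (?f n u) \<partial>rayleigh s)"
      by (simp only: summable_norm_exp)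
  qed
  then have "(\<lambda>n. (- ?q) ^ n /\<^sub>R fact n) sums (\<integral>x. Lambda_fun s (t * x) \<partial>rayleigh s)"
    unfolding e Lambda_fun_coeff .
  from sums_unique2[OF this exp_converges] show ?thesis by simp
qed


section \<open>Uniqueness of characteristic functions in several dimensions\<close>

text \<open>The weighted marginals in the induction below need not have mass 1. The mass is the
  value of \<open>char\<close> at 0; after division by it Levy's theorem applies, with the null
  measure as a separate case.\<close>

lemma finite_measure_char_unique:
  fixes M N :: "real measure"
  assumes "finite_measure M" "finite_measure N" and sM[simp, measurable_cong]: "sets M = sets borel"
    and sN[simp, measurable_cong]: "sets N = sets borel" and char: "char M = char N"
  shows "M = N"
proof -
  interpret M: finite_measure M by fact
  interpret N: finite_measure N by fact
  have sp[simp]: "space M = UNIV" "space N = UNIV" using sM sN sets_eq_imp_space_eq by force+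
  have "complex_of_real (measure M UNIV) = complex_of_real (measure N UNIV)"
    using fun_cong[OF char, of 0] by (simp add: char_def)
  then have m: "measure M UNIV = measure N UNIV" by simp
  show ?thesis
  proof (cases "measure M UNIV = 0")
    case True
    have "emeasure M A = 0" "emeasure N A = 0" for A
      using emeasure_mono[of A UNIV M] emeasure_mono[of A UNIV N] True m
      by (auto simp: M.emeasure_eq_measure N.emeasure_eq_measure) (metis measure_le_0_iff M.bounded_measure N.bounded_measure sp)+
    then show ?thesis by (intro measure_eqI) auto
  next
    case False
    define c where "c = 1 / measure M UNIV"
    have c: "c > 0" using False by (simp add: c_def zero_less_measure_iff order_less_le)
    have P: "real_distribution (density K (\<lambda>_. ennreal c))"
      if "finite_measure K" "measure K UNIV = measure M UNIV" "sets K = sets borel" for K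
    proof -
      interpret K: finite_measure K by fact
      have "space K = UNIV" using that(3) sets_eq_imp_space_eq by force
      then have "emeasure (density K (\<lambda>_. ennreal c)) (space K) = 1"
        using that c False by (simp add: emeasure_density_const K.emeasure_eq_measure c_def flip: ennreal_mult)
      then have "prob_space (density K (\<lambda>_. ennreal c))" by (intro prob_spaceI) simp
      then show ?thesis using that(3) by (simp add: real_distribution_def real_distribution_axioms_def)
    qed
    have "density M (\<lambda>_. ennreal c) = density N (\<lambda>_. ennreal c)"
    proof (rule Levy_uniqueness)
      have "char (density K (\<lambda>_. ennreal c)) t = c * char K t" if [measurable_cong]: "sets K = sets borel" for K t
      proof -
        have m: "(\<lambda>x. iexp (t * x)) \<in> borel_measurable K"
          by (subst measurable_cong_sets[OF that refl]) simp
        show ?thesis unfolding char_def using c m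
          by (subst integral_density) (auto simp: scaleR_conv_of_real simp del: of_real_mult)
      qed
      then show "char (density M (\<lambda>_. ennreal c)) = char (density N (\<lambda>_. ennreal c))"
        using char by (intro ext) simp
    qed (use P[of M] P[of N] m assms in auto)
    then have "ennreal c * emeasure M A = ennreal c * emeasure N A" if "A \<in> sets borel" for A
      using that by (metis emeasure_density_const sM sN)
    then have "emeasure M A = emeasure N A" if "A \<in> sets borel" for A
      using that c by (simp add: ennreal_mult_cancel_left)
    then show ?thesis by (intro measure_eqI) auto
  qed
qed

lemma (in prob_space) integrable_bounded:
  fixes f :: "'a \<Rightarrow> 'b::{banach, second_countable_topology}"
  assumes "f \<in> borel_measurable M" "\<And>x. norm (f x) \<le> B"
  shows "integrable M f"
  by (rule integrable_const_bound[of _ B]) (use assms in auto)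

text \<open>Induction over the coordinates: for each new coordinate the weights \<open>1 + cos (\<theta> + t \<bullet> x)\<close> are
  nonnegative, so that one-dimensional uniqueness applies to the weighted marginals.\<close>

lemma integral_box_cos_eq:
  fixes M N :: "'a::euclidean_space measure"
  assumes M: "prob_space M" and N: "prob_space N"
    and sM[measurable_cong]: "sets M = sets borel" and sN[measurable_cong]: "sets N = sets borel"
    and char: "char_fun M = char_fun N"
    and A[measurable]: "\<And>b. A b \<in> sets borel" and S: "finite S"
  shows "(\<integral>x. (\<Prod>b\<in>S. indicator (A b) (x \<bullet> b)) * cos (\<theta> + t \<bullet> x) \<partial>M)
       = (\<integral>x. (\<Prod>b\<in>S. indicator (A b) (x \<bullet> b)) * cos (\<theta> + t \<bullet> x) \<partial>N)"
  using S
proof (induction S arbitrary: \<theta> t rule: finite_induct)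
  case empty
  \<comment> \<open>Multiplying the characteristic function by exp(i theta) covers the cosine and
    the sine in one formula.\<close>
  have "(\<integral>x. cos (\<theta> + t \<bullet> x) \<partial>K) = Re (exp (\<i> * \<theta>) * char_fun K t)"
    if K: "prob_space K" and [measurable_cong]: "sets K = sets borel" for K
  proof -
    interpret prob_space K by fact
    have i: "integrable K (\<lambda>x. exp (\<i> * \<theta>) * iexp (t \<bullet> x))"
      by (rule integrable_bounded[where B = 1]) (auto simp: norm_mult)
    have "Re (exp (\<i> * \<theta>) * char_fun K t) = Re (CLINT x|K. exp (\<i> * \<theta>) * iexp (t \<bullet> x))"
      unfolding char_fun_def by simp
    also have "\<dots> = (\<integral>x. Re (exp (\<i> * \<theta>) * iexp (t \<bullet> x)) \<partial>K)"
      using i by (rule integral_Re[symmetric])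
    also have "\<dots> = (\<integral>x. cos (\<theta> + t \<bullet> x) \<partial>K)"
      by (intro Bochner_Integration.integral_cong refl) (simp add: cos_add Re_exp Im_exp)
    finally show ?thesis ..
  qed
  then show ?case using M N sM sN char by simp
next
  case (insert b S)
  define P :: "'a \<Rightarrow> real" where "P x = (\<Prod>b\<in>S. indicator (A b) (x \<bullet> b))" for x
  have P[measurable]: "P \<in> borel_measurable borel" unfolding P_def by measurable
  have P01: "0 \<le> P x" "P x \<le> 1" for x
    unfolding P_def by (auto intro!: prod_nonneg prod_le_1)
  have IH: "(\<integral>x. P x * cos (\<theta> + t \<bullet> x) \<partial>M) = (\<integral>x. P x * cos (\<theta> + t \<bullet> x) \<partial>N)" for \<theta> t
    using insert.IH unfolding P_def by simp
  have Pcos: "integrable K (\<lambda>x. P x * cos (\<alpha> + t \<bullet> x))"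
    if K: "prob_space K" and [measurable_cong]: "sets K = sets borel" for K \<alpha> t
  proof -
    interpret prob_space K by fact
    show ?thesis using P01 by (intro integrable_bounded[where B = 1]) (auto simp: abs_mult intro!: mult_le_one)
  qed
  \<comment> \<open>Product-to-sum: a weighted trigonometric integral in the new coordinate splits
    into three integrals of the form in the induction hypothesis, with shifted phases and
    frequencies.\<close>
  have expand: "(\<integral>x. P x * (1 + cos (\<theta> + t \<bullet> x)) * cos (\<phi> + \<tau> * (x \<bullet> b)) \<partial>K) =
      (\<integral>x. P x * cos (\<phi> + (\<tau> *\<^sub>R b) \<bullet> x) \<partial>K) +
      ((\<integral>x. P x * cos ((\<theta> + \<phi>) + (t + \<tau> *\<^sub>R b) \<bullet> x) \<partial>K) + (\<integral>x. P x * cos ((\<theta> - \<phi>) + (t - \<tau> *\<^sub>R b) \<bullet> x) \<partial>K)) / 2"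
    if K: "prob_space K" and sK: "sets K = sets borel" for K \<theta> t \<phi> \<tau>
  proof -
    have "(\<integral>x. P x * (1 + cos (\<theta> + t \<bullet> x)) * cos (\<phi> + \<tau> * (x \<bullet> b)) \<partial>K) =
      (\<integral>x. P x * cos (\<phi> + (\<tau> *\<^sub>R b) \<bullet> x) + (P x * cos ((\<theta> + \<phi>) + (t + \<tau> *\<^sub>R b) \<bullet> x) + P x * cos ((\<theta> - \<phi>) + (t - \<tau> *\<^sub>R b) \<bullet> x)) / 2 \<partial>K)"
    proof (intro Bochner_Integration.integral_cong refl)
      fix x
      have "cos (\<theta> + t \<bullet> x) * cos (\<phi> + \<tau> * (x \<bullet> b)) = (cos ((\<theta> - \<phi>) + (t - \<tau> *\<^sub>R b) \<bullet> x) + cos ((\<theta> + \<phi>) + (t + \<tau> *\<^sub>R b) \<bullet> x)) / 2"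
        unfolding cos_times_cos by (simp add: inner_add_left inner_diff_left inner_commute[of x b] algebra_simps)
      then show "P x * (1 + cos (\<theta> + t \<bullet> x)) * cos (\<phi> + \<tau> * (x \<bullet> b)) =
         P x * cos (\<phi> + (\<tau> *\<^sub>R b) \<bullet> x) + (P x * cos ((\<theta> + \<phi>) + (t + \<tau> *\<^sub>R b) \<bullet> x) + P x * cos ((\<theta> - \<phi>) + (t - \<tau> *\<^sub>R b) \<bullet> x)) / 2"
        by (simp add: distrib_left distrib_right inner_commute[of x b] mult.assoc add_divide_distrib)
    qed
    also have "\<dots> = (\<integral>x. P x * cos (\<phi> + (\<tau> *\<^sub>R b) \<bullet> x) \<partial>K) +
      ((\<integral>x. P x * cos ((\<theta> + \<phi>) + (t + \<tau> *\<^sub>R b) \<bullet> x) \<partial>K) + (\<integral>x. P x * cos ((\<theta> - \<phi>) + (t - \<tau> *\<^sub>R b) \<bullet> x) \<partial>K)) / 2"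
    proof -
      have lin: "(\<integral>x. f x + (g x + h x) / 2 \<partial>K) = (\<integral>x. f x \<partial>K) + ((\<integral>x. g x \<partial>K) + (\<integral>x. h x \<partial>K)) / 2"
        if "integrable K f" "integrable K g" "integrable K h" for f g h :: "'a \<Rightarrow> real"
        using that by simp
      show ?thesis by (rule lin) (rule Pcos[OF that])+
    qed
    finally show ?thesis .
  qed
  have step: "(\<integral>x. indicator (A b) (x \<bullet> b) * (P x * (1 + cos (\<theta> + t \<bullet> x))) \<partial>M)
            = (\<integral>x. indicator (A b) (x \<bullet> b) * (P x * (1 + cos (\<theta> + t \<bullet> x))) \<partial>N)" for \<theta> t
  proof -
    define W where "W x = P x * (1 + cos (\<theta> + t \<bullet> x))" for x
    have W[measurable]: "W \<in> borel_measurable borel" unfolding W_def by measurable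
    have "1 + cos y \<ge> 0" "1 + cos y \<le> 2" for y :: real using cos_ge_minus_one[of y] cos_le_one[of y] by linarith+
    then have W0: "0 \<le> W x" and W2: "W x \<le> 2" for x
      using P01[of x] mult_mono[of "P x" 1 "1 + cos (\<theta> + t \<bullet> x)" 2] by (simp_all add: W_def)
    \<comment> \<open>\<open>D K\<close> is the law of coordinate b under the weight
      \<open>W\<close>. Equality of \<open>D M\<close> and \<open>D N\<close>, tested on the
      indicator of \<open>A b\<close>, is the claim.\<close>
    define D where "D K = distr (density K (\<lambda>x. ennreal (W x))) borel (\<lambda>x. x \<bullet> b)" for K
    have sD: "sets (D K) = sets borel" for K by (simp add: D_def)
    have fD: "finite_measure (D K)" if K: "prob_space K" and [measurable_cong]: "sets K = sets borel" for K
    proof -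
      interpret prob_space K by fact
      have "(\<integral>\<^sup>+x. ennreal (W x) \<partial>K) \<le> (\<integral>\<^sup>+x. 2 \<partial>K)" using W2 by (intro nn_integral_mono) (simp add: ennreal_le_iff2 flip: ennreal_numeral)
      also have "\<dots> < \<infinity>" by (simp add: emeasure_space_1)
      finally have "finite_measure (density K (\<lambda>x. ennreal (W x)))"
        by (intro finite_measureI) (simp add: emeasure_density cong: nn_integral_cong_simp)
      then show ?thesis unfolding D_def by (intro finite_measure.finite_measure_distr) auto
    qed
    have iD: "(\<integral>y. f y \<partial>D K) = (\<integral>x. W x *\<^sub>R f (x \<bullet> b) \<partial>K)"
      if [measurable_cong]: "sets K = sets borel" and [measurable]: "f \<in> borel_measurable borel"
      for K and f :: "real \<Rightarrow> 'b::{banach, second_countable_topology}"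
      unfolding D_def using W0 by (subst integral_distr) (auto simp: integral_density)
    have "D M = D N"
    proof (rule finite_measure_char_unique)
      show "char (D M) = char (D N)"
      proof
        fix \<tau>
        have i: "integrable K (\<lambda>x. W x *\<^sub>R iexp (\<tau> * (x \<bullet> b)))"
          if K: "prob_space K" and [measurable_cong]: "sets K = sets borel" for K
        proof -
          interpret prob_space K by fact
          show ?thesis using W0 W2 by (intro integrable_bounded[where B = 2]) auto
        qed
        have char_eq: "char (D K) \<tau> = (CLINT x|K. W x *\<^sub>R iexp (\<tau> * (x \<bullet> b)))" if "sets K = sets borel" for K
          unfolding char_def by (rule iD[OF that]) simp
        \<comment> \<open>In \<open>expand\<close> the phase phi = 0 yields the real part of the
          characteristic function, and phi = - pi / 2 the imaginary part.\<close>
        have Re: "Re (char (D K) \<tau>) = (\<integral>x. P x * (1 + cos (\<theta> + t \<bullet> x)) * cos (0 + \<tau> * (x \<bullet> b)) \<partial>K)"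
          if K: "prob_space K" and sK: "sets K = sets borel" for K
          unfolding char_eq[OF sK] integral_Re[OF i[OF that], symmetric]
          by (intro Bochner_Integration.integral_cong refl) (simp add: W_def Re_exp)
        have Im: "Im (char (D K) \<tau>) = (\<integral>x. P x * (1 + cos (\<theta> + t \<bullet> x)) * cos (- (pi / 2) + \<tau> * (x \<bullet> b)) \<partial>K)"
          if K: "prob_space K" and sK: "sets K = sets borel" for K
          unfolding char_eq[OF sK] integral_Im[OF i[OF that], symmetric]
        proof (intro Bochner_Integration.integral_cong refl)
          have "cos (- (pi / 2) + y) = sin y" for y by (subst cos_add) simp
          then show "Im (W x *\<^sub>R iexp (\<tau> * (x \<bullet> b))) = P x * (1 + cos (\<theta> + t \<bullet> x)) * cos (- (pi / 2) + \<tau> * (x \<bullet> b))" for x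
            by (simp only: W_def) (simp add: Im_exp)
        qed
        show "char (D M) \<tau> = char (D N) \<tau>"
          by (rule complex_eqI) (simp_all only: Re[OF M sM] Re[OF N sN] Im[OF M sM] Im[OF N sN] expand[OF M sM] expand[OF N sN] IH)
      qed
    qed (use fD M N sM sN sD in auto)
    then have "(\<integral>x. W x *\<^sub>R indicator (A b) (x \<bullet> b) \<partial>M) = (\<integral>x. W x *\<^sub>R (indicator (A b) (x \<bullet> b) :: real) \<partial>N)"
      using iD[OF sM, of "indicator (A b) :: real \<Rightarrow> real"] iD[OF sN, of "indicator (A b) :: real \<Rightarrow> real"] by simp
    then show ?thesis by (simp add: W_def mult_ac)
  qed
  \<comment> \<open>For theta = pi / 2 and t = 0 the weight is \<open>P\<close> alone. Subtracting
    this case removes the constant 1 that kept the weight nonnegative.\<close>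
  have step0: "(\<integral>x. indicator (A b) (x \<bullet> b) * P x \<partial>M) = (\<integral>x. indicator (A b) (x \<bullet> b) * P x \<partial>N)"
    using step[of "pi / 2" 0] by simp
  have split: "(\<integral>x. indicator (A b) (x \<bullet> b) * (P x * (1 + cos (\<theta> + t \<bullet> x))) \<partial>K) =
      (\<integral>x. indicator (A b) (x \<bullet> b) * P x \<partial>K) + (\<integral>x. indicator (A b) (x \<bullet> b) * P x * cos (\<theta> + t \<bullet> x) \<partial>K)"
    if K: "prob_space K" and [measurable_cong]: "sets K = sets borel" for K
  proof -
    interpret prob_space K by fact
    have "integrable K (\<lambda>x. indicator (A b) (x \<bullet> b) * P x)" "integrable K (\<lambda>x. indicator (A b) (x \<bullet> b) * P x * cos (\<theta> + t \<bullet> x))"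
      using P01 by (intro integrable_bounded[where B = 1]; auto simp: abs_mult indicator_def intro!: mult_le_one)+
    from Bochner_Integration.integral_add[OF this] show ?thesis by (simp add: algebra_simps)
  qed
  have "(\<integral>x. indicator (A b) (x \<bullet> b) * P x * cos (\<theta> + t \<bullet> x) \<partial>M) = (\<integral>x. indicator (A b) (x \<bullet> b) * P x * cos (\<theta> + t \<bullet> x) \<partial>N)"
    using step[of \<theta> t] step0 split[OF M sM] split[OF N sN] by simp
  then show ?case using insert.hyps by (simp add: P_def)
qed

text \<open>Open boxes form an intersection-stable generator, and their indicators are the case
  theta = 0, t = 0 of the preceding lemma with an interval in each coordinate.\<close>

theorem char_fun_unique:
  fixes M N :: "'a::euclidean_space measure"
  assumes M: "prob_space M" and N: "prob_space N"
    and sM[measurable_cong]: "sets M = sets borel" and sN[measurable_cong]: "sets N = sets borel"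
    and char: "char_fun M = char_fun N"
  shows "M = N"
proof (rule measure_eqI_generator_eq[where \<Omega> = UNIV and E = "range (\<lambda>(a, b). box a b)"
      and A = "\<lambda>i::nat. box (- (real i *\<^sub>R One)) (real i *\<^sub>R One)"])
  interpret M: prob_space M by fact
  interpret N: prob_space N by fact
  show "Int_stable (range (\<lambda>(a, b). box a b :: 'a set))"
    by (auto simp: Int_stable_def box_Int_box)
  show "sets M = sigma_sets UNIV (range (\<lambda>(a, b). box a b))" "sets N = sigma_sets UNIV (range (\<lambda>(a, b). box a b))"
    using sM sN unfolding borel_eq_box by simp_all
  show "emeasure M (box (- (real i *\<^sub>R One)) (real i *\<^sub>R One)) \<noteq> \<infinity>" for i by simp
  fix X assume "X \<in> range (\<lambda>(a, b). box a b :: 'a set)"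
  then obtain a b where X: "X = box a b" by auto
  have "(\<Prod>i\<in>Basis. indicator {a \<bullet> i<..<b \<bullet> i} (x \<bullet> i)) = (indicator (box a b) x :: real)" for x
    by (auto simp: indicator_def box_def prod_eq_1_iff)
  then have "(\<integral>x. indicator (box a b) x \<partial>M) = (\<integral>x. (indicator (box a b) x :: real) \<partial>N)"
    using integral_box_cos_eq[OF M N sM sN char, of "\<lambda>i. {a \<bullet> i<..<b \<bullet> i}" Basis 0 0] by simp
  then show "emeasure M X = emeasure N X"
    unfolding X by (simp add: M.emeasure_eq_measure N.emeasure_eq_measure sets_eq_imp_space_eq[OF sM] sets_eq_imp_space_eq[OF sN])
qed (auto simp: UN_box_eq_UNIV)


section \<open>Product laws and mixtures\<close>

lemma borel_measurable_vecI:
  fixes f :: "'a \<Rightarrow> real ^ 'k"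
  assumes "\<And>i. (\<lambda>x. f x $ i) \<in> borel_measurable M"
  shows "f \<in> borel_measurable M"
  by (subst borel_measurable_euclidean_space) (auto simp: Basis_vec_def inner_axis assms)

lemma borel_measurable_vec_nth [measurable]: "(\<lambda>x::real ^ 'k. x $ i) \<in> borel_measurable borel"
  by (intro borel_measurable_continuous_onI continuous_intros)

lemma PiM_distr:
  fixes M :: "'k::finite \<Rightarrow> 'a measure" and N :: "'k \<Rightarrow> 'b measure"
  assumes M: "\<And>i. prob_space (M i)" and f[measurable]: "\<And>i. f i \<in> measurable (M i) (N i)"
  shows "Pi\<^sub>M UNIV (\<lambda>i. distr (M i) (N i) (f i)) = distr (Pi\<^sub>M UNIV M) (Pi\<^sub>M UNIV N) (\<lambda>u i. f i (u i))"
proof -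
  interpret D: product_prob_space "\<lambda>i. distr (M i) (N i) (f i)" UNIV
    unfolding product_prob_space_def product_sigma_finite_def product_prob_space_axioms_def
    using M f by (auto intro!: prob_space.prob_space_distr prob_space_imp_sigma_finite)
  interpret P: product_prob_space M UNIV
    unfolding product_prob_space_def product_sigma_finite_def product_prob_space_axioms_def
    using M by (auto intro!: prob_space_imp_sigma_finite)
  have m: "(\<lambda>u i. f i (u i)) \<in> measurable (Pi\<^sub>M UNIV M) (Pi\<^sub>M UNIV N)"
    by (rule measurable_PiM_single') (auto simp: space_PiM intro!: measurable_compose[OF measurable_component_singleton] f measurable_space[OF f])
  show ?thesis
  proof (rule D.PiM_eqI[symmetric])
    fix A assume A: "\<And>i. i \<in> UNIV \<Longrightarrow> A i \<in> sets (distr (M i) (N i) (f i))"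
    have "(\<lambda>u i. f i (u i)) -` Pi\<^sub>E UNIV A \<inter> space (Pi\<^sub>M UNIV M) = (\<Pi>\<^sub>E i\<in>UNIV. f i -` A i \<inter> space (M i))"
      by (auto simp: space_PiM)
    then show "emeasure (distr (Pi\<^sub>M UNIV M) (Pi\<^sub>M UNIV N) (\<lambda>u i. f i (u i))) (Pi\<^sub>E UNIV A) = (\<Prod>i\<in>UNIV. emeasure (distr (M i) (N i) (f i)) (A i))"
      using A m by (subst emeasure_distr) (auto intro!: sets_PiM_I_finite P.emeasure_PiM[THEN trans] measurable_sets[OF f] prod.cong simp: emeasure_distr)
  qed (auto intro!: sets_PiM_cong)
qed

section \<open>The product angle law on R^k\<close>

text \<open>One fixed law from which every component of the mixture \<open>F_map s G\<close> arises
  by componentwise multiplication.\<close>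

definition angle_vec :: "real \<Rightarrow> (real ^ 'k) measure" where
  "angle_vec s = product_measure UNIV (\<lambda>_. angle_law s)"

locale kingman =
  fixes s :: real
  assumes s: "s \<ge> -1/2"

lemma measurable_vec_lambda_PiM:
  fixes M :: "'k::finite \<Rightarrow> real measure"
  assumes "\<And>i. (\<lambda>x. x) \<in> borel_measurable (M i)"
  shows "(\<lambda>f. \<chi> i. f i) \<in> borel_measurable (Pi\<^sub>M UNIV M)"
proof (rule borel_measurable_vecI)
  show "(\<lambda>f. (\<chi> i. f i) $ i) \<in> borel_measurable (Pi\<^sub>M UNIV M)" for i
    using measurable_compose[OF measurable_component_singleton[of i UNIV M] assms[of i]] by simp
qed

lemma borel_on_id: "sets M = sets (borel_on S) \<Longrightarrow> (\<lambda>x. x) \<in> borel_measurable M"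
  by (simp add: measurable_restrict_space1 cong: measurable_cong_sets)

lemma measurable_vec_lambda_orthant:
  fixes M :: "'k::finite \<Rightarrow> real measure"
  assumes "\<And>i. sets (M i) = sets (borel_on {0..})"
  shows "(\<lambda>f. \<chi> i. f i) \<in> measurable (Pi\<^sub>M UNIV M) (borel_on orthant)"
proof (rule measurable_restrict_space2)
  have "space (M i) = {0..}" for i using sets_eq_imp_space_eq[OF assms[of i]] by (simp add: space_restrict_space)
  then show "(\<lambda>f. \<chi> i. f i) \<in> space (Pi\<^sub>M UNIV M) \<rightarrow> orthant"
    by (auto simp: space_PiM orthant_def PiE_iff)
qed (rule measurable_vec_lambda_PiM, rule borel_on_id[OF assms])

lemma sets_product_measure [simp, measurable_cong]: "sets (product_measure E M) = sets (borel_on E)"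
  by (simp add: product_measure_def)

lemma integral_PiM_prod:
  fixes M :: "'k::finite \<Rightarrow> 'a measure" and f :: "'k \<Rightarrow> 'a \<Rightarrow> 'b::{real_normed_field,banach,second_countable_topology}"
  assumes M: "\<And>i. prob_space (M i)" and f: "\<And>i. integrable (M i) (f i)"
  shows "(\<integral>x. (\<Prod>i\<in>UNIV. f i (x i)) \<partial>Pi\<^sub>M UNIV M) = (\<Prod>i\<in>UNIV. integral\<^sup>L (M i) (f i))"
proof -
  interpret product_sigma_finite M
    unfolding product_sigma_finite_def using M by (auto intro: prob_space_imp_sigma_finite)
  show ?thesis by (rule product_integral_prod) (use f in auto)
qed

lemma integral_product_measure_prod:
  fixes M :: "'k::finite \<Rightarrow> real measure" and f :: "'k \<Rightarrow> real \<Rightarrow> 'b::{real_normed_field,banach,second_countable_topology}"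
  assumes M: "\<And>i. prob_space (M i)" and m: "(\<lambda>f. \<chi> i. f i) \<in> measurable (Pi\<^sub>M UNIV M) (borel_on E)"
    and f: "\<And>i. integrable (M i) (f i)" and [measurable]: "\<And>i. f i \<in> borel_measurable borel"
  shows "(\<integral>x. (\<Prod>i\<in>UNIV. f i (x $ i)) \<partial>product_measure E M) = (\<Prod>i\<in>UNIV. integral\<^sup>L (M i) (f i))"
proof -
  have "(\<lambda>x::real ^ 'k. \<Prod>i\<in>UNIV. f i (x $ i)) \<in> borel_measurable (borel_on E)"
    by (rule measurable_restrict_space1) measurable
  then show ?thesis unfolding product_measure_def
    by (subst integral_distr[OF m]) (simp_all add: integral_PiM_prod[OF M f])
qed

lemma iexp_inner_vec: "iexp (t \<bullet> x) = (\<Prod>i\<in>UNIV. iexp (t $ i * x $ i))" for t x :: "real ^ 'k"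
  by (simp add: inner_vec_def exp_sum sum_distrib_left)

context kingman begin

lemma real_distribution_angle: "real_distribution (angle_law s)"
  using s by (rule real_distribution_angle_law)

lemma prob_space_angle: "prob_space (angle_law s)"
  using real_distribution_angle by (simp add: real_distribution_def)

lemma vec_lambda_angle: "(\<lambda>f. \<chi> i. f i) \<in> borel_measurable (Pi\<^sub>M UNIV (\<lambda>_::'k::finite. angle_law s))"
  by (rule measurable_vec_lambda_PiM) (simp cong: measurable_cong_sets)

lemma sets_angle_vec [simp, measurable_cong]: "sets (angle_vec s) = sets borel"
  by (simp add: angle_vec_def borel_on_UNIV)

lemma space_angle_vec [simp]: "space (angle_vec s) = UNIV"
  using sets_eq_imp_space_eq[OF sets_angle_vec] by simp

lemma prob_space_angle_vec: "prob_space (angle_vec s :: (real ^ 'k) measure)"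
  unfolding angle_vec_def product_measure_def borel_on_UNIV
  by (intro prob_space.prob_space_distr prob_space_PiM prob_space_angle vec_lambda_angle)

lemma integral_angle_vec_prod:
  fixes f :: "'k::finite \<Rightarrow> real \<Rightarrow> 'b::{real_normed_field,banach,second_countable_topology}"
  assumes "\<And>i. f i \<in> borel_measurable borel" "\<And>i u. u \<in> {-1..1} \<Longrightarrow> norm (f i u) \<le> B"
  shows "(\<integral>x. (\<Prod>i\<in>UNIV. f i (x $ i)) \<partial>angle_vec s) = (\<Prod>i\<in>UNIV. integral\<^sup>L (angle_law s) (f i))"
proof -
  have i: "integrable (angle_law s) (f i)" for i
    using s by (rule integrable_angle_law) (rule assms, erule assms(2))
  have m: "(\<lambda>f. \<chi> i. f i) \<in> measurable (Pi\<^sub>M UNIV (\<lambda>_::'k. angle_law s)) (borel_on UNIV)"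
    unfolding borel_on_UNIV by (rule vec_lambda_angle)
  show ?thesis unfolding angle_vec_def
    by (rule integral_product_measure_prod[OF prob_space_angle m i assms(1)])
qed

lemma char_fun_angle_vec: "char_fun (angle_vec s) t = of_real (\<Prod>i\<in>UNIV. Lambda_fun s (t $ i))"
proof -
  have "char_fun (angle_vec s) t = (\<Prod>i\<in>UNIV. CLINT u|angle_law s. iexp (t $ i * u))"
    unfolding char_fun_def iexp_inner_vec
    by (rule integral_angle_vec_prod[where B = 1]) auto
  then show ?thesis using char_angle_law[OF s] by (simp add: char_def)
qed

end

section \<open>Mixtures as images of product measures, and the map F_{s,k}\<close>

text \<open>Drawing c from G and then f c U with U of law V amounts to drawing c and U
  independently. This replaces \<open>bind\<close> by a product measure, on which Fubini's theorem
  is available; the measurability of the kernel is recorded for the associativity of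
  \<open>bind\<close>.\<close>

lemma bind_distr_eq_distr_pair:
  assumes G: "prob_space G" and V: "prob_space V" and f[measurable]: "case_prod f \<in> measurable (G \<Otimes>\<^sub>M V) N"
  shows "G \<bind> (\<lambda>c. distr V N (f c)) = distr (G \<Otimes>\<^sub>M V) N (case_prod f)"
    and "(\<lambda>c. distr V N (f c)) \<in> measurable G (subprob_algebra N)"
proof -
  interpret G: prob_space G by fact
  interpret V: prob_space V by fact
  have V': "V \<in> space (subprob_algebra V)"
    by (simp add: space_subprob_algebra V.subprob_space_axioms)
  show k: "(\<lambda>c. distr V N (f c)) \<in> measurable G (subprob_algebra N)"
    by (rule measurable_distr2[OF f measurable_const[OF V']])
  have fc: "f c \<in> measurable V N" if "c \<in> space G" for c
    using measurable_compose[OF measurable_Pair1'[OF that] f] by simp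
  show "G \<bind> (\<lambda>c. distr V N (f c)) = distr (G \<Otimes>\<^sub>M V) N (case_prod f)"
  proof (rule measure_eqI)
    have sN: "sets (distr V N (f c)) = sets N" for c by simp
    show sets: "sets (G \<bind> (\<lambda>c. distr V N (f c))) = sets (distr (G \<Otimes>\<^sub>M V) N (case_prod f))"
      using sets_bind[OF sN G.not_empty] by simp
    fix A assume "A \<in> sets (G \<bind> (\<lambda>c. distr V N (f c)))"
    then have A[measurable]: "A \<in> sets N" unfolding sets by simp
    have "emeasure (G \<bind> (\<lambda>c. distr V N (f c))) A = (\<integral>\<^sup>+c. emeasure (distr V N (f c)) A \<partial>G)"
      by (rule emeasure_bind[OF G.not_empty k A])
    also have "\<dots> = (\<integral>\<^sup>+c. (\<integral>\<^sup>+u. indicator A (f c u) \<partial>V) \<partial>G)"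
    proof (rule nn_integral_cong)
      fix c assume "c \<in> space G"
      from fc[OF this] show "emeasure (distr V N (f c)) A = (\<integral>\<^sup>+u. indicator A (f c u) \<partial>V)"
      proof -
        have "emeasure (distr V N (f c)) A = (\<integral>\<^sup>+x. indicator A x \<partial>distr V N (f c))" by simp
        also have "\<dots> = (\<integral>\<^sup>+u. indicator A (f c u) \<partial>V)" using \<open>f c \<in> measurable V N\<close> by (rule nn_integral_distr) simp
        finally show ?thesis .
      qed
    qed
    also have "\<dots> = (\<integral>\<^sup>+p. indicator A (case_prod f p) \<partial>(G \<Otimes>\<^sub>M V))"
      by (subst V.nn_integral_fst[symmetric]) auto
    also have "\<dots> = (\<integral>\<^sup>+x. indicator A x \<partial>distr (G \<Otimes>\<^sub>M V) N (case_prod f))"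
      using f by (rule nn_integral_distr[symmetric]) simp
    also have "\<dots> = emeasure (distr (G \<Otimes>\<^sub>M V) N (case_prod f)) A" by simp
    finally show "emeasure (G \<bind> (\<lambda>c. distr V N (f c))) A = emeasure (distr (G \<Otimes>\<^sub>M V) N (case_prod f)) A" .
  qed
qed

lemma integral_pair_bounded:
  fixes f :: "'a \<Rightarrow> 'b \<Rightarrow> 'c::{banach, second_countable_topology}"
  assumes G: "prob_space G" and V: "prob_space V" and f[measurable]: "case_prod f \<in> borel_measurable (G \<Otimes>\<^sub>M V)"
    and B: "\<And>c u. c \<in> space G \<Longrightarrow> u \<in> space V \<Longrightarrow> norm (f c u) \<le> B"
  shows "(\<integral>p. case_prod f p \<partial>(G \<Otimes>\<^sub>M V)) = (\<integral>c. (\<integral>u. f c u \<partial>V) \<partial>G)"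
proof -
  interpret G: prob_space G by fact
  interpret V: prob_space V by fact
  interpret P: pair_prob_space G V ..
  have "integrable (G \<Otimes>\<^sub>M V) (case_prod f)"
    by (rule P.P.integrable_const_bound[of _ B]) (auto simp: space_pair_measure B)
  from P.integral_fst'[OF this] show ?thesis by simp
qed

context kingman begin

lemma prob_measures_orthantD:
  assumes "G \<in> prob_measures orthant"
  shows "prob_space G" "sets G = sets (borel_on orthant)" "space G = orthant"
  using assms sets_eq_imp_space_eq[of G "borel_on orthant"] by (auto simp: prob_measures_def space_restrict_space)

lemma measurable_orthant_nth:
  assumes "sets G = sets (borel_on orthant)" shows "(\<lambda>c. c $ i) \<in> borel_measurable G"
  by (subst measurable_cong_sets[OF assms refl]) (rule measurable_restrict_space1, simp)

lemma measurable_times_vec: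
  assumes "sets G = sets (borel_on orthant)"
  shows "(\<lambda>(c, u). c * u) \<in> borel_measurable (G \<Otimes>\<^sub>M (angle_vec s :: (real ^ 'k) measure))"
  unfolding split_beta'
  by (rule borel_measurable_vecI)
     (auto intro!: borel_measurable_times measurable_compose[OF measurable_fst measurable_orthant_nth[OF assms]]
       measurable_compose[OF measurable_snd])

text \<open>On vectors \<open>c * u\<close> is the componentwise product, so independent dilations
  of the coordinates become a single map applied to \<open>angle_vec s\<close>.\<close>

lemma product_dilate_eq: "product_measure UNIV (\<lambda>i. dilate (c $ i) (F_law s)) = distr (angle_vec s) borel (\<lambda>u. c * u)"
  for c :: "real ^ 'k"
proof -
  have id: "(\<lambda>x. x) \<in> borel_measurable (distr (angle_law s) (angle_law s) (\<lambda>u. c $ i * u))" for i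
    by (simp cong: measurable_cong_sets)
  have m: "(\<lambda>u i. c $ i * u i) \<in> measurable (Pi\<^sub>M UNIV (\<lambda>_::'k. angle_law s)) (Pi\<^sub>M UNIV (\<lambda>_::'k. angle_law s))"
    by (rule measurable_PiM_single') (auto simp: space_PiM intro!: measurable_compose[OF measurable_component_singleton])
  have "Pi\<^sub>M UNIV (\<lambda>i. dilate (c $ i) (F_law s)) = distr (Pi\<^sub>M UNIV (\<lambda>_::'k. angle_law s)) (Pi\<^sub>M UNIV (\<lambda>_::'k. angle_law s)) (\<lambda>u i. c $ i * u i)"
    unfolding F_law_eq[OF s] dilate_def real_scaleR_def by (rule PiM_distr) (auto intro: prob_space_angle)
  then have "product_measure UNIV (\<lambda>i. dilate (c $ i) (F_law s)) = distr (Pi\<^sub>M UNIV (\<lambda>_::'k. angle_law s)) borel (\<lambda>u. \<chi> i. c $ i * u i)"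
    unfolding product_measure_def borel_on_UNIV by (simp add: distr_distr[OF vec_lambda_angle m] comp_def)
  also have "\<dots> = distr (angle_vec s) borel (\<lambda>u. c * u)"
    unfolding angle_vec_def product_measure_def borel_on_UNIV
    by (subst distr_distr[OF _ vec_lambda_angle]) (auto simp: comp_def vec_eq_iff intro!: borel_measurable_vecI arg_cong[where f = "distr _ _"])
  finally show ?thesis .
qed

lemma F_map_eq:
  assumes G: "G \<in> prob_measures orthant"
  shows "F_map s G = distr (G \<Otimes>\<^sub>M angle_vec s) borel (\<lambda>(c, u). c * u)"
  unfolding F_map_def product_dilate_eq
  by (rule bind_distr_eq_distr_pair(1)[OF _ prob_space_angle_vec measurable_times_vec])
     (rule prob_measures_orthantD[OF G])+

lemma F_map_prob_measures: assumes G: "G \<in> prob_measures orthant" shows "F_map s G \<in> prob_measures UNIV"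
proof -
  note G' = prob_measures_orthantD[OF G]
  interpret G: prob_space G by fact
  interpret V: prob_space "angle_vec s" by (rule prob_space_angle_vec)
  interpret P: pair_prob_space G "angle_vec s" ..
  show ?thesis unfolding F_map_eq[OF G] prob_measures_def borel_on_UNIV
    using measurable_times_vec[OF G'(2)] by (auto intro!: P.P.prob_space_distr)
qed

lemma integral_F_map:
  fixes f :: "real ^ 'k \<Rightarrow> 'b::{banach, second_countable_topology}"
  assumes G: "G \<in> prob_measures orthant" and f[measurable]: "f \<in> borel_measurable borel" and B: "\<And>x. norm (f x) \<le> B"
  shows "(\<integral>x. f x \<partial>F_map s G) = (\<integral>c. (\<integral>u. f (c * u) \<partial>angle_vec s) \<partial>G)"
proof -
  note G' = prob_measures_orthantD[OF G]
  have "(\<integral>x. f x \<partial>F_map s G) = (\<integral>p. case_prod (\<lambda>c u. f (c * u)) p \<partial>(G \<Otimes>\<^sub>M angle_vec s))"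
    unfolding F_map_eq[OF G] by (subst integral_distr[OF measurable_times_vec[OF G'(2)]]) (auto simp: split_beta')
  also have "\<dots> = (\<integral>c. (\<integral>u. f (c * u) \<partial>angle_vec s) \<partial>G)"
  proof (rule integral_pair_bounded[OF G'(1) prob_space_angle_vec])
    show "case_prod (\<lambda>c u. f (c * u)) \<in> borel_measurable (G \<Otimes>\<^sub>M angle_vec s)"
      using measurable_compose[OF measurable_times_vec[OF G'(2)] f] by (simp add: split_beta')
  qed (rule B)
  finally show ?thesis .
qed

text \<open>Componentwise multiplication is self-adjoint, so the inner product of t with c u is that
  of t c with u, and the inner integral is the characteristic function of \<open>angle_vec s\<close>
  at t c.\<close>

lemma char_fun_F_map:
  fixes G :: "(real ^ 'k) measure"
  assumes G: "G \<in> prob_measures orthant"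
  shows "char_fun (F_map s G) t = complex_of_real (radial_char_fun s G t)"
proof -
  have "char_fun (F_map s G) t = (\<integral>c. (CLINT u|angle_vec s. iexp (t \<bullet> (c * u))) \<partial>G)"
    unfolding char_fun_def by (rule integral_F_map[OF G, where B = 1]) auto
  also have "\<dots> = (\<integral>c. complex_of_real (\<Prod>j\<in>UNIV. Lambda_fun s (t $ j * c $ j)) \<partial>G)"
  proof (intro Bochner_Integration.integral_cong refl)
    fix c
    have "t \<bullet> (c * u) = (t * c) \<bullet> u" for u by (simp add: inner_vec_def mult_ac)
    then show "(CLINT u|angle_vec s. iexp (t \<bullet> (c * u))) = complex_of_real (\<Prod>j\<in>UNIV. Lambda_fun s (t $ j * c $ j))"
      using char_fun_angle_vec[of "t * c"] by (simp add: char_fun_def)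
  qed
  finally show ?thesis unfolding radial_char_fun_def by (simp only: integral_complex_of_real)
qed

end


context kingman begin

section \<open>The Kingman convolution\<close>

text \<open>Two of the three integrations are against point masses; only the angle remains
  random.\<close>

lemma kingman_conv_return:
  assumes xy: "x \<ge> 0" "y \<ge> 0"
  shows "kingman_conv s (return (borel_on {0..}) x) (return (borel_on {0..}) y) = distr (angle_law s) (borel_on {0..}) (kingman_radius x y)"
proof (rule measure_eqI)
  let ?R = "\<lambda>x. return (borel_on {0..}) x :: real measure"
  let ?h = "\<lambda>(x, y, u). sqrt (x\<^sup>2 + 2 * u * x * y + y\<^sup>2) :: real"
  let ?Q = "?R y \<Otimes>\<^sub>M kingman_angle s"
  let ?P = "?R x \<Otimes>\<^sub>M ?Q"
  have sp: "space (borel_on {0..}) = {0::real..}" by (simp add: space_restrict_space)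
  have id: "(\<lambda>x. x) \<in> borel_measurable (?R z)" for z by (rule borel_on_id) simp
  have h: "?h \<in> measurable ?P (borel_on {0..})"
  proof (rule measurable_restrict_space2)
    show "?h \<in> space ?P \<rightarrow> {0..}"
      by (auto simp: space_pair_measure sp space_kingman_angle kingman_arg_nonneg)
    have "(\<lambda>p. fst p) \<in> borel_measurable ?P" "(\<lambda>p. fst (snd p)) \<in> borel_measurable ?P"
      "(\<lambda>p. snd (snd p)) \<in> borel_measurable ?P"
      using measurable_compose[OF measurable_fst id]
        measurable_compose[OF measurable_compose[OF measurable_snd measurable_fst] id]
        measurable_compose[OF measurable_compose[OF measurable_snd measurable_snd] measurable_id_kingman_angle] by blast+
    then show "?h \<in> borel_measurable ?P"
      unfolding split_beta'
      by (intro measurable_compose[OF _ borel_measurable_continuous_onI[of sqrt]] continuous_intros borel_measurable_add borel_measurable_times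
          borel_measurable_power borel_measurable_const)
  qed
  have r: "kingman_radius x y \<in> measurable (angle_law s) (borel_on {0..})"
    by (rule measurable_restrict_space2) (auto simp: kingman_radius_def cong: measurable_cong_sets)
  fix A assume "A \<in> sets (kingman_conv s (?R x) (?R y))"
  then have A[measurable]: "A \<in> sets (borel_on {0..})" by (simp add: kingman_conv_def)
  interpret K: prob_space "kingman_angle s" using s by (rule prob_space_kingman_angle)
  interpret Y: prob_space "?R y" by (rule prob_space_return) (simp add: sp xy)
  interpret Q: pair_prob_space "?R y" "kingman_angle s" ..
  define \<phi> :: "real \<times> real \<times> real \<Rightarrow> ennreal" where "\<phi> p = indicator A (?h p)" for p
  have \<phi>: "\<phi> \<in> borel_measurable ?P"
    unfolding \<phi>_def using measurable_compose[OF h, of "indicator A" borel] by simp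
  have \<phi>x: "(\<lambda>q. \<phi> (x, q)) \<in> borel_measurable ?Q"
    using measurable_compose[OF measurable_Pair1'[of x "?R x"] \<phi>] xy by (simp add: sp)
  have "emeasure (kingman_conv s (?R x) (?R y)) A = (\<integral>\<^sup>+z. indicator A z \<partial>kingman_conv s (?R x) (?R y))"
    by (simp add: kingman_conv_def)
  also have "\<dots> = (\<integral>\<^sup>+p. \<phi> p \<partial>?P)"
    unfolding kingman_conv_def \<phi>_def using h by (rule nn_integral_distr) simp
  also have "\<dots> = (\<integral>\<^sup>+a. (\<integral>\<^sup>+q. \<phi> (a, q) \<partial>?Q) \<partial>?R x)"
    using \<phi> by (rule Q.P.nn_integral_fst[symmetric])
  also have "\<dots> = (\<integral>\<^sup>+q. \<phi> (x, q) \<partial>?Q)"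
    by (rule nn_integral_return) (use xy Q.P.borel_measurable_nn_integral_fst[OF \<phi>] in \<open>simp_all add: sp\<close>)
  also have "\<dots> = (\<integral>\<^sup>+b. (\<integral>\<^sup>+u. \<phi> (x, b, u) \<partial>kingman_angle s) \<partial>?R y)"
    using \<phi>x by (rule K.nn_integral_fst[symmetric])
  also have "\<dots> = (\<integral>\<^sup>+u. \<phi> (x, y, u) \<partial>kingman_angle s)"
    by (rule nn_integral_return) (use xy K.borel_measurable_nn_integral_fst[OF \<phi>x] in \<open>simp_all add: sp\<close>)
  also have "\<dots> = (\<integral>\<^sup>+u. indicator A (kingman_radius x y u) \<partial>kingman_angle s)"
    by (rule nn_integral_cong) (simp add: \<phi>_def kingman_radius_eq[OF xy] space_kingman_angle)
  also have "\<dots> = (\<integral>\<^sup>+u. indicator A (kingman_radius x y u) \<partial>angle_law s)"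
    unfolding angle_law_def
    by (rule nn_integral_distr[symmetric]) (use measurable_compose[OF r, of "indicator A" borel] in \<open>simp_all cong: measurable_cong_sets\<close>)
  also have "\<dots> = (\<integral>\<^sup>+z. indicator A z \<partial>distr (angle_law s) (borel_on {0..}) (kingman_radius x y))"
    using r by (rule nn_integral_distr[symmetric]) simp
  finally show "emeasure (kingman_conv s (?R x) (?R y)) A = emeasure (distr (angle_law s) (borel_on {0..}) (kingman_radius x y)) A"
    by simp
qed (simp add: kingman_conv_def)

definition radius_vec :: "real ^ 'k \<Rightarrow> real ^ 'k \<Rightarrow> real ^ 'k \<Rightarrow> real ^ 'k" where
  "radius_vec x y u = (\<chi> i. kingman_radius (x $ i) (y $ i) (u $ i))"

lemma radius_vec_orthant: "radius_vec x y u \<in> orthant"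
  by (simp add: radius_vec_def orthant_def kingman_radius_def)

text \<open>Again a map applied to the fixed law \<open>angle_vec s\<close>, the form required for
  turning \<open>bind\<close> into a product measure.\<close>

lemma kingman_conv_point_eq:
  fixes x y :: "real ^ 'k"
  assumes xy: "x \<in> orthant" "y \<in> orthant"
  shows "kingman_conv_point s x y = distr (angle_vec s) (borel_on orthant) (radius_vec x y)"
proof -
  let ?A = "Pi\<^sub>M UNIV (\<lambda>_::'k. angle_law s)"
  let ?B = "\<lambda>_::'k. borel_on {0::real..}"
  have r: "kingman_radius a b \<in> measurable (angle_law s) (borel_on {0..})" for a b
    by (rule measurable_restrict_space2) (auto simp: kingman_radius_def cong: measurable_cong_sets)
  have m: "(\<lambda>u i. kingman_radius (x $ i) (y $ i) (u i)) \<in> measurable ?A (Pi\<^sub>M UNIV ?B)"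
  proof (rule measurable_PiM_single')
    show "(\<lambda>u. kingman_radius (x $ i) (y $ i) (u i)) \<in> measurable ?A (borel_on {0..})" for i
      by (rule measurable_compose[OF measurable_component_singleton[of i UNIV "\<lambda>_. angle_law s"] r]) simp
  qed (auto simp: space_restrict_space kingman_radius_def)
  have v: "(\<lambda>f. \<chi> i. f i) \<in> measurable (Pi\<^sub>M UNIV ?B) (borel_on orthant)"
    by (rule measurable_vec_lambda_orthant) simp
  have rv: "radius_vec x y \<in> measurable borel (borel_on orthant)"
    by (rule measurable_restrict_space2) (auto simp: radius_vec_orthant, auto simp: radius_vec_def[abs_def] intro!: borel_measurable_vecI measurable_compose[OF borel_measurable_vec_nth measurable_kingman_radius])
  have "Pi\<^sub>M UNIV (\<lambda>i. kingman_conv s (return (borel_on {0..}) (x $ i)) (return (borel_on {0..}) (y $ i))) =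
     distr ?A (Pi\<^sub>M UNIV ?B) (\<lambda>u i. kingman_radius (x $ i) (y $ i) (u i))"
    using xy by (subst kingman_conv_return) (auto simp: orthant_def intro!: PiM_distr prob_space_angle r)
  then have "kingman_conv_point s x y = distr (distr ?A (Pi\<^sub>M UNIV ?B) (\<lambda>u i. kingman_radius (x $ i) (y $ i) (u i))) (borel_on orthant) (\<lambda>f. \<chi> i. f i)"
    unfolding kingman_conv_point_def product_measure_def by simp
  also have "\<dots> = distr ?A (borel_on orthant) (\<lambda>u. \<chi> i. kingman_radius (x $ i) (y $ i) (u i))"
    by (subst distr_distr[OF v m]) (simp add: comp_def)
  also have "\<dots> = distr (angle_vec s) (borel_on orthant) (radius_vec x y)"
    unfolding angle_vec_def product_measure_def borel_on_UNIV
    by (subst distr_distr[OF rv vec_lambda_angle]) (simp add: comp_def radius_vec_def)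
  finally show ?thesis .
qed

lemma radial_char_fun_measurable: "(\<lambda>x::real ^ 'k. \<Prod>j\<in>UNIV. Lambda_fun s (t $ j * x $ j)) \<in> borel_measurable borel"
  by (intro borel_measurable_continuous_onI continuous_on_prod continuous_on_compose2[OF continuous_Lambda_fun[OF s]] continuous_intros) auto

lemma radial_char_fun_bound: "\<bar>\<Prod>j\<in>UNIV. Lambda_fun s (t $ j * x $ j)\<bar> \<le> 1" for t x :: "real ^ 'k"
  by (simp add: abs_prod prod_le_1 abs_Lambda_fun_le[OF s])

context
  fixes G1 G2 :: "(real ^ 'k) measure"
  assumes G1: "G1 \<in> prob_measures orthant" and G2: "G2 \<in> prob_measures orthant"
begin

lemma measurable_radius_vec:
  "(\<lambda>((x, y), u). radius_vec x y u) \<in> measurable ((G1 \<Otimes>\<^sub>M G2) \<Otimes>\<^sub>M angle_vec s) (borel_on orthant)"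
proof (rule measurable_restrict_space2)
  let ?P = "(G1 \<Otimes>\<^sub>M G2) \<Otimes>\<^sub>M (angle_vec s :: (real ^ 'k) measure)"
  have c: "(\<lambda>p. fst (fst p) $ i) \<in> borel_measurable ?P" "(\<lambda>p. snd (fst p) $ i) \<in> borel_measurable ?P"
      "(\<lambda>p. snd p $ i) \<in> borel_measurable ?P" for i
    by (rule measurable_compose[OF measurable_compose[OF measurable_fst measurable_fst] measurable_orthant_nth[OF prob_measures_orthantD(2)[OF G1]]])
       (rule measurable_compose[OF measurable_compose[OF measurable_fst measurable_snd] measurable_orthant_nth[OF prob_measures_orthantD(2)[OF G2]]],
        rule measurable_compose[OF measurable_snd], simp cong: measurable_cong_sets)
  show "(\<lambda>((x, y), u). radius_vec x y u) \<in> borel_measurable ?P"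
    unfolding split_beta' radius_vec_def kingman_radius_def
    by (rule borel_measurable_vecI, simp, intro measurable_compose[OF _ borel_measurable_continuous_onI[of sqrt]] continuous_intros borel_measurable_add borel_measurable_times
          borel_measurable_power borel_measurable_const borel_measurable_abs c)
qed (auto simp: radius_vec_orthant)

lemma prob_space_pair_orthant: "prob_space (G1 \<Otimes>\<^sub>M G2)"
proof -
  interpret G1: prob_space G1 by (rule prob_measures_orthantD[OF G1])
  interpret G2: prob_space G2 by (rule prob_measures_orthantD[OF G2])
  interpret pair_prob_space G1 G2 ..
  show ?thesis by (rule P.prob_space_axioms)
qed

lemma kingman_conv_vec_eq:
  "kingman_conv_vec s G1 G2 = distr ((G1 \<Otimes>\<^sub>M G2) \<Otimes>\<^sub>M angle_vec s) (borel_on orthant) (\<lambda>((x, y), u). radius_vec x y u)"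
proof -
  have "kingman_conv_vec s G1 G2 = (G1 \<Otimes>\<^sub>M G2) \<bind> (\<lambda>p. distr (angle_vec s) (borel_on orthant) ((\<lambda>(x, y). radius_vec x y) p))"
    unfolding kingman_conv_vec_def
    by (rule bind_cong) (auto simp: space_pair_measure prob_measures_orthantD[OF G1] prob_measures_orthantD[OF G2] kingman_conv_point_eq)
  also have "\<dots> = distr ((G1 \<Otimes>\<^sub>M G2) \<Otimes>\<^sub>M angle_vec s) (borel_on orthant) (case_prod (\<lambda>(x, y). radius_vec x y))"
    by (rule bind_distr_eq_distr_pair(1)[OF prob_space_pair_orthant prob_space_angle_vec measurable_radius_vec])
  finally show ?thesis .
qed

lemma kingman_conv_vec_prob_measures: "kingman_conv_vec s G1 G2 \<in> prob_measures orthant"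
proof -
  interpret G: prob_space "G1 \<Otimes>\<^sub>M G2" by (rule prob_space_pair_orthant)
  interpret V: prob_space "angle_vec s :: (real ^ 'k) measure" by (rule prob_space_angle_vec)
  interpret P: pair_prob_space "G1 \<Otimes>\<^sub>M G2" "angle_vec s :: (real ^ 'k) measure" ..
  show ?thesis unfolding kingman_conv_vec_eq prob_measures_def
    using measurable_radius_vec by (auto intro!: P.P.prob_space_distr)
qed

text \<open>For fixed x and y the angles are independent, so the inner integral factors over the
  coordinates and \<open>Lambda_fun_product\<close> applies to each factor; Fubini's theorem then
  separates x from y.\<close>

lemma radial_char_fun_kingman_conv_vec:
  "radial_char_fun s (kingman_conv_vec s G1 G2) t = radial_char_fun s G1 t * radial_char_fun s G2 t"
proof -
  let ?L = "\<lambda>x::real ^ 'k. \<Prod>j\<in>UNIV. Lambda_fun s (t $ j * x $ j)"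
  note m = measurable_compose[OF measurable_radius_vec measurable_restrict_space1[OF radial_char_fun_measurable[of t]]]
  have "radial_char_fun s (kingman_conv_vec s G1 G2) t = (\<integral>p. ?L ((\<lambda>((x, y), u). radius_vec x y u) p) \<partial>((G1 \<Otimes>\<^sub>M G2) \<Otimes>\<^sub>M angle_vec s))"
    unfolding radial_char_fun_def kingman_conv_vec_eq
    by (rule integral_distr[OF measurable_radius_vec measurable_restrict_space1[OF radial_char_fun_measurable]])
  also have "\<dots> = (\<integral>p. case_prod (\<lambda>p u. ?L (radius_vec (fst p) (snd p) u)) p \<partial>((G1 \<Otimes>\<^sub>M G2) \<Otimes>\<^sub>M angle_vec s))"
    by (simp add: split_beta')
  also have "\<dots> = (\<integral>p. (\<integral>u. ?L (radius_vec (fst p) (snd p) u) \<partial>angle_vec s) \<partial>(G1 \<Otimes>\<^sub>M G2))"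
    by (rule integral_pair_bounded[OF prob_space_pair_orthant prob_space_angle_vec, where B = 1])
       (use m in \<open>simp_all add: split_beta' radial_char_fun_bound\<close>)
  also have "\<dots> = (\<integral>p. ?L (fst p) * ?L (snd p) \<partial>(G1 \<Otimes>\<^sub>M G2))"
  proof (intro Bochner_Integration.integral_cong refl)
    fix p assume "p \<in> space (G1 \<Otimes>\<^sub>M G2)"
    then have p: "fst p $ i \<ge> 0" "snd p $ i \<ge> 0" for i
      by (auto simp: space_pair_measure prob_measures_orthantD[OF G1] prob_measures_orthantD[OF G2] orthant_def)
    have "(\<integral>u. ?L (radius_vec (fst p) (snd p) u) \<partial>angle_vec s) =
       (\<integral>u. (\<Prod>j\<in>UNIV. Lambda_fun s (t $ j * kingman_radius (fst p $ j) (snd p $ j) (u $ j))) \<partial>angle_vec s)"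
      by (simp add: radius_vec_def)
    also have "\<dots> = (\<Prod>j\<in>UNIV. (\<integral>u. Lambda_fun s (t $ j * kingman_radius (fst p $ j) (snd p $ j) u) \<partial>angle_law s))"
    proof (rule integral_angle_vec_prod[where B = 1])
      show "(\<lambda>u. Lambda_fun s (t $ i * kingman_radius (fst p $ i) (snd p $ i) u)) \<in> borel_measurable borel" for i
        by (rule measurable_compose[OF _ borel_measurable_continuous_onI[OF continuous_Lambda_fun[OF s]]]) simp
    qed (simp add: abs_Lambda_fun_le[OF s])
    also have "\<dots> = ?L (fst p) * ?L (snd p)"
      by (simp add: Lambda_fun_product[OF s p] prod.distrib)
    finally show "(\<integral>u. ?L (radius_vec (fst p) (snd p) u) \<partial>angle_vec s) = ?L (fst p) * ?L (snd p)" .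
  qed
  also have "\<dots> = (\<integral>p. case_prod (\<lambda>x y. ?L x * ?L y) p \<partial>(G1 \<Otimes>\<^sub>M G2))" by (simp add: split_beta')
  also have "\<dots> = (\<integral>x. (\<integral>y. ?L x * ?L y \<partial>G2) \<partial>G1)"
  proof (rule integral_pair_bounded[where B = 1])
    have "?L \<in> borel_measurable G" if "sets G = sets (borel_on orthant)" for G
      by (subst measurable_cong_sets[OF that refl]) (rule measurable_restrict_space1[OF radial_char_fun_measurable])
    then show "case_prod (\<lambda>x y. ?L x * ?L y) \<in> borel_measurable (G1 \<Otimes>\<^sub>M G2)"
      unfolding split_beta'
      by (intro borel_measurable_times measurable_compose[OF measurable_fst] measurable_compose[OF measurable_snd])
         (simp_all only: prob_measures_orthantD[OF G1] prob_measures_orthantD[OF G2])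
    show "norm (?L x * ?L y) \<le> 1" for x y
      unfolding real_norm_def abs_mult by (intro mult_le_one radial_char_fun_bound abs_ge_zero)
  qed (rule prob_measures_orthantD[OF G1] prob_measures_orthantD[OF G2])+
  also have "\<dots> = radial_char_fun s G1 t * radial_char_fun s G2 t"
    unfolding radial_char_fun_def by simp
  finally show ?thesis .
qed

end

end


section \<open>Algebraic properties of the map\<close>

lemma prob_measures_UNIVD:
  assumes "K \<in> prob_measures UNIV"
  shows "prob_space K" "sets K = sets borel" "space K = UNIV"
  using assms sets_eq_imp_space_eq[of K borel] by (auto simp: prob_measures_def borel_on_UNIV)

lemma char_fun_cos_sin:
  fixes K :: "'a::euclidean_space measure"
  assumes K: "K \<in> prob_measures UNIV"
  shows "char_fun K t = Complex (\<integral>y. cos (t \<bullet> y) \<partial>K) (\<integral>y. sin (t \<bullet> y) \<partial>K)"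
proof -
  interpret prob_space K by (rule prob_measures_UNIVD[OF K])
  have "integrable K (\<lambda>x. iexp (t \<bullet> x))"
    by (rule integrable_bounded[where B = 1]) (auto simp: measurable_cong_sets[OF prob_measures_UNIVD(2)[OF K] refl])
  from integral_Re[OF this] integral_Im[OF this] show ?thesis
    unfolding char_fun_def by (simp add: complex_eq_iff Re_exp Im_exp)
qed

lemma char_fun_unique':
  fixes K L :: "'a::euclidean_space measure"
  assumes "K \<in> prob_measures UNIV" "L \<in> prob_measures UNIV" "\<And>t. char_fun K t = char_fun L t"
  shows "K = L"
  using assms by (intro char_fun_unique) (auto simp: prob_measures_UNIVD)

lemma convolution_prob_measures:
  fixes K L :: "'a::ordered_euclidean_space measure"
  assumes K: "K \<in> prob_measures UNIV" and L: "L \<in> prob_measures UNIV"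
  shows "(K \<star> L) \<in> prob_measures UNIV"
proof -
  note [measurable_cong] = prob_measures_UNIVD(2)[OF K] prob_measures_UNIVD(2)[OF L]
  interpret K: prob_space K by (rule prob_measures_UNIVD[OF K])
  interpret L: prob_space L by (rule prob_measures_UNIVD[OF L])
  interpret pair_prob_space K L ..
  show ?thesis unfolding convolution_def prob_measures_def borel_on_UNIV by (auto intro!: P.prob_space_distr)
qed

lemma char_fun_convolution:
  fixes K L :: "'a::ordered_euclidean_space measure"
  assumes K: "K \<in> prob_measures UNIV" and L: "L \<in> prob_measures UNIV"
  shows "char_fun (K \<star> L) t = char_fun K t * char_fun L t"
proof -
  note [measurable_cong] = prob_measures_UNIVD(2)[OF K] prob_measures_UNIVD(2)[OF L]
  have "char_fun (K \<star> L) t = (\<integral>p. case_prod (\<lambda>x y. iexp (t \<bullet> x) * iexp (t \<bullet> y)) p \<partial>(K \<Otimes>\<^sub>M L))"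
    unfolding char_fun_def convolution_def
    by (subst integral_distr) (auto simp: split_beta' inner_add_right exp_add distrib_left)
  also have "\<dots> = (\<integral>x. (\<integral>y. iexp (t \<bullet> x) * iexp (t \<bullet> y) \<partial>L) \<partial>K)"
    by (rule integral_pair_bounded[where B = 1]) (auto simp: prob_measures_UNIVD[OF K] prob_measures_UNIVD[OF L] norm_mult)
  finally show ?thesis unfolding char_fun_def by simp
qed

lemma char_fun_return_0: "char_fun (return borel (0::'a::euclidean_space)) t = 1"
  unfolding char_fun_def by (subst integral_return) auto

lemma return_0_prob_measures: "return borel (0::'a::euclidean_space) \<in> prob_measures UNIV"
  by (simp add: prob_measures_def borel_on_UNIV prob_space_return)

lemma char_fun_dilate:
  fixes K :: "'a::euclidean_space measure"
  assumes K: "K \<in> prob_measures UNIV"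
  shows "char_fun (dilate c K) t = char_fun K (c *\<^sub>R t)"
proof -
  note [measurable_cong] = prob_measures_UNIVD(2)[OF K]
  show ?thesis unfolding char_fun_def dilate_def by (subst integral_distr) auto
qed

lemma dilate_prob_measures:
  fixes K :: "'a::euclidean_space measure"
  assumes K: "K \<in> prob_measures UNIV"
  shows "dilate c K \<in> prob_measures UNIV"
proof -
  note [measurable_cong] = prob_measures_UNIVD(2)[OF K]
  have "(\<lambda>x. c *\<^sub>R x) \<in> measurable K K" by measurable
  then show ?thesis using K unfolding dilate_def prob_measures_def by (auto intro: prob_space.prob_space_distr)
qed

text \<open>A convex combination is a mixture over a finite index set. Written as a
  \<open>bind\<close>, it commutes with \<open>F_map\<close> by associativity.\<close>

lemma convex_combination_eq_bind:
  fixes M :: "nat \<Rightarrow> 'a::topological_space measure"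
  assumes n: "n > 0" and M: "\<And>i. i < n \<Longrightarrow> M i \<in> prob_measures E"
  shows "convex_combination E n a M = point_measure {..<n} (\<lambda>i. ennreal (a i)) \<bind> M"
    and "M \<in> measurable (point_measure {..<n} (\<lambda>i. ennreal (a i))) (subprob_algebra (borel_on E))"
proof -
  let ?P = "point_measure {..<n} (\<lambda>i. ennreal (a i))"
  have ne: "space ?P \<noteq> {}" using n by (auto simp: space_point_measure)
  show m: "M \<in> measurable ?P (subprob_algebra (borel_on E))"
    using M by (auto simp: measurable_point_measure_eq1 space_subprob_algebra prob_measures_def intro: prob_space_imp_subprob_space)
  have sets: "sets (?P \<bind> M) = sets (borel_on E)" by (rule sets_bind_measurable[OF m ne])
  have space: "space (?P \<bind> M) = E" using sets_eq_imp_space_eq[OF sets] by (simp add: space_restrict_space)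
  have em: "emeasure (?P \<bind> M) A = (\<Sum>i<n. ennreal (a i) * emeasure (M i) A)" if "A \<in> sets (borel_on E)" for A
    using that by (subst emeasure_bind[OF ne m]) (auto simp: nn_integral_point_measure_finite)
  have "convex_combination E n a M = measure_of (space (?P \<bind> M)) (sets (?P \<bind> M)) (emeasure (?P \<bind> M))"
    unfolding convex_combination_def space sets
  proof (intro measure_of_eq)
    show "sets (borel_on E) \<subseteq> Pow E"
      using sets.space_closed[of "borel_on E"] by (simp add: space_restrict_space)
    fix A assume "A \<in> sigma_sets E (sets (borel_on E))"
    then have "A \<in> sets (borel_on E)"
      using sets.sigma_sets_eq[of "borel_on E"] by (simp add: space_restrict_space)
    then show "(\<Sum>i<n. ennreal (a i) * emeasure (M i) A) = emeasure (?P \<bind> M) A" using em by simp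
  qed
  then show "convex_combination E n a M = ?P \<bind> M" by (simp add: measure_of_of_measure)
qed

context kingman begin

lemma F_map_convex_combination:
  fixes G :: "nat \<Rightarrow> (real ^ 'k) measure"
  assumes G: "\<And>i. i < n \<Longrightarrow> 0 \<le> a i \<and> G i \<in> prob_measures orthant" and a: "(\<Sum>i<n. a i) = 1"
  shows "F_map s (convex_combination orthant n a G) = convex_combination UNIV n a (\<lambda>i. F_map s (G i))"
proof -
  have n: "n > 0" using a by (cases n) auto
  let ?P = "point_measure {..<n} (\<lambda>i. ennreal (a i))"
  let ?K = "\<lambda>c. distr (angle_vec s) borel (\<lambda>u. c * u) :: (real ^ 'k) measure"
  \<comment> \<open>Measurability of the kernel depends only on the sigma-algebra, so it can be read
    off from any one member of the family.\<close>
  note G0 = prob_measures_orthantD[OF conjunct2[OF G[OF n]]]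
  have K: "?K \<in> measurable (borel_on orthant) (subprob_algebra borel)"
    using bind_distr_eq_distr_pair(2)[OF G0(1) prob_space_angle_vec measurable_times_vec[OF G0(2)]]
    by (simp add: measurable_cong_sets[OF G0(2) refl])
  have "F_map s (convex_combination orthant n a G) = (?P \<bind> G) \<bind> ?K"
    unfolding F_map_def product_dilate_eq using convex_combination_eq_bind(1)[OF n, of G orthant a] G by simp
  also have "\<dots> = ?P \<bind> (\<lambda>i. F_map s (G i))"
    unfolding F_map_def product_dilate_eq
    by (rule bind_assoc[OF convex_combination_eq_bind(2)[OF n] K]) (use G in simp)
  also have "\<dots> = convex_combination UNIV n a (\<lambda>i. F_map s (G i))"
    by (rule convex_combination_eq_bind(1)[OF n, symmetric]) (use G F_map_prob_measures in blast)
  finally show ?thesis .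
qed

lemma F_map_kingman_conv_vec:
  fixes G1 G2 :: "(real ^ 'k) measure"
  assumes G1: "G1 \<in> prob_measures orthant" and G2: "G2 \<in> prob_measures orthant"
  shows "(F_map s G1 \<star> F_map s G2) = F_map s (kingman_conv_vec s G1 G2)"
  by (rule char_fun_unique')
     (simp_all add: convolution_prob_measures F_map_prob_measures kingman_conv_vec_prob_measures char_fun_convolution
       char_fun_F_map radial_char_fun_kingman_conv_vec assms)

lemma return_orthant: "return (borel_on orthant) (0 :: real ^ 'k) \<in> prob_measures orthant"
  by (simp add: prob_measures_def prob_space_return space_restrict_space orthant_def)

lemma F_map_return_0: "F_map s (return (borel_on orthant) (0 :: real ^ 'k)) = return borel 0"
proof (rule char_fun_unique')
  fix t :: "real ^ 'k"
  have "radial_char_fun s (return (borel_on orthant) 0) t = 1"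
    unfolding radial_char_fun_def
    by (subst integral_return) (simp_all add: space_restrict_space orthant_def measurable_restrict_space1[OF radial_char_fun_measurable] Lambda_fun_0[OF s])
  then show "char_fun (F_map s (return (borel_on orthant) 0)) t = char_fun (return borel 0) t"
    by (simp add: char_fun_F_map return_orthant char_fun_return_0)
qed (simp_all add: F_map_prob_measures return_orthant return_0_prob_measures)

lemma F_map_dilate:
  fixes G :: "(real ^ 'k) measure"
  assumes G: "G \<in> prob_measures orthant" and c: "c > 0"
  shows "F_map s (dilate c G) = dilate c (F_map s G)"
proof -
  note G' = prob_measures_orthantD[OF G]
  have m: "(\<lambda>x. c *\<^sub>R x) \<in> measurable G (borel_on orthant)"
    unfolding measurable_cong_sets[OF G'(2) refl]
    by (rule measurable_restrict_space3) (use c in \<open>auto simp: orthant_def\<close>)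
  then have m': "(\<lambda>x. c *\<^sub>R x) \<in> measurable G G" by (simp add: measurable_cong_sets[OF refl G'(2)])
  have D: "dilate c G \<in> prob_measures orthant"
    using G m' unfolding dilate_def prob_measures_def by (auto intro: prob_space.prob_space_distr)
  have "radial_char_fun s (dilate c G) t = radial_char_fun s G (c *\<^sub>R t)" for t
  proof -
    have "(\<lambda>x. \<Prod>j\<in>UNIV. Lambda_fun s (t $ j * x $ j)) \<in> borel_measurable G"
      unfolding measurable_cong_sets[OF G'(2) refl] by (rule measurable_restrict_space1[OF radial_char_fun_measurable])
    from integral_distr[OF m' this] show ?thesis
      unfolding radial_char_fun_def dilate_def by (simp add: mult_ac)
  qed
  then show ?thesis
    by (intro char_fun_unique')
       (simp_all add: F_map_prob_measures D G dilate_prob_measures char_fun_dilate char_fun_F_map)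
qed

lemma F_range_subset: "(F_range s :: (real ^ 'k) measure set) \<subseteq> prob_measures UNIV"
  by (auto simp: F_range_def F_map_prob_measures)

lemma convolution_F_range:
  assumes "K1 \<in> F_range s" "K2 \<in> F_range s"
  shows "(K1 \<star> K2) \<in> (F_range s :: (real ^ 'k) measure set)"
  using assms unfolding F_range_def by (auto simp: F_map_kingman_conv_vec intro!: imageI kingman_conv_vec_prob_measures)

section \<open>The image of the Rayleigh law and the centred normal law\<close>

lemma rayleigh_vec_prob_measures: "(rayleigh_vec s :: (real ^ 'k) measure) \<in> prob_measures orthant"
  unfolding rayleigh_vec_def product_measure_def prob_measures_def
  using measurable_vec_lambda_orthant[of "\<lambda>_::'k. rayleigh s"]
  by (auto intro!: prob_space.prob_space_distr prob_space_PiM prob_space_rayleigh s simp: sets_rayleigh)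

lemma radial_char_fun_rayleigh_vec:
  "radial_char_fun s (rayleigh_vec s) t = exp (- (t \<bullet> t) / (4 * (s + 1)))" for t :: "real ^ 'k"
proof -
  have L: "(\<lambda>x. Lambda_fun s (c * x)) \<in> borel_measurable borel" for c
    by (intro borel_measurable_continuous_onI continuous_on_compose2[OF continuous_Lambda_fun[OF s]] continuous_intros) auto
  interpret prob_space "rayleigh s" by (rule prob_space_rayleigh[OF s])
  have i: "integrable (rayleigh s) (\<lambda>x. Lambda_fun s (c * x))" for c
    by (rule integrable_bounded[where B = 1])
       (simp_all add: abs_Lambda_fun_le[OF s] measurable_cong_sets[OF sets_rayleigh refl] measurable_restrict_space1[OF L])
  have "radial_char_fun s (rayleigh_vec s) t = (\<Prod>i\<in>UNIV. (\<integral>x. Lambda_fun s (t $ i * x) \<partial>rayleigh s))"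
    unfolding radial_char_fun_def rayleigh_vec_def
    by (rule integral_product_measure_prod[OF prob_space_rayleigh[OF s] measurable_vec_lambda_orthant[OF sets_rayleigh] i L])
  also have "\<dots> = exp (\<Sum>i\<in>UNIV. - (t $ i)\<^sup>2 / (4 * (s + 1)))"
    by (simp add: integral_Lambda_rayleigh[OF s] exp_sum)
  also have "(\<Sum>i\<in>UNIV. - (t $ i)\<^sup>2 / (4 * (s + 1))) = - (t \<bullet> t) / (4 * (s + 1))"
    by (simp add: inner_vec_def sum_divide_distrib[symmetric] sum_negf power2_eq_square)
  finally show ?thesis .
qed

end

lemma char_normal_density:
  assumes "\<sigma> > 0"
  shows "(CLINT x|lborel. normal_density 0 \<sigma> x *\<^sub>R iexp (t * x)) = complex_of_real (exp (- (\<sigma> * t)\<^sup>2 / 2))"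
proof -
  have "(CLINT x|lborel. normal_density 0 \<sigma> x *\<^sub>R iexp (t * x)) =
     (CLINT x|lborel. \<sigma> *\<^sub>R (normal_density 0 \<sigma> (\<sigma> * x) *\<^sub>R iexp (t * (\<sigma> * x))))"
    using assms by (subst lborel_integral_real_affine[of \<sigma> _ 0]) (simp_all only: Bochner_Integration.integral_scaleR_right add_0 abs_of_pos)
  also have "\<dots> = (CLINT x|lborel. std_normal_density x *\<^sub>R iexp ((\<sigma> * t) * x))"
    using assms by (intro Bochner_Integration.integral_cong refl)
      (simp add: normal_density_def real_sqrt_mult power_mult_distrib mult_ac)
  also have "\<dots> = char std_normal_distribution (\<sigma> * t)"
    unfolding char_def by (subst integral_density) (auto simp: normal_density_nonneg)
  finally show ?thesis by (simp add: char_std_normal_distribution)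
qed

lemma mat_matrix_mult_mat: "mat r ** mat q = (mat (r * q) :: real ^ 'k ^ 'k)"
  by (simp add: matrix_matrix_mult_def mat_def vec_eq_iff if_distrib[of "\<lambda>x. _ * x"] if_distrib[of "\<lambda>x. x * _"] cong: if_cong)

lemma matrix_inv_mat:
  assumes "r \<noteq> 0" shows "matrix_inv (mat r) = (mat (1 / r) :: real ^ 'k ^ 'k)"
  unfolding matrix_inv_def
proof (rule some_equality)
  show "mat r ** mat (1 / r) = (mat 1 :: real ^ 'k ^ 'k) \<and> mat (1 / r) ** mat r = (mat 1 :: real ^ 'k ^ 'k)"
    using assms by (simp add: mat_matrix_mult_mat)
  fix A :: "real ^ 'k ^ 'k" assume A: "mat r ** A = mat 1 \<and> A ** mat r = mat 1"
  have "A = (mat (1 / r) ** mat r) ** A" using assms by (simp add: mat_matrix_mult_mat)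
  also have "\<dots> = mat (1 / r)" using A by (simp add: matrix_mul_assoc[symmetric])
  finally show "A = mat (1 / r)" .
qed

lemma mat_vector_mult: "mat r *v x = r *\<^sub>R (x :: real ^ 'k)"
  by (simp add: matrix_vector_mult_def mat_def vec_eq_iff if_distrib[of "\<lambda>x. x * _"] cong: if_cong)

lemma det_mat: "det (mat r :: real ^ 'k ^ 'k) = r ^ CARD('k)"
  by (subst det_diagonal) (simp_all add: mat_def)

lemma inner_self_eq_sum_Basis: "x \<bullet> x = (\<Sum>b\<in>Basis. (x \<bullet> b)\<^sup>2)"
  unfolding power2_eq_square by (rule euclidean_inner)

lemma centred_normal_mat:
  assumes r: "r > 0"
  shows "centred_normal (mat r :: real ^ 'k ^ 'k) = density lborel (\<lambda>x. ennreal (\<Prod>b\<in>Basis. normal_density 0 (sqrt r) (x \<bullet> b)))"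
proof -
  have "exp (- (x \<bullet> ((1 / r) *\<^sub>R x)) / 2) / sqrt ((2 * pi) ^ CARD('k) * r ^ CARD('k)) = (\<Prod>b\<in>Basis. normal_density 0 (sqrt r) (x \<bullet> b))"
    for x :: "real ^ 'k"
  proof -
    have "(\<Prod>b\<in>Basis. normal_density 0 (sqrt r) (x \<bullet> b)) = (1 / sqrt (2 * pi * r)) ^ CARD('k) * exp (\<Sum>b\<in>Basis. - (x \<bullet> b)\<^sup>2 / (2 * r))"
      using r by (simp add: normal_density_def exp_sum prod.distrib prod_dividef power_divide)
    also have "(\<Sum>b\<in>Basis. - (x \<bullet> b)\<^sup>2 / (2 * r)) = - (x \<bullet> ((1 / r) *\<^sub>R x)) / 2"
    proof -
      have "(\<Sum>b\<in>Basis. - (x \<bullet> b)\<^sup>2 / (2 * r)) = - (\<Sum>b\<in>Basis. (x \<bullet> b)\<^sup>2) / (2 * r)"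
        by (subst sum_divide_distrib[symmetric]) (simp only: sum_negf)
      then show ?thesis unfolding inner_self_eq_sum_Basis[symmetric] by simp
    qed
    finally have p: "(\<Prod>b\<in>Basis. normal_density 0 (sqrt r) (x \<bullet> b)) = (1 / sqrt (2 * pi * r)) ^ CARD('k) * exp (- (x \<bullet> ((1 / r) *\<^sub>R x)) / 2)" .
    have q: "sqrt ((2 * pi) ^ CARD('k) * r ^ CARD('k)) = sqrt (2 * pi * r) ^ CARD('k)"
      by (simp only: power_mult_distrib[symmetric] real_sqrt_power)
    show ?thesis unfolding p q power_one_over by (simp only: divide_inverse mult_1_left mult.commute)
  qed
  then show ?thesis using r by (simp add: centred_normal_def matrix_inv_mat mat_vector_mult det_mat)
qed

lemma centred_normal_prob_measures:
  assumes r: "r > 0" shows "centred_normal (mat r :: real ^ 'k ^ 'k) \<in> prob_measures UNIV"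
proof -
  have "integral\<^sup>N lborel (\<lambda>x::real ^ 'k. ennreal (\<Prod>b\<in>Basis. normal_density 0 (sqrt r) (x \<bullet> b)))
      = integral\<^sup>N lborel (\<lambda>x::real ^ 'k. \<Prod>b\<in>Basis. ennreal (normal_density 0 (sqrt r) (x \<bullet> b)))"
    by (simp add: prod_ennreal normal_density_nonneg)
  also have "\<dots> = (\<Prod>b\<in>(Basis :: (real ^ 'k) set). (\<integral>\<^sup>+x. ennreal (normal_density 0 (sqrt r) x) \<partial>lborel))"
    by (rule nn_integral_lborel_prod) simp_all
  also have "\<dots> = 1"
    using r by (subst nn_integral_eq_integral) (simp_all add: normal_density_nonneg)
  finally show ?thesis
    unfolding centred_normal_mat[OF r] prob_measures_def borel_on_UNIV
    by (auto intro!: prob_spaceI simp: emeasure_density)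
qed

text \<open>Lebesgue measure is the image of a product measure over the basis, and both the density
  and the exponential factor along it.\<close>

lemma char_fun_centred_normal:
  assumes r: "r > 0" shows "char_fun (centred_normal (mat r :: real ^ 'k ^ 'k)) t = complex_of_real (exp (- (r * (t \<bullet> t)) / 2))"
proof -
  let ?\<phi> = "normal_density 0 (sqrt r)"
  have m: "(\<lambda>f. \<Sum>b\<in>Basis. f b *\<^sub>R b) \<in> measurable (Pi\<^sub>M Basis (\<lambda>_. lborel)) (borel :: (real ^ 'k) measure)"
    by (intro borel_measurable_sum borel_measurable_scaleR borel_measurable_const)
       (use measurable_component_singleton[of _ Basis "\<lambda>_. lborel :: real measure"] in \<open>simp cong: measurable_cong_sets\<close>)
  interpret product_sigma_finite "\<lambda>_::real ^ 'k. lborel :: real measure" ..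
  have "char_fun (centred_normal (mat r)) t = (CLINT x|lborel. (\<Prod>b\<in>Basis. ?\<phi> (x \<bullet> b)) *\<^sub>R iexp (t \<bullet> x))"
    unfolding char_fun_def centred_normal_mat[OF r]
    by (subst integral_density) (auto intro!: prod_nonneg normal_density_nonneg)
  also have "\<dots> = (CLINT x|lborel. (\<Prod>b\<in>Basis. ?\<phi> (x \<bullet> b) *\<^sub>R iexp ((t \<bullet> b) * (x \<bullet> b))))"
    by (subst euclidean_inner) (simp add: exp_sum sum_distrib_left prod.distrib scaleR_conv_of_real)
  also have "\<dots> = (CLINT f|Pi\<^sub>M Basis (\<lambda>_. lborel). (\<Prod>b\<in>Basis. ?\<phi> (f b) *\<^sub>R iexp ((t \<bullet> b) * f b)))"
    by (subst lborel_eq, subst integral_distr[OF m]) (auto simp: inner_sum_left inner_Basis if_distrib sum.delta cong: if_cong)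
  also have "\<dots> = (\<Prod>b\<in>Basis. CLINT x|lborel. ?\<phi> x *\<^sub>R iexp ((t \<bullet> b) * x))"
  proof (rule product_integral_prod)
    show "integrable lborel (\<lambda>x. ?\<phi> x *\<^sub>R iexp ((t \<bullet> i) * x))" for i
      by (rule Bochner_Integration.integrable_bound[of _ ?\<phi>]) (use r in \<open>auto simp: normal_density_nonneg\<close>)
  qed simp
  also have "\<dots> = complex_of_real (exp (\<Sum>b\<in>Basis. - (sqrt r * (t \<bullet> b))\<^sup>2 / 2))"
    using r by (simp only: char_normal_density real_sqrt_gt_zero exp_sum finite_Basis of_real_prod)
  also have "(\<Sum>b\<in>Basis. - (sqrt r * (t \<bullet> b))\<^sup>2 / 2) = - (r * (t \<bullet> t)) / 2"
  proof -
    have "(sqrt r * (t \<bullet> b))\<^sup>2 = r * (t \<bullet> b)\<^sup>2" for b using r by (simp add: power_mult_distrib)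
    then show ?thesis unfolding inner_self_eq_sum_Basis
      by (simp only: sum_divide_distrib[symmetric] sum_negf sum_distrib_left[symmetric])
  qed
  finally show ?thesis .
qed

context kingman begin

text \<open>The characteristic function exp(- |t|^2 / (4 (s + 1))) is exp(- r |t|^2 / 2) for r = 1 /
  (2 (s + 1)); this is where the covariance comes from.\<close>

lemma F_map_rayleigh_vec: "F_map s (rayleigh_vec s :: (real ^ 'k) measure) = centred_normal (mat (1 / (2 * (s + 1))))"
proof (rule char_fun_unique')
  have r: "1 / (2 * (s + 1)) > 0" using s by simp
  show "(centred_normal (mat (1 / (2 * (s + 1)))) :: (real ^ 'k) measure) \<in> prob_measures UNIV"
    by (rule centred_normal_prob_measures[OF r])
  show "char_fun (F_map s (rayleigh_vec s :: (real ^ 'k) measure)) t = char_fun (centred_normal (mat (1 / (2 * (s + 1))))) t" for t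
    unfolding char_fun_F_map[OF rayleigh_vec_prob_measures] radial_char_fun_rayleigh_vec char_fun_centred_normal[OF r]
    by simp
qed (rule F_map_prob_measures[OF rayleigh_vec_prob_measures])

end


section \<open>Sequential compactness of the probability measures on a cube\<close>

lemma binary_expansion:
  fixes x :: real
  assumes x: "x \<in> {0..1}"
  obtains b :: "nat \<Rightarrow> real" where "\<And>n. b n \<in> {0, 1}" "(\<lambda>n. b n / 2 ^ Suc n) sums x"
proof -
  \<comment> \<open>\<open>r n\<close> is 2^n times the remainder after n digits, an orbit of the
    doubling map. It stays in [0,1], also for x = 1, where all digits are 1.\<close>
  define r where "r = rec_nat x (\<lambda>_ y. 2 * y - of_bool (1/2 \<le> y))"
  define b :: "nat \<Rightarrow> real" where "b n = of_bool (1/2 \<le> r n)" for n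
  have r0: "r 0 = x" and rS: "r (Suc n) = 2 * r n - b n" for n by (simp_all add: r_def b_def)
  have r01: "r n \<in> {0..1}" for n
  proof (induction n)
    case (Suc n) then show ?case by (auto simp: rS b_def)
  qed (use x r0 in auto)
  have part: "(\<Sum>i<n. b i / 2 ^ Suc i) = x - r n / 2 ^ n" for n
    by (induction n) (simp_all add: r0 rS field_simps)
  have "(\<lambda>n. r n / 2 ^ n) \<longlonglongrightarrow> 0"
  proof (rule tendsto_sandwich)
    show "\<forall>\<^sub>F n in sequentially. 0 \<le> r n / 2 ^ n" "\<forall>\<^sub>F n in sequentially. r n / 2 ^ n \<le> (1 / 2) ^ n"
      using r01 by (auto intro!: always_eventually divide_right_mono simp: power_one_over inverse_eq_divide)
    show "(\<lambda>n. (1 / 2 :: real) ^ n) \<longlonglongrightarrow> 0" by (rule LIMSEQ_realpow_zero) auto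
  qed simp
  then have "(\<lambda>n. x - r n / 2 ^ n) \<longlonglongrightarrow> x - 0" by (intro tendsto_intros)
  then have "(\<lambda>n. b n / 2 ^ Suc n) sums x" unfolding sums_def part by simp
  moreover have "b n \<in> {0, 1}" for n by (simp add: b_def)
  ultimately show thesis using that by blast
qed

text \<open>Schoenberg's space-filling curve: the tent-like function \<open>tent\<close> has period 2 and reads off the
  first ternary digit of a point of the Cantor set.\<close>

definition tent :: "real \<Rightarrow> real" where
  "tent t = max 0 (min 1 (1/2 - cos (pi * t)))"

text \<open>Coordinate j reads the digits at the positions congruent to j modulo k. For different j
  < k these sets are disjoint, so one parameter can prescribe all coordinates independently.\<close>

definition schoenberg :: "nat \<Rightarrow> nat \<Rightarrow> real \<Rightarrow> real" where
  "schoenberg k j t = (\<Sum>n. tent (3 ^ (k * n + j) * t) / 2 ^ Suc n)"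

definition cantor_point :: "(nat \<Rightarrow> real) \<Rightarrow> real" where
  "cantor_point c = (\<Sum>n. 2 * c n / 3 ^ Suc n)"

lemma tent_bounds: "0 \<le> tent t" "tent t \<le> 1"
  by (simp_all add: tent_def)

lemma geometric_half_sums: "(\<lambda>n. 1 / 2 ^ Suc n :: real) sums 1"
  using power_half_series by (simp add: power_one_over)

lemma cantor_point_Suc:
  assumes c: "\<And>n. c n \<in> {0, 1}"
  shows "3 * cantor_point c = 2 * c 0 + cantor_point (\<lambda>n. c (Suc n))" and "cantor_point c \<in> {0..1}"
proof -
  have g: "(\<lambda>n. 2 / 3 ^ Suc n :: real) sums 1"
    using sums_mult[OF geometric_sums[of "1/3 :: real"], of "2/3"] by (simp add: power_one_over)
  have le: "0 \<le> 2 * c n / 3 ^ Suc n" "2 * c n / 3 ^ Suc n \<le> 2 / 3 ^ Suc n" if "\<And>n. c n \<in> {0, 1}" for n and c :: "nat \<Rightarrow> real"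
    using that[of n] by auto
  have sm: "summable (\<lambda>n. 2 * c n / 3 ^ Suc n)" if "\<And>n. c n \<in> {0, 1}" for c :: "nat \<Rightarrow> real"
    by (rule summable_comparison_test'[OF sums_summable[OF g], of 0]) (simp only: real_norm_def abs_of_nonneg[OF le(1)[where c = c, OF that]] le(2)[where c = c, OF that])
  show "cantor_point c \<in> {0..1}"
    unfolding cantor_point_def
    using suminf_nonneg[OF sm[where c = c, OF c] le(1)[where c = c, OF c]]
      suminf_le[OF le(2)[where c = c, OF c] sm[where c = c, OF c] sums_summable[OF g]] sums_unique[OF g] by simp
  have "cantor_point c = 2 * c 0 / 3 + (\<Sum>n. 2 * c (Suc n) / 3 ^ Suc (Suc n))"
    unfolding cantor_point_def using suminf_split_head[OF sm[where c = c, OF c]] by simp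
  also have "(\<Sum>n. 2 * c (Suc n) / 3 ^ Suc (Suc n)) = (\<Sum>n. 2 * c (Suc n) / 3 ^ Suc n) / 3"
    by (subst suminf_divide[OF sm, symmetric]) (use c in \<open>simp_all add: field_simps\<close>)
  finally show "3 * cantor_point c = 2 * c 0 + cantor_point (\<lambda>n. c (Suc n))" by (simp add: cantor_point_def)
qed

text \<open>Multiplication by 3 shifts the digits and adds the even integer \<open>2 * c 0\<close>,
  which the period 2 of \<open>tent\<close> ignores. Only the first digit needs an estimate: it puts
  the point into [0,1/3] or [2/3,1], where \<open>tent\<close> is constantly 0 or 1.\<close>

lemma tent_cantor_point:
  assumes "\<And>n. c n \<in> {0, 1}"
  shows "tent (3 ^ m * cantor_point c) = c m"
  using assms
proof (induction m arbitrary: c)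
  case 0
  let ?t = "cantor_point c" and ?u = "cantor_point (\<lambda>n. c (Suc n))"
  have u: "?u \<in> {0..1}" using 0 by (intro cantor_point_Suc(2)) auto
  have t: "?t = 2 / 3 * c 0 + ?u / 3" using cantor_point_Suc(1)[of c] 0 by simp
  show ?case
  proof (cases "c 0 = 0")
    case True
    have "cos (pi / 3) \<le> cos (pi * ?t)"
      using u t True by (intro cos_monotone_0_pi_le) (auto simp: field_simps)
    then show ?thesis using True by (simp add: tent_def cos_60)
  next
    case False
    then have c0: "c 0 = 1" using 0[of 0] by simp
    have "cos (pi * ?t) \<le> cos (pi * (2 / 3))"
    proof (intro cos_monotone_0_pi_le)
      show "pi * ?t \<le> pi" using u t c0 by (simp add: mult_left_le)
    qed (use u t c0 in \<open>auto intro!: mult_left_mono\<close>)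
    also have "cos (pi * (2 / 3)) = - (1 / 2)" using cos_120 by (simp add: mult.commute)
    finally show ?thesis using c0 by (simp add: tent_def)
  qed
next
  case (Suc m)
  obtain K :: nat where K: "c 0 = real K" using Suc.prems[of 0] by (auto intro: that[of 0] that[of 1])
  have "3 ^ Suc m * cantor_point c = 3 ^ m * (3 * cantor_point c)" by simp
  also have "\<dots> = 3 ^ m * (2 * real K + cantor_point (\<lambda>n. c (Suc n)))"
    unfolding cantor_point_Suc(1)[OF Suc.prems] K ..
  also have "\<dots> = 3 ^ m * cantor_point (\<lambda>n. c (Suc n)) + 2 * real (3 ^ m * K)"
    by (simp add: algebra_simps)
  finally have pe: "pi * (3 ^ Suc m * cantor_point c) = pi * (3 ^ m * cantor_point (\<lambda>n. c (Suc n))) + 2 * real (3 ^ m * K) * pi"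
    by (simp only: distrib_left) (simp add: mult_ac)
  have "tent (3 ^ Suc m * cantor_point c) = tent (3 ^ m * cantor_point (\<lambda>n. c (Suc n)))"
    unfolding tent_def pe cos_add cos_2npi sin_2npi by simp
  also have "\<dots> = c (Suc m)" using Suc.prems by (intro Suc.IH) auto
  finally show ?case .
qed

lemma schoenberg_bounds: "schoenberg k j t \<in> {0..1}"
  and continuous_schoenberg: "continuous_on UNIV (schoenberg k j)"
proof -
  have le: "0 \<le> tent x / 2 ^ Suc n" "tent x / 2 ^ Suc n \<le> 1 / 2 ^ Suc n" for x n
    using tent_bounds[of x] by (auto intro!: divide_right_mono)
  have g: "summable (\<lambda>n. 1 / 2 ^ Suc n :: real)" by (rule sums_summable[OF geometric_half_sums])
  have sm: "summable (\<lambda>n. tent (3 ^ (k * n + j) * t) / 2 ^ Suc n)" for t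
    by (rule summable_comparison_test'[OF g, of 0]) (use le in \<open>simp only: real_norm_def abs_of_nonneg\<close>)
  show "schoenberg k j t \<in> {0..1}"
    unfolding schoenberg_def
    using suminf_nonneg[OF sm le(1)] suminf_le[OF le(2) sm g] sums_unique[OF geometric_half_sums] by simp
  have "uniform_limit UNIV (\<lambda>n t. \<Sum>i<n. tent (3 ^ (k * i + j) * t) / 2 ^ Suc i) (\<lambda>t. \<Sum>i. tent (3 ^ (k * i + j) * t) / 2 ^ Suc i) sequentially"
    by (rule Weierstrass_m_test[OF _ g]) (simp only: real_norm_def abs_of_nonneg le)
  then have "uniform_limit UNIV (\<lambda>n t. \<Sum>i<n. tent (3 ^ (k * i + j) * t) / 2 ^ Suc i) (schoenberg k j) sequentially"
    by (simp only: schoenberg_def[abs_def])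
  then show "continuous_on UNIV (schoenberg k j)"
    by (rule uniform_limit_theorem[rotated]) (auto simp: tent_def intro!: always_eventually continuous_intros)
qed

definition unit_cube :: "(real ^ 'k) set" where
  "unit_cube = {x. \<forall>i. x $ i \<in> {0..1}}"

lemma unit_cube_eq_cbox: "unit_cube = cbox 0 1"
  by (auto simp: unit_cube_def mem_box_cart)

lemma bounded_on_unit_cube:
  fixes f :: "real ^ 'k \<Rightarrow> real"
  assumes f: "continuous_on UNIV f"
  obtains B where "\<And>x. x \<in> unit_cube \<Longrightarrow> \<bar>f x\<bar> \<le> B"
proof -
  have "compact (f ` unit_cube)"
    unfolding unit_cube_eq_cbox by (intro compact_continuous_image continuous_on_subset[OF f]) auto
  then obtain B where "\<forall>x\<in>unit_cube. \<bar>f x\<bar> \<le> B" by (auto dest!: compact_imp_bounded simp: bounded_iff)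
  then show thesis using that by blast
qed

lemma space_filling_curve:
  obtains \<gamma> :: "real \<Rightarrow> real ^ 'k" where "continuous_on UNIV \<gamma>" "\<And>t. \<gamma> t \<in> unit_cube" "unit_cube \<subseteq> \<gamma> ` {0..1}"
proof -
  let ?k = "CARD('k)"
  obtain h :: "'k \<Rightarrow> nat" where h: "bij_betw h UNIV {0..<?k}"
    using ex_bij_betw_finite_nat[of "UNIV :: 'k set"] by auto
  define \<gamma> :: "real \<Rightarrow> real ^ 'k" where "\<gamma> t = (\<chi> i. schoenberg ?k (h i) t)" for t
  have "continuous_on UNIV \<gamma>"
    unfolding \<gamma>_def by (intro continuous_on_vec_lambda continuous_schoenberg)
  moreover have "\<gamma> t \<in> unit_cube" for t
    using schoenberg_bounds by (simp add: \<gamma>_def unit_cube_def)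
  moreover have "unit_cube \<subseteq> \<gamma> ` {0..1}"
  proof
    fix x :: "real ^ 'k" assume "x \<in> unit_cube"
    then have x01: "x $ i \<in> {0..1}" for i by (simp add: unit_cube_def)
    have "\<exists>b. (\<forall>n. b n \<in> {0, 1 :: real}) \<and> (\<lambda>n. b n / 2 ^ Suc n) sums (x $ i)" for i
      by (rule binary_expansion[OF x01[of i]]) blast
    then have "\<exists>b. \<forall>i. (\<forall>n. b i n \<in> {0, 1 :: real}) \<and> (\<lambda>n. b i n / 2 ^ Suc n) sums (x $ i)"
      by (intro choice allI)
    then obtain b where b: "\<And>i n. b i n \<in> {0, 1 :: real}" "\<And>i. (\<lambda>n. b i n / 2 ^ Suc n) sums (x $ i)" by blast
    \<comment> \<open>Interleaving: position k n + h i holds the n-th binary digit of coordinate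
      i.\<close>
    define c where "c m = b (inv_into UNIV h (m mod ?k)) (m div ?k)" for m
    have c: "c m \<in> {0, 1}" for m unfolding c_def by (rule b)
    have "inj h" using h by (simp add: bij_betw_def)
    have "c (?k * n + h i) = b i n" for n i
    proof -
      have "h i < ?k" using h by (auto simp: bij_betw_def)
      then show ?thesis using \<open>inj h\<close> by (simp add: c_def)
    qed
    then have "schoenberg ?k (h i) (cantor_point c) = x $ i" for i
      unfolding schoenberg_def tent_cantor_point[OF c] using b(2)[of i] by (simp add: sums_iff)
    then have "x = \<gamma> (cantor_point c)" by (simp add: \<gamma>_def vec_eq_iff)
    then show "x \<in> \<gamma> ` {0..1}" using cantor_point_Suc(2)[where c = c, OF c] by blast
  qed
  ultimately show thesis using that by blast
qed

section \<open>Borel sections and convergent subsequences on the cube\<close>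

text \<open>The least preimage is chosen. Its sublevel sets are, up to the complement of S,
  continuous images of compact sets, hence Borel.\<close>

lemma measurable_section:
  fixes \<gamma> :: "real \<Rightarrow> 'a::{t2_space, second_countable_topology}"
  assumes \<gamma>: "continuous_on UNIV \<gamma>" and S: "S = \<gamma> ` {0..1}"
  obtains \<sigma> where "\<sigma> \<in> borel_measurable borel" "\<And>x. \<sigma> x \<in> {0..1}" "\<And>x. x \<in> S \<Longrightarrow> \<gamma> (\<sigma> x) = x"
proof -
  define \<sigma> where "\<sigma> x = (if x \<in> S then Inf ({0..1} \<inter> \<gamma> -` {x}) else 0)" for x
  have cl: "closed ({0..1} \<inter> \<gamma> -` {x})" for x
    using \<gamma> by (intro closed_Int closed_vimage) (auto simp: continuous_on_eq_continuous_at)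
  have bb: "bdd_below ({0..1} \<inter> \<gamma> -` {x})" for x by (rule bdd_below_mono[of "{0..1}"]) auto
  have inS: "Inf ({0..1} \<inter> \<gamma> -` {x}) \<in> {0..1} \<inter> \<gamma> -` {x}" if "x \<in> S" for x
    using that S by (intro closed_contains_Inf cl bb) auto
  have compact_im: "compact (\<gamma> ` ({0..1} \<inter> {..a}))" for a :: real
    by (intro compact_continuous_image continuous_on_subset[OF \<gamma>] compact_Int_closed) auto
  have "compact S" unfolding S by (intro compact_continuous_image continuous_on_subset[OF \<gamma>]) auto
  have "\<sigma> \<in> borel_measurable borel"
    unfolding borel_measurable_iff_le
  proof (intro allI)
    fix a :: real
    \<comment> \<open>Points outside S have the default value 0, which puts \<open>- S\<close> into
      every sublevel set with a >= 0.\<close>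
    have "{x. \<sigma> x \<le> a} = (if a < 0 then {} else \<gamma> ` ({0..1} \<inter> {..a}) \<union> - S)"
    proof (intro equalityI subsetI)
      fix x assume "x \<in> {x. \<sigma> x \<le> a}"
      then have x: "\<sigma> x \<le> a" by simp
      show "x \<in> (if a < 0 then {} else \<gamma> ` ({0..1} \<inter> {..a}) \<union> - S)"
      proof (cases "x \<in> S")
        case True
        then have "\<sigma> x \<in> {0..1}" "\<gamma> (\<sigma> x) = x" using inS[OF True] by (simp_all add: \<sigma>_def)
        then show ?thesis using x by (auto intro!: image_eqI[of x \<gamma> "\<sigma> x"])
      next
        case False then show ?thesis using x by (simp add: \<sigma>_def)
      qed
    next
      fix x assume x: "x \<in> (if a < 0 then {} else \<gamma> ` ({0..1} \<inter> {..a}) \<union> - S)"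
      show "x \<in> {x. \<sigma> x \<le> a}"
      proof (cases "x \<in> S")
        case True
        with x obtain t where t: "t \<in> {0..1}" "t \<le> a" "x = \<gamma> t" by (auto split: if_splits)
        have "Inf ({0..1} \<inter> \<gamma> -` {x}) \<le> t" using t by (intro cInf_lower bb) auto
        then show ?thesis using True t by (simp add: \<sigma>_def)
      next
        case False then show ?thesis using x by (auto simp: \<sigma>_def split: if_splits)
      qed
    qed
    then show "{w \<in> space borel. \<sigma> w \<le> a} \<in> sets borel"
      using borel_compact[OF compact_im[of a]] borel_compact[OF \<open>compact S\<close>] by auto
  qed
  moreover have "\<sigma> x \<in> {0..1}" for x using inS[of x] by (auto simp: \<sigma>_def)
  moreover have "\<gamma> (\<sigma> x) = x" if "x \<in> S" for x using inS[OF that] that by (simp add: \<sigma>_def)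
  ultimately show thesis using that by blast
qed

text \<open>Only the curve has to be continuous: it turns test functions on the cube into test
  functions on the line. For the section Borel measurability is enough, since
  \<open>\<gamma> (\<sigma> x) = x\<close> on the cube makes the transported integrals equal to the
  original ones.\<close>

lemma unit_cube_convergent_subsequence:
  fixes \<mu> :: "nat \<Rightarrow> (real ^ 'k) measure"
  assumes P: "\<And>n. \<mu> n \<in> prob_measures UNIV" and S: "\<And>n. AE x in \<mu> n. x \<in> unit_cube"
  obtains r \<nu> where "strict_mono (r :: nat \<Rightarrow> nat)" "\<nu> \<in> prob_measures UNIV" "AE x in \<nu>. x \<in> unit_cube"
    "\<And>f :: real ^ 'k \<Rightarrow> real. continuous_on UNIV f \<Longrightarrow> (\<lambda>n. \<integral>x. f x \<partial>\<mu> (r n)) \<longlonglongrightarrow> (\<integral>x. f x \<partial>\<nu>)"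
proof -
  note [measurable_cong] = prob_measures_UNIVD(2)[OF P]
  obtain \<gamma> :: "real \<Rightarrow> real ^ 'k" where \<gamma>: "continuous_on UNIV \<gamma>" "\<And>t. \<gamma> t \<in> unit_cube" "unit_cube \<subseteq> \<gamma> ` {0..1}"
    using space_filling_curve by blast
  have [measurable]: "\<gamma> \<in> borel_measurable borel" using \<gamma>(1) by (rule borel_measurable_continuous_onI)
  have "unit_cube = \<gamma> ` {0..1}" using \<gamma>(2,3) by auto
  then obtain \<sigma> where \<sigma>[measurable]: "\<sigma> \<in> borel_measurable borel" and \<sigma>01: "\<And>x. \<sigma> x \<in> {0..1}"
      and \<gamma>\<sigma>: "\<And>x. x \<in> unit_cube \<Longrightarrow> \<gamma> (\<sigma> x) = x"
    using measurable_section[OF \<gamma>(1)] by blast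
  define \<kappa> where "\<kappa> n = distr (\<mu> n) borel \<sigma>" for n
  have \<kappa>: "real_distribution (\<kappa> n)" for n
    unfolding \<kappa>_def real_distribution_def real_distribution_axioms_def
    using prob_measures_UNIVD(1)[OF P, of n] by (auto intro: prob_space.prob_space_distr)
  \<comment> \<open>Tightness is phrased with half-open intervals, and (-1,1] contains all values of
    the section.\<close>
  have "measure (\<kappa> n) {-1<..1} = 1" for n
  proof -
    interpret prob_space "\<mu> n" by (rule prob_measures_UNIVD[OF P])
    have "\<sigma> -` {-1<..1} = UNIV" using \<sigma>01 by (force simp: less_le_trans[of "-1" 0])
    then show ?thesis unfolding \<kappa>_def using prob_space by (subst measure_distr) (auto simp: prob_measures_UNIVD(3)[OF P])
  qed
  then have "tight \<kappa>"
    unfolding tight_def using \<kappa> by (intro conjI allI impI exI[of _ "-1"] exI[of _ 1]) simp_all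
  from tight_imp_convergent_subsubsequence[OF this strict_mono_id] obtain r \<rho> where
    r: "strict_mono r" and \<rho>: "real_distribution \<rho>" and w: "weak_conv_m (\<kappa> \<circ> id \<circ> r) \<rho>" by auto
  interpret \<rho>: real_distribution \<rho> by fact
  define \<nu> where "\<nu> = distr \<rho> borel \<gamma>"
  have \<nu>: "\<nu> \<in> prob_measures UNIV"
    unfolding \<nu>_def prob_measures_def borel_on_UNIV by (auto intro!: \<rho>.prob_space_distr)
  have cube[measurable]: "unit_cube \<in> sets (borel :: (real ^ 'k) measure)" by (simp add: unit_cube_eq_cbox)
  have "AE x in \<nu>. x \<in> unit_cube"
    unfolding \<nu>_def by (subst AE_distr_iff) (auto simp: \<gamma>(2))
  moreover have "(\<lambda>n. \<integral>x. f x \<partial>\<mu> (r n)) \<longlonglongrightarrow> (\<integral>x. f x \<partial>\<nu>)" if f: "continuous_on UNIV f" for f :: "real ^ 'k \<Rightarrow> real"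
  proof -
    have [measurable]: "f \<in> borel_measurable borel" using f by (rule borel_measurable_continuous_onI)
    obtain B where B: "\<And>x. x \<in> unit_cube \<Longrightarrow> \<bar>f x\<bar> \<le> B" using bounded_on_unit_cube[OF f] by blast
    have "isCont (\<lambda>t. f (\<gamma> t)) t" for t
      using continuous_on_compose2[OF f \<gamma>(1)] by (simp add: continuous_on_eq_continuous_at)
    moreover have "norm (f (\<gamma> t)) \<le> B" for t using B[OF \<gamma>(2)] by simp
    ultimately have "(\<lambda>n. \<integral>t. f (\<gamma> t) \<partial>(\<kappa> \<circ> id \<circ> r) n) \<longlonglongrightarrow> (\<integral>t. f (\<gamma> t) \<partial>\<rho>)"
      using \<kappa> by (intro weak_conv_imp_integral_bdd_continuous_conv[OF _ \<rho> w]) auto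
    moreover have "(\<integral>t. f (\<gamma> t) \<partial>(\<kappa> \<circ> id \<circ> r) n) = (\<integral>x. f x \<partial>\<mu> (r n))" for n
    proof -
      have "(\<integral>t. f (\<gamma> t) \<partial>(\<kappa> \<circ> id \<circ> r) n) = (\<integral>x. f (\<gamma> (\<sigma> x)) \<partial>\<mu> (r n))"
        by (simp add: \<kappa>_def) (subst integral_distr, auto)
      also have "\<dots> = (\<integral>x. f x \<partial>\<mu> (r n))"
        by (rule integral_cong_AE) (use S[of "r n"] \<gamma>\<sigma> in \<open>auto elim!: eventually_mono\<close>)
      finally show ?thesis .
    qed
    moreover have "(\<integral>t. f (\<gamma> t) \<partial>\<rho>) = (\<integral>x. f x \<partial>\<nu>)"
      unfolding \<nu>_def by (subst integral_distr) auto
    ultimately show ?thesis by simp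
  qed
  ultimately show thesis using that[OF r \<nu>] by blast
qed


section \<open>Laplace transforms as integrals against the image law\<close>

lemma continuous_on_integral_inner:
  fixes M :: "'a::euclidean_space measure" and g :: "real \<Rightarrow> real"
  assumes M: "prob_space M" and id: "(\<lambda>x. x) \<in> borel_measurable M"
    and g: "continuous_on UNIV g" and B: "\<And>x. \<bar>g x\<bar> \<le> 1"
  shows "continuous_on UNIV (\<lambda>w. \<integral>x. g (w \<bullet> x) \<partial>M)"
proof -
  interpret prob_space M by fact
  note [measurable] = id borel_measurable_continuous_onI[OF g]
  have "isCont (\<lambda>w. \<integral>x. g (w \<bullet> x) \<partial>M) w" for w
    unfolding continuous_at_sequentially comp_def
  proof (intro allI impI)
    fix X assume X: "X \<longlonglongrightarrow> w"
    show "(\<lambda>n. \<integral>x. g (X n \<bullet> x) \<partial>M) \<longlonglongrightarrow> (\<integral>x. g (w \<bullet> x) \<partial>M)"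
    proof (rule integral_dominated_convergence[where w = "\<lambda>_. 1"])
      show "AE x in M. (\<lambda>n. g (X n \<bullet> x)) \<longlonglongrightarrow> g (w \<bullet> x)"
        using g by (intro always_eventually allI isCont_tendsto_compose[of _ g] tendsto_inner X tendsto_const)
          (auto simp: continuous_on_eq_continuous_at)
    qed (use B in auto)
  qed
  then show ?thesis by (simp add: continuous_on_eq_continuous_at)
qed

lemma continuous_on_times_vec: "continuous_on UNIV (\<lambda>y. a * y :: real ^ 'k)"
proof -
  have "(\<lambda>y. a * y) = (\<lambda>y::real ^ 'k. \<chi> i. a $ i * y $ i)" by (auto simp: vec_eq_iff)
  then show ?thesis by (simp only:) (intro continuous_intros)
qed

context kingman begin

text \<open>The ordinary cosine transform of the Rayleigh law. Being bounded and continuous, it is a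
  legitimate test function for the weak topology on the image side.\<close>

definition rayleigh_cos :: "real ^ 'k \<Rightarrow> real" where
  "rayleigh_cos w = (\<integral>x. cos (w \<bullet> x) \<partial>rayleigh_vec s)"

lemma continuous_rayleigh_cos: "continuous_on UNIV (rayleigh_cos :: real ^ 'k \<Rightarrow> real)"
  unfolding rayleigh_cos_def using prob_measures_orthantD(1,2)[OF rayleigh_vec_prob_measures]
  by (intro continuous_on_integral_inner borel_on_id[where S = orthant] continuous_intros) (auto simp: measurable_restrict_space1 cong: measurable_cong_sets)

lemma abs_rayleigh_cos_le: "\<bar>rayleigh_cos w\<bar> \<le> 1" for w :: "real ^ 'k"
proof -
  interpret prob_space "rayleigh_vec s :: (real ^ 'k) measure" by (rule prob_measures_orthantD[OF rayleigh_vec_prob_measures])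
  have "\<bar>rayleigh_cos w\<bar> \<le> (\<integral>x. \<bar>cos (w \<bullet> x)\<bar> \<partial>rayleigh_vec s)" unfolding rayleigh_cos_def by (rule integral_abs_bound)
  also have "\<dots> \<le> (\<integral>x. 1 \<partial>(rayleigh_vec s :: (real ^ 'k) measure))"
    by (rule integral_mono_AE') auto
  finally show ?thesis by (simp add: prob_space)
qed

lemma borel_measurable_pair_restrict_space:
  assumes sM: "sets M = sets (borel_on A)" and sN: "sets N = sets (borel_on B)"
    and f: "case_prod f \<in> borel_measurable (borel :: ((real ^ 'k) \<times> (real ^ 'k)) measure)"
  shows "case_prod f \<in> borel_measurable (M \<Otimes>\<^sub>M N)"
proof -
  have "(\<lambda>x. x) \<in> borel_measurable M" "(\<lambda>x. x) \<in> borel_measurable N"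
    using sM sN by (simp_all add: measurable_restrict_space1 cong: measurable_cong_sets)
  then have "(\<lambda>p. (fst p, snd p)) \<in> measurable (M \<Otimes>\<^sub>M N) (borel \<Otimes>\<^sub>M borel)"
    by (intro measurable_Pair measurable_compose[OF measurable_fst] measurable_compose[OF measurable_snd])
  from measurable_compose[OF this[unfolded borel_prod] f] show ?thesis by simp
qed

lemma integral_swap_bounded:
  fixes f :: "'a \<Rightarrow> 'b \<Rightarrow> real"
  assumes G: "prob_space G" and V: "prob_space V" and f[measurable]: "case_prod f \<in> borel_measurable (G \<Otimes>\<^sub>M V)"
    and B: "\<And>c u. \<bar>f c u\<bar> \<le> B"
  shows "(\<integral>u. (\<integral>c. f c u \<partial>G) \<partial>V) = (\<integral>c. (\<integral>u. f c u \<partial>V) \<partial>G)"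
proof -
  interpret G: prob_space G by fact
  interpret V: prob_space V by fact
  interpret P: pair_prob_space G V ..
  show ?thesis
    by (rule P.Fubini_integral, rule P.P.integrable_const_bound[of _ B]) (auto simp: B)
qed

text \<open>The order of integration is exchanged twice. Integrating the cosine over the image law
  gives the radial characteristic function of G; integrating its kernel over the Rayleigh law gives
  a Gaussian in c.\<close>

lemma integral_rayleigh_cos_F_map:
  fixes G :: "(real ^ 'k) measure"
  assumes G: "G \<in> prob_measures orthant"
  shows "(\<integral>y. rayleigh_cos (\<tau> * y) \<partial>F_map s G) = (\<integral>c. exp (- ((\<tau> * c) \<bullet> (\<tau> * c)) / (4 * (s + 1))) \<partial>G)"
proof -
  let ?R = "rayleigh_vec s :: (real ^ 'k) measure"
  note R = prob_measures_orthantD[OF rayleigh_vec_prob_measures[where 'k = 'k]]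
  note F = prob_measures_UNIVD[OF F_map_prob_measures[OF G]]
  note G' = prob_measures_orthantD[OF G]
  have sF: "sets (F_map s G) = sets (borel_on UNIV)" using F(2) by (simp add: borel_on_UNIV)
  have e: "(\<tau> * y) \<bullet> x = (\<tau> * x) \<bullet> y" for x y :: "real ^ 'k" by (simp add: inner_vec_def mult_ac)
  have "(\<integral>y. rayleigh_cos (\<tau> * y) \<partial>F_map s G) = (\<integral>x. (\<integral>y. cos ((\<tau> * y) \<bullet> x) \<partial>F_map s G) \<partial>?R)"
    unfolding rayleigh_cos_def
  proof (rule integral_swap_bounded[OF R(1) F(1) borel_measurable_pair_restrict_space[OF R(2) sF], where B = 1])
    have "continuous_on UNIV (\<lambda>p::(real ^ 'k) \<times> (real ^ 'k). cos (\<Sum>i\<in>UNIV. (\<tau> $ i * snd p $ i) * fst p $ i))"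
      by (intro continuous_intros)
    then show "(\<lambda>(x, y). cos ((\<tau> * y) \<bullet> x)) \<in> borel_measurable borel"
      by (simp add: split_beta' inner_vec_def borel_measurable_continuous_onI)
  qed simp
  also have "\<dots> = (\<integral>x. radial_char_fun s G (\<tau> * x) \<partial>?R)"
  proof (rule Bochner_Integration.integral_cong[OF refl])
    fix x
    show "(\<integral>y. cos ((\<tau> * y) \<bullet> x) \<partial>F_map s G) = radial_char_fun s G (\<tau> * x)"
      using char_fun_F_map[OF G, of "\<tau> * x"] char_fun_cos_sin[OF F_map_prob_measures[OF G], of "\<tau> * x"]
      by (simp add: e complex_eq_iff)
  qed
  also have "\<dots> = (\<integral>c. (\<integral>x. (\<Prod>j\<in>UNIV. Lambda_fun s ((\<tau> * c) $ j * x $ j)) \<partial>?R) \<partial>G)"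
    unfolding radial_char_fun_def
  proof (subst integral_swap_bounded[OF R(1) G'(1) borel_measurable_pair_restrict_space[OF R(2) G'(2)], where B = 1, symmetric])
    have "continuous_on UNIV (\<lambda>p::(real ^ 'k) \<times> (real ^ 'k). (\<Prod>j\<in>UNIV. Lambda_fun s ((\<tau> $ j * fst p $ j) * snd p $ j)))"
      by (intro continuous_on_prod continuous_on_compose2[OF continuous_Lambda_fun[OF s]] continuous_intros) auto
    then show "(\<lambda>(x, c). \<Prod>j\<in>UNIV. Lambda_fun s ((\<tau> * x) $ j * c $ j)) \<in> borel_measurable borel"
      by (simp add: split_beta' borel_measurable_continuous_onI)
  qed (rule radial_char_fun_bound, simp add: mult_ac)
  also have "\<dots> = (\<integral>c. exp (- ((\<tau> * c) \<bullet> (\<tau> * c)) / (4 * (s + 1))) \<partial>G)"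
    unfolding radial_char_fun_rayleigh_vec[symmetric] radial_char_fun_def ..
  finally show ?thesis .
qed

text \<open>The scaling cancels the 4 (s + 1) of the Gaussian, so that for l >= 0 the integral
  against the image law is the Laplace transform of the squared coordinates at l.\<close>

definition laplace_kernel :: "real ^ 'k \<Rightarrow> real ^ 'k \<Rightarrow> real" where
  "laplace_kernel l y = rayleigh_cos ((\<chi> i. sqrt (4 * (s + 1) * l $ i)) * y)"

lemma continuous_laplace_kernel: "continuous_on UNIV (laplace_kernel l :: real ^ 'k \<Rightarrow> real)"
  unfolding laplace_kernel_def
  by (rule continuous_on_compose2[OF continuous_rayleigh_cos continuous_on_times_vec]) auto

lemma abs_laplace_kernel_le: "\<bar>laplace_kernel l y\<bar> \<le> 1"
  unfolding laplace_kernel_def by (rule abs_rayleigh_cos_le)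

lemma integral_laplace_kernel:
  fixes G :: "(real ^ 'k) measure"
  assumes G: "G \<in> prob_measures orthant" and l: "\<And>i. l $ i \<ge> 0"
  shows "(\<integral>y. laplace_kernel l y \<partial>F_map s G) = (\<integral>c. (\<Prod>i\<in>UNIV. exp (- (l $ i * (c $ i)\<^sup>2))) \<partial>G)"
proof -
  have "- (((\<chi> i. sqrt (4 * (s + 1) * l $ i)) * c) \<bullet> ((\<chi> i. sqrt (4 * (s + 1) * l $ i)) * c)) / (4 * (s + 1)) = (\<Sum>i\<in>UNIV. - (l $ i * (c $ i)\<^sup>2))"
    for c :: "real ^ 'k"
  proof -
    have p: "4 * (s + 1) > 0" using s by simp
    have "(sqrt (4 * (s + 1) * l $ i) * c $ i) * (sqrt (4 * (s + 1) * l $ i) * c $ i) = (4 * (s + 1)) * (l $ i * (c $ i)\<^sup>2)" for i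
    proof -
      have "0 \<le> 4 * (s + 1) * l $ i" using p l[of i] by simp
      then have "sqrt (4 * (s + 1) * l $ i) * sqrt (4 * (s + 1) * l $ i) = 4 * (s + 1) * l $ i" by (rule real_sqrt_mult_self[THEN trans, OF abs_of_nonneg])
      then show ?thesis by (simp only: power2_eq_square mult_ac)
    qed
    then have "((\<chi> i. sqrt (4 * (s + 1) * l $ i)) * c) \<bullet> ((\<chi> i. sqrt (4 * (s + 1) * l $ i)) * c) = (4 * (s + 1)) * (\<Sum>i\<in>UNIV. l $ i * (c $ i)\<^sup>2)"
      by (simp only: inner_vec_def vector_mult_component vec_lambda_beta inner_real_def sum_distrib_left)
    then show ?thesis using p by (simp add: sum_negf)
  qed
  then show ?thesis unfolding laplace_kernel_def integral_rayleigh_cos_F_map[OF G] by (simp only: exp_sum finite)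
qed

end

section \<open>Polynomials on the cube as integrals against the image law\<close>

text \<open>Integration respects sums but not products, so polynomials have to be presented as sums
  of monomials; each monomial is then matched by one Laplace kernel.\<close>

inductive monomial_sum :: "(real ^ 'k \<Rightarrow> real) \<Rightarrow> bool" where
  monomial: "monomial_sum (\<lambda>z. a * (\<Prod>i\<in>UNIV. (z $ i) ^ m i))"
| sum: "monomial_sum f \<Longrightarrow> monomial_sum g \<Longrightarrow> monomial_sum (\<lambda>z. f z + g z)"

lemma monomial_sum_mult_monomial:
  "monomial_sum (f :: real ^ 'k \<Rightarrow> real) \<Longrightarrow> monomial_sum (\<lambda>z. f z * (a * (\<Prod>i\<in>UNIV. (z $ i) ^ m i)))"
proof (induction rule: monomial_sum.induct)
  case (monomial b n)
  have "(\<lambda>z::real ^ 'k. b * (\<Prod>i\<in>UNIV. (z $ i) ^ n i) * (a * (\<Prod>i\<in>UNIV. (z $ i) ^ m i))) =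
      (\<lambda>z. (b * a) * (\<Prod>i\<in>UNIV. (z $ i) ^ (n i + m i)))"
    by (simp add: power_add prod.distrib mult_ac)
  then show ?case by (simp only: monomial_sum.monomial)
next
  case (sum f g) then show ?case by (simp add: distrib_right monomial_sum.sum)
qed

lemma monomial_sum_mult: "monomial_sum g \<Longrightarrow> monomial_sum f \<Longrightarrow> monomial_sum (\<lambda>z. f z * g z)"
proof (induction rule: monomial_sum.induct)
  case (monomial a m) then show ?case by (rule monomial_sum_mult_monomial)
next
  case (sum f g) then show ?case by (simp add: distrib_left monomial_sum.sum)
qed

lemma monomial_sum_const: "monomial_sum (\<lambda>z. c)"
  using monomial_sum.monomial[of c "\<lambda>_. 0"] by simp

lemma monomial_sum_sum:
  assumes "finite I" "\<And>i. i \<in> I \<Longrightarrow> monomial_sum (f i)" shows "monomial_sum (\<lambda>z. \<Sum>i\<in>I. f i z)"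
  using assms by (induction rule: finite_induct) (auto intro: monomial_sum_const monomial_sum.sum)

lemma monomial_sum_nth: "monomial_sum (\<lambda>z::real ^ 'k. c * z $ j)"
proof -
  have "(\<Prod>i\<in>UNIV. (z $ i) ^ (if i = j then 1 else 0)) = z $ j" for z :: "real ^ 'k"
  proof -
    have "(\<Prod>i\<in>UNIV. (z $ i) ^ (if i = j then 1 else 0)) = (\<Prod>i\<in>UNIV. if i = j then z $ i else 1)"
      by (intro prod.cong) auto
    then show ?thesis by simp
  qed
  then show ?thesis using monomial_sum.monomial[of c "\<lambda>i. if i = j then 1 else 0"] by simp
qed

lemma real_polynomial_function_monomial_sum:
  "real_polynomial_function f \<Longrightarrow> monomial_sum (f :: real ^ 'k \<Rightarrow> real)"
proof (induction rule: real_polynomial_function.induct)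
  case (linear f)
  interpret bounded_linear f by fact
  have "f z = (\<Sum>j\<in>UNIV. f (axis j 1) * z $ j)" for z
  proof -
    have "f z = f (\<Sum>j\<in>UNIV. z $ j *\<^sub>R axis j 1)"
      by (rule arg_cong[where f = f]) (simp add: vec_eq_iff axis_def if_distrib[of "\<lambda>x. _ * x"] cong: if_cong)
    then show ?thesis by (simp add: sum scaleR mult.commute)
  qed
  then have "f = (\<lambda>z. \<Sum>j\<in>UNIV. f (axis j 1) * z $ j)" by (rule ext)
  then show ?case using monomial_sum_sum[of UNIV "\<lambda>j z. f (axis j 1) * z $ j"] monomial_sum_nth by (metis finite)
qed (auto intro: monomial_sum_const monomial_sum.sum monomial_sum_mult)

definition exp_coords :: "real ^ 'k \<Rightarrow> real ^ 'k" where
  "exp_coords x = (\<chi> i. exp (- (x $ i)\<^sup>2))"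

lemma exp_coords_unit: "exp_coords x $ i \<in> {0<..1}"
  by (simp add: exp_coords_def)

lemma measurable_exp_coords: "exp_coords \<in> borel_measurable borel"
  unfolding exp_coords_def by (rule borel_measurable_continuous_onI) (intro continuous_intros)

lemma exp_coords_cube: "exp_coords c \<in> unit_cube"
  using exp_coords_unit[of c] by (auto simp: unit_cube_def less_imp_le)

lemma monomial_sum_continuous: "monomial_sum p \<Longrightarrow> continuous_on UNIV p"
  by (induction rule: monomial_sum.induct) (auto intro!: continuous_intros)

context kingman begin

lemma integrable_exp_coords:
  fixes g :: "real ^ 'k \<Rightarrow> real"
  assumes G: "G \<in> prob_measures orthant" and g: "continuous_on UNIV g"
  shows "integrable G (\<lambda>c. g (exp_coords c))"
proof -
  note G' = prob_measures_orthantD[OF G]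
  interpret prob_space G by fact
  obtain B where "\<And>x. x \<in> unit_cube \<Longrightarrow> \<bar>g x\<bar> \<le> B" using bounded_on_unit_cube[OF g] by blast
  moreover have "(\<lambda>c. g (exp_coords c)) \<in> borel_measurable G"
    unfolding measurable_cong_sets[OF G'(2) refl]
    by (rule measurable_restrict_space1, rule measurable_compose[OF measurable_exp_coords borel_measurable_continuous_onI[OF g]])
  ultimately show ?thesis by (intro integrable_bounded[where B = B]) (simp_all add: exp_coords_cube)
qed

text \<open>In the coordinates exp(- c_i^2) a monomial with exponents \<open>m i\<close> is the
  Laplace integrand at \<open>l $ i = m i\<close>. \<open>H\<close> is chosen before G, so one test
  function serves all laws.\<close>

lemma monomial_sum_integral:
  assumes "monomial_sum p"
  shows "\<exists>H :: real ^ 'k \<Rightarrow> real. continuous_on UNIV H \<and> bounded (range H) \<and>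
    (\<forall>G \<in> prob_measures orthant. (\<integral>c. p (exp_coords c) \<partial>G) = (\<integral>y. H y \<partial>F_map s G))"
  using assms
proof (induction rule: monomial_sum.induct)
  case (monomial a m)
  let ?l = "\<chi> i. real (m i) :: real ^ 'k"
  have "(\<integral>c. a * (\<Prod>i\<in>UNIV. (exp_coords c $ i) ^ m i) \<partial>G) = (\<integral>y. a * laplace_kernel ?l y \<partial>F_map s G)"
    if "G \<in> prob_measures orthant" for G
    using integral_laplace_kernel[OF that, of ?l] by (simp add: exp_coords_def flip: exp_of_nat_mult)
  moreover have "continuous_on UNIV (\<lambda>y. a * laplace_kernel ?l y)"
    by (intro continuous_intros continuous_laplace_kernel)
  moreover have "bounded (range (\<lambda>y. a * laplace_kernel ?l y))"
    using abs_laplace_kernel_le[of ?l] by (auto simp: bounded_iff abs_mult intro!: exI[of _ "\<bar>a\<bar>"] mult_left_le)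
  ultimately show ?case by (intro exI[of _ "\<lambda>y. a * laplace_kernel ?l y"] conjI ballI)
next
  case (sum f g)
  then obtain H K :: "real ^ 'k \<Rightarrow> real" where H: "continuous_on UNIV H" "bounded (range H)"
      "\<And>G. G \<in> prob_measures orthant \<Longrightarrow> (\<integral>c. f (exp_coords c) \<partial>G) = (\<integral>y. H y \<partial>F_map s G)"
    and K: "continuous_on UNIV K" "bounded (range K)"
      "\<And>G. G \<in> prob_measures orthant \<Longrightarrow> (\<integral>c. g (exp_coords c) \<partial>G) = (\<integral>y. K y \<partial>F_map s G)"
    by blast
  have i: "integrable (F_map s G) L" if G: "G \<in> prob_measures orthant" and L: "continuous_on UNIV L" "bounded (range L)"
    for G and L :: "real ^ 'k \<Rightarrow> real"
  proof -
    note F = prob_measures_UNIVD[OF F_map_prob_measures[OF G]]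
    interpret prob_space "F_map s G" by (rule F)
    obtain B where "\<And>x. norm (L x) \<le> B" using L(2) by (auto simp: bounded_iff)
    then show ?thesis
      by (intro integrable_bounded[where B = B]) (auto simp: measurable_cong_sets[OF F(2) refl] borel_measurable_continuous_onI[OF L(1)])
  qed
  show ?case
  proof (intro exI[of _ "\<lambda>y. H y + K y"] conjI ballI)
    show "continuous_on UNIV (\<lambda>y. H y + K y)" using H(1) K(1) by (rule continuous_on_add)
    show "bounded (range (\<lambda>y. H y + K y))" using H(2) K(2) by (rule bounded_plus_comp)
    fix G :: "(real ^ 'k) measure" assume G: "G \<in> prob_measures orthant"
    show "(\<integral>c. f (exp_coords c) + g (exp_coords c) \<partial>G) = (\<integral>y. H y + K y \<partial>F_map s G)"
      using integrable_exp_coords[OF G monomial_sum_continuous[OF sum.hyps(1)]]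
        integrable_exp_coords[OF G monomial_sum_continuous[OF sum.hyps(2)]] i[OF G H(1,2)] i[OF G K(1,2)] H(3)[OF G] K(3)[OF G] by simp
  qed
qed

end


section \<open>Approximation of integrals by integrals against the image law\<close>

text \<open>The inverse of \<open>exp_coords\<close> on (0,1]^k. The absolute value makes it a total
  map into the orthant, so that it can be applied to laws on all of R^k.\<close>

definition log_coords :: "real ^ 'k \<Rightarrow> real ^ 'k" where
  "log_coords z = (\<chi> i. sqrt \<bar>ln (z $ i)\<bar>)"

lemma log_coords_exp_coords: "c \<in> orthant \<Longrightarrow> log_coords (exp_coords c) = c"
  by (simp add: log_coords_def exp_coords_def orthant_def vec_eq_iff)

lemma log_coords_orthant: "log_coords z \<in> orthant"
  by (simp add: log_coords_def orthant_def)

definition cutoff :: "real \<Rightarrow> 'a::real_normed_vector \<Rightarrow> real" where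
  "cutoff R x = max 0 (min 1 (R + 1 - norm x))"

lemma cutoff_bounds: "0 \<le> cutoff R x" "cutoff R x \<le> 1"
  by (simp_all add: cutoff_def)

lemma continuous_cutoff: "continuous_on A (cutoff R)"
  unfolding cutoff_def by (intro continuous_intros)

text \<open>In the coordinates exp(- c_i^2) the function f may have no limit at the faces z_i = 0.
  The cutoff vanishes once the norm reaches R + 1, thus near these faces, and the extension by 0 is
  continuous.\<close>

lemma cutoff_extension:
  fixes f :: "real ^ 'k \<Rightarrow> real"
  assumes f: "continuous_on orthant f" and R: "R \<ge> 0"
  obtains g where "continuous_on UNIV g" "\<And>c. c \<in> orthant \<Longrightarrow> g (exp_coords c) = f c * cutoff R c"
proof -
  define P :: "(real ^ 'k) set" where "P = {z. \<forall>i. z $ i > 0}"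
  \<comment> \<open>The threshold is exp(- c^2) at c = R + 1: a point of \<open>P \<inter> T\<close>
    has a log coordinate above R + 1, where the cutoff is 0. The open sets \<open>P\<close> and
    \<open>T\<close> cover the space, and \<open>g\<close> is continuous on each.\<close>
  define T :: "(real ^ 'k) set" where "T = {z. \<exists>i. z $ i < exp (- (R + 1)\<^sup>2)}"
  define g where "g z = (if z \<in> P then f (log_coords z) * cutoff R (log_coords z) else 0)" for z
  have "P = (\<Inter>i. {z. 0 < z $ i})" "T = (\<Union>i. {z. z $ i < exp (- (R + 1)\<^sup>2)})" by (auto simp: P_def T_def)
  then have op: "open P" "open T"
    by (auto intro!: open_INT open_UN open_Collect_less continuous_intros)
  have PT: "P \<union> T = UNIV"
    by (auto simp: P_def T_def not_less) (metis exp_gt_zero le_less_trans not_less)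
  have zero: "g z = 0" if "z \<in> T" for z
  proof (cases "z \<in> P")
    case True
    from that obtain i where i: "z $ i < exp (- (R + 1)\<^sup>2)" by (auto simp: T_def)
    have zi: "z $ i > 0" using True by (simp add: P_def)
    then have "ln (z $ i) < - (R + 1)\<^sup>2" using i by (metis ln_exp ln_less_cancel_iff exp_gt_zero)
    moreover have "0 \<le> (R + 1)\<^sup>2" by simp
    ultimately have "(R + 1)\<^sup>2 < \<bar>ln (z $ i)\<bar>" by linarith
    then have "R + 1 < log_coords z $ i" unfolding log_coords_def by (simp add: real_less_rsqrt)
    also have "\<dots> \<le> norm (log_coords z)" using component_le_norm_cart[of "log_coords z" i] by simp
    finally have "cutoff R (log_coords z) = 0" by (simp add: cutoff_def)
    then show ?thesis by (simp add: g_def)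
  qed (simp add: g_def)
  have "continuous_on P (\<lambda>z. f (log_coords z) * cutoff R (log_coords z))"
  proof -
    have l: "continuous_on P log_coords"
      unfolding log_coords_def by (intro continuous_on_vec_lambda continuous_intros) (auto simp: P_def, metis less_irrefl)
    show ?thesis
      by (intro continuous_on_mult continuous_on_compose2[OF f l] continuous_on_compose2[OF continuous_cutoff[of UNIV] l]) (auto simp: log_coords_orthant)
  qed
  then have "continuous_on P g" by (rule continuous_on_eq) (simp add: g_def)
  moreover have "continuous_on T g" by (rule continuous_on_eq[OF continuous_on_const[of _ 0]]) (simp add: zero)
  ultimately have "continuous_on UNIV g" using continuous_on_open_Un[OF op] PT by simp
  moreover have "g (exp_coords c) = f c * cutoff R c" if "c \<in> orthant" for c
    using exp_coords_unit[of c] that by (simp add: g_def P_def log_coords_exp_coords)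
  ultimately show thesis using that by blast
qed

context kingman begin

lemma integrable_orthant:
  fixes f :: "real ^ 'k \<Rightarrow> real"
  assumes G: "G \<in> prob_measures orthant" and f: "continuous_on orthant f" and B: "\<And>x. x \<in> orthant \<Longrightarrow> \<bar>f x\<bar> \<le> B"
  shows "integrable G f"
proof -
  note G' = prob_measures_orthantD[OF G]
  interpret prob_space G by fact
  show ?thesis
    by (rule integrable_const_bound[of _ B])
       (use B in \<open>auto simp: G'(3) measurable_cong_sets[OF G'(2) refl] borel_measurable_continuous_on_restrict[OF f]\<close>)
qed

text \<open>Stone-Weierstrass gives a polynomial uniformly close to g on the cube, and total mass 1
  keeps the error of the integrals below e for all G simultaneously.\<close>

lemma approximate_by_F_map_integral:
  fixes g :: "real ^ 'k \<Rightarrow> real"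
  assumes g: "continuous_on UNIV g" and e: "e > 0"
  obtains H :: "real ^ 'k \<Rightarrow> real" where "continuous_on UNIV H" "bounded (range H)"
    "\<And>G. G \<in> prob_measures orthant \<Longrightarrow> \<bar>(\<integral>c. g (exp_coords c) \<partial>G) - (\<integral>y. H y \<partial>F_map s G)\<bar> \<le> e"
proof -
  have "compact (unit_cube :: (real ^ 'k) set)" by (simp add: unit_cube_eq_cbox)
  then obtain p where p: "real_polynomial_function p" "\<And>z. z \<in> unit_cube \<Longrightarrow> \<bar>g z - p z\<bar> < e"
    using Stone_Weierstrass_real_polynomial_function[OF _ continuous_on_subset[OF g] e, of unit_cube] by auto
  have m: "monomial_sum p" using p(1) by (rule real_polynomial_function_monomial_sum)
  obtain H :: "real ^ 'k \<Rightarrow> real" where H: "continuous_on UNIV H" "bounded (range H)"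
      "\<And>G. G \<in> prob_measures orthant \<Longrightarrow> (\<integral>c. p (exp_coords c) \<partial>G) = (\<integral>y. H y \<partial>F_map s G)"
    using monomial_sum_integral[OF m] by blast
  have "\<bar>(\<integral>c. g (exp_coords c) \<partial>G) - (\<integral>y. H y \<partial>F_map s G)\<bar> \<le> e" if G: "G \<in> prob_measures orthant" for G
  proof -
    note G' = prob_measures_orthantD[OF G]
    interpret prob_space G by fact
    have ip: "integrable G (\<lambda>c. p (exp_coords c))" and ig: "integrable G (\<lambda>c. g (exp_coords c))"
      using G m g by (auto intro: integrable_exp_coords monomial_sum_continuous)
    have "\<bar>(\<integral>c. g (exp_coords c) \<partial>G) - (\<integral>c. p (exp_coords c) \<partial>G)\<bar> = \<bar>\<integral>c. g (exp_coords c) - p (exp_coords c) \<partial>G\<bar>"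
      using ip ig by simp
    also have "\<dots> \<le> (\<integral>c. \<bar>g (exp_coords c) - p (exp_coords c)\<bar> \<partial>G)" by (rule integral_abs_bound)
    also have "\<dots> \<le> (\<integral>c. e \<partial>G)"
      using p(2)[OF exp_coords_cube] ip ig by (intro integral_mono) (auto intro: less_imp_le)
    also have "\<dots> = e" by (simp add: prob_space)
    finally show ?thesis unfolding H(3)[OF G] .
  qed
  with H(1,2) show thesis using that by blast
qed

text \<open>The second closeness condition is a tightness statement: almost all mass of
  \<open>G0\<close> lies in a large ball, hence so does almost all mass of each G that is close on
  the cutoff, and the tails of the bounded function f are negligible.\<close>

lemma cutoff_controls_integral:
  fixes f :: "real ^ 'k \<Rightarrow> real"
  assumes G0: "G0 \<in> prob_measures orthant" and f: "continuous_on orthant f" and B: "bounded (f ` orthant)" and e: "e > 0"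
  obtains R d where "R \<ge> 0" "d > 0"
    "\<And>G. G \<in> prob_measures orthant \<Longrightarrow> \<bar>(\<integral>c. f c * cutoff R c \<partial>G) - (\<integral>c. f c * cutoff R c \<partial>G0)\<bar> < d \<Longrightarrow>
       \<bar>(\<integral>c. cutoff R c \<partial>G) - (\<integral>c. cutoff R c \<partial>G0)\<bar> < d \<Longrightarrow> \<bar>(\<integral>c. f c \<partial>G) - (\<integral>c. f c \<partial>G0)\<bar> < e"
proof -
  obtain B where B: "\<And>x. x \<in> orthant \<Longrightarrow> \<bar>f x\<bar> \<le> B" using B by (auto simp: bounded_iff)
  have "0 \<in> (orthant :: (real ^ 'k) set)" by (simp add: orthant_def)
  with B have B0: "B \<ge> 0" by force
  \<comment> \<open>The errors add up to d + 2 B d + B d, from the cutoff part, the tail of G and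
    the tail of \<open>G0\<close>. The summand 1 keeps the denominator positive when B = 0.\<close>
  define d where "d = e / (4 * (B + 1))"
  have d: "d > 0" using e B0 by (simp add: d_def)
  note G0' = prob_measures_orthantD[OF G0]
  have ic: "integrable G (cutoff R)" if "G \<in> prob_measures orthant" for G :: "(real ^ 'k) measure" and R
    using that by (rule integrable_orthant[where B = 1]) (auto simp: continuous_cutoff cutoff_bounds)
  have i_f: "integrable G f" if "G \<in> prob_measures orthant" for G
    using that f B by (rule integrable_orthant)
  have ifc: "integrable G (\<lambda>c. f c * cutoff R c)" if "G \<in> prob_measures orthant" for G and R
    using that by (rule integrable_orthant[where B = B])
      (auto simp: abs_mult cutoff_bounds intro!: continuous_on_mult f continuous_cutoff order_trans[OF mult_left_le B])
  have lim: "(\<lambda>n. \<integral>c. cutoff (real n) c \<partial>G0) \<longlonglongrightarrow> (\<integral>c. 1 \<partial>G0)"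
  proof (rule integral_dominated_convergence[where w = "\<lambda>_. 1"])
    interpret prob_space G0 by fact
    show "integrable G0 (\<lambda>_. 1 :: real)" by simp
    show "cutoff (real n) \<in> borel_measurable G0" for n using ic[OF G0] by blast
    have "(\<lambda>n. cutoff (real n) c) \<longlonglongrightarrow> 1" for c :: "real ^ 'k"
    proof (rule tendsto_eventually)
      have "cutoff (real n) c = 1" if "n \<ge> nat \<lceil>norm c\<rceil>" for n
        using that by (simp add: cutoff_def nat_ceiling_le_eq)
      then show "\<forall>\<^sub>F n in sequentially. cutoff (real n) c = 1" by (rule eventually_sequentiallyI)
    qed
    then show "AE c in G0. (\<lambda>n. cutoff (real n) c) \<longlonglongrightarrow> 1" by simp
  qed (auto simp: cutoff_bounds)
  have one: "(\<integral>c. 1 \<partial>G) = (1::real)" if "G \<in> prob_measures orthant" for G :: "(real ^ 'k) measure"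
    using prob_space.prob_space[OF prob_measures_orthantD(1)[OF that]] by simp
  have "\<forall>\<^sub>F n in sequentially. 1 - d < (\<integral>c. cutoff (real n) c \<partial>G0)"
    by (rule order_tendstoD(1)[OF lim]) (use d one[OF G0] in simp)
  \<comment> \<open>The cutoff integral of \<open>G0\<close> falls short of 1 by less than d, so
    that of a law G within d of it falls short by less than 2 d.\<close>
  then obtain n where n: "1 - d < (\<integral>c. cutoff (real n) c \<partial>G0)" by (auto simp: eventually_sequentially)
  have tail: "\<bar>(\<integral>c. f c \<partial>G) - (\<integral>c. f c * cutoff R c \<partial>G)\<bar> \<le> B * (1 - (\<integral>c. cutoff R c \<partial>G))"
    if G: "G \<in> prob_measures orthant" for G and R
  proof -
    interpret prob_space G by (rule prob_measures_orthantD[OF G])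
    have "\<bar>(\<integral>c. f c \<partial>G) - (\<integral>c. f c * cutoff R c \<partial>G)\<bar> = \<bar>\<integral>c. f c - f c * cutoff R c \<partial>G\<bar>"
      using i_f[OF G] ifc[OF G] by simp
    also have "\<dots> \<le> (\<integral>c. \<bar>f c - f c * cutoff R c\<bar> \<partial>G)" by (rule integral_abs_bound)
    also have "\<dots> \<le> (\<integral>c. B * (1 - cutoff R c) \<partial>G)"
    proof (rule integral_mono)
      fix c assume "c \<in> space G"
      then have c: "c \<in> orthant" by (simp add: prob_measures_orthantD[OF G])
      have "f c - f c * cutoff R c = f c * (1 - cutoff R c)" by (simp add: right_diff_distrib)
      then have "\<bar>f c - f c * cutoff R c\<bar> = \<bar>f c\<bar> * (1 - cutoff R c)"
        using cutoff_bounds[of R c] by (simp only: abs_mult abs_of_nonneg diff_ge_0_iff_ge)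
      also have "\<dots> \<le> B * (1 - cutoff R c)" using cutoff_bounds[of R c] by (intro mult_right_mono B c) auto
      finally show "\<bar>f c - f c * cutoff R c\<bar> \<le> B * (1 - cutoff R c)" .
    qed (use i_f[OF G] ifc[OF G] ic[OF G] in auto)
    also have "\<dots> = B * (1 - (\<integral>c. cutoff R c \<partial>G))" using ic[OF G] one[OF G] by simp
    finally show ?thesis .
  qed
  show thesis
  proof (rule that[of "real n" d])
    fix G :: "(real ^ 'k) measure" assume G: "G \<in> prob_measures orthant"
      and 1: "\<bar>(\<integral>c. f c * cutoff (real n) c \<partial>G) - (\<integral>c. f c * cutoff (real n) c \<partial>G0)\<bar> < d"
      and 2: "\<bar>(\<integral>c. cutoff (real n) c \<partial>G) - (\<integral>c. cutoff (real n) c \<partial>G0)\<bar> < d"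
    have "B * (1 - (\<integral>c. cutoff (real n) c \<partial>G)) \<le> B * (2 * d)" "B * (1 - (\<integral>c. cutoff (real n) c \<partial>G0)) \<le> B * d"
      using n 2 B0 by (auto intro!: mult_left_mono)
    then have "\<bar>(\<integral>c. f c \<partial>G) - (\<integral>c. f c \<partial>G0)\<bar> < d + B * (2 * d) + B * d"
      using tail[OF G, of "real n"] tail[OF G0, of "real n"] 1 by linarith
    also have "\<dots> = d * (1 + 3 * B)" by (simp add: algebra_simps)
    also have "\<dots> \<le> d * (4 * (B + 1))" using B0 d by (intro mult_left_mono) auto
    also have "\<dots> = e" using B0 by (simp add: d_def)
    finally show "\<bar>(\<integral>c. f c \<partial>G) - (\<integral>c. f c \<partial>G0)\<bar> < e" .
  qed (use d in simp_all)
qed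

text \<open>Two test functions on the image side suffice for each f: one for f times the cutoff, one
  for the cutoff itself. This is continuity of the inverse at \<open>F_map s G0\<close>, and it
  yields injectivity too.\<close>

lemma F_map_controls_integral:
  fixes f :: "real ^ 'k \<Rightarrow> real"
  assumes G0: "G0 \<in> prob_measures orthant" and f: "continuous_on orthant f" and B: "bounded (f ` orthant)" and e: "e > 0"
  obtains H K :: "real ^ 'k \<Rightarrow> real" and d where "d > 0" "continuous_on UNIV H" "bounded (range H)" "continuous_on UNIV K" "bounded (range K)"
    "\<And>G. G \<in> prob_measures orthant \<Longrightarrow> \<bar>(\<integral>y. H y \<partial>F_map s G) - (\<integral>y. H y \<partial>F_map s G0)\<bar> < d \<Longrightarrow>
       \<bar>(\<integral>y. K y \<partial>F_map s G) - (\<integral>y. K y \<partial>F_map s G0)\<bar> < d \<Longrightarrow> \<bar>(\<integral>c. f c \<partial>G) - (\<integral>c. f c \<partial>G0)\<bar> < e"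
proof -
  from cutoff_controls_integral[OF assms] obtain R d where R: "R \<ge> 0" and d: "d > 0" and
    c: "\<And>G. G \<in> prob_measures orthant \<Longrightarrow> \<bar>(\<integral>c. f c * cutoff R c \<partial>G) - (\<integral>c. f c * cutoff R c \<partial>G0)\<bar> < d \<Longrightarrow>
       \<bar>(\<integral>c. cutoff R c \<partial>G) - (\<integral>c. cutoff R c \<partial>G0)\<bar> < d \<Longrightarrow> \<bar>(\<integral>c. f c \<partial>G) - (\<integral>c. f c \<partial>G0)\<bar> < e"
    by blast
  obtain g where g: "continuous_on UNIV g" "\<And>c. c \<in> orthant \<Longrightarrow> g (exp_coords c) = f c * cutoff R c"
    using cutoff_extension[OF f R] by blast
  obtain h :: "real ^ 'k \<Rightarrow> real" where h: "continuous_on UNIV h" "\<And>c. c \<in> orthant \<Longrightarrow> h (exp_coords c) = 1 * cutoff R c"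
    using cutoff_extension[OF continuous_on_const[of "orthant :: (real ^ 'k) set" "1::real"] R] by blast
  \<comment> \<open>One third each for the approximation at G, the approximation at
    \<open>G0\<close> and the closeness of the images.\<close>
  have d3: "d / 3 > 0" using d by simp
  obtain H where H: "continuous_on UNIV H" "bounded (range H)"
    "\<And>G. G \<in> prob_measures orthant \<Longrightarrow> \<bar>(\<integral>c. g (exp_coords c) \<partial>G) - (\<integral>y. H y \<partial>F_map s G)\<bar> \<le> d / 3"
    using approximate_by_F_map_integral[OF g(1) d3] by blast
  obtain K where K: "continuous_on UNIV K" "bounded (range K)"
    "\<And>G. G \<in> prob_measures orthant \<Longrightarrow> \<bar>(\<integral>c. h (exp_coords c) \<partial>G) - (\<integral>y. K y \<partial>F_map s G)\<bar> \<le> d / 3"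
    using approximate_by_F_map_integral[OF h(1) d3] by blast
  have eq: "(\<integral>c. g (exp_coords c) \<partial>G) = (\<integral>c. f c * cutoff R c \<partial>G)" "(\<integral>c. h (exp_coords c) \<partial>G) = (\<integral>c. cutoff R c \<partial>G)"
    if "G \<in> prob_measures orthant" for G
    by (intro Bochner_Integration.integral_cong refl; simp add: g h prob_measures_orthantD[OF that])+
  show thesis
  proof (rule that[of "d / 3" H K])
    fix G :: "(real ^ 'k) measure" assume G: "G \<in> prob_measures orthant"
      and 1: "\<bar>(\<integral>y. H y \<partial>F_map s G) - (\<integral>y. H y \<partial>F_map s G0)\<bar> < d / 3" and 2: "\<bar>(\<integral>y. K y \<partial>F_map s G) - (\<integral>y. K y \<partial>F_map s G0)\<bar> < d / 3"
    show "\<bar>(\<integral>c. f c \<partial>G) - (\<integral>c. f c \<partial>G0)\<bar> < e"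
    proof (rule c[OF G])
      show "\<bar>(\<integral>c. f c * cutoff R c \<partial>G) - (\<integral>c. f c * cutoff R c \<partial>G0)\<bar> < d"
        using 1 H(3)[OF G] H(3)[OF G0] unfolding eq[OF G] eq[OF G0] by linarith
      show "\<bar>(\<integral>c. cutoff R c \<partial>G) - (\<integral>c. cutoff R c \<partial>G0)\<bar> < d"
        using 2 K(3)[OF G] K(3)[OF G0] unfolding eq[OF G] eq[OF G0] by linarith
    qed
  qed (use d3 H K in auto)
qed

section \<open>Injectivity of the map\<close>

text \<open>Viewed on R^k both laws have the same cosine and sine integrals, hence the same
  characteristic function. The orthant is closed, so its Borel subsets are Borel in R^k and nothing
  is lost by passing there.\<close>

lemma prob_measures_orthant_eqI:
  fixes G G' :: "(real ^ 'k) measure"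
  assumes G: "G \<in> prob_measures orthant" and G': "G' \<in> prob_measures orthant"
    and eq: "\<And>f :: real ^ 'k \<Rightarrow> real. continuous_on orthant f \<Longrightarrow> bounded (f ` orthant) \<Longrightarrow> (\<integral>c. f c \<partial>G) = (\<integral>c. f c \<partial>G')"
  shows "G = G'"
proof -
  let ?D = "\<lambda>G. distr G borel (\<lambda>x::real ^ 'k. x)"
  have id: "(\<lambda>x. x) \<in> borel_measurable G" if "G \<in> prob_measures orthant" for G :: "(real ^ 'k) measure"
    by (simp add: measurable_cong_sets[OF prob_measures_orthantD(2)[OF that] refl] measurable_restrict_space1)
  have D: "?D G \<in> prob_measures UNIV" if "G \<in> prob_measures orthant" for G
    using that id[OF that] by (auto simp: prob_measures_def borel_on_UNIV intro!: prob_space.prob_space_distr)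
  have c: "char_fun (?D G) t = Complex (\<integral>x. cos (t \<bullet> x) \<partial>G) (\<integral>x. sin (t \<bullet> x) \<partial>G)"
    if G: "G \<in> prob_measures orthant" for G t
    unfolding char_fun_cos_sin[OF D[OF G]] by (subst (1 2) integral_distr[OF id[OF G]]) auto
  have "?D G = ?D G'"
  proof (rule char_fun_unique')
    show "?D G \<in> prob_measures UNIV" "?D G' \<in> prob_measures UNIV" by (rule D[OF G], rule D[OF G'])
    show "char_fun (?D G) t = char_fun (?D G') t" for t
      unfolding c[OF G] c[OF G']
      by (intro arg_cong2[where f = Complex] eq continuous_intros) (auto simp: bounded_iff intro!: exI[of _ 1])
  qed
  moreover have "emeasure (?D K) A = emeasure K A" if "K \<in> prob_measures orthant" "A \<in> sets (borel_on orthant)" for K A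
  proof -
    have o: "(orthant :: (real ^ 'k) set) = (\<Inter>i. {x. 0 \<le> x $ i})" by (auto simp: orthant_def)
    have "closed (orthant :: (real ^ 'k) set)" unfolding o by (intro closed_INT ballI closed_Collect_le continuous_intros)
    then have A: "A \<in> sets borel" "A \<subseteq> orthant" using that(2) by (auto simp: sets_restrict_space_iff)
    then show ?thesis
      by (subst emeasure_distr[OF id[OF that(1)]]) (auto simp: prob_measures_orthantD[OF that(1)] Int_absorb2)
  qed
  ultimately show ?thesis
    using prob_measures_orthantD(2)[OF G] prob_measures_orthantD(2)[OF G'] by (intro measure_eqI) (auto, metis assms(1,2))
qed

text \<open>If the images coincide, the closeness conditions of the previous estimate hold trivially
  for every e.\<close>

lemma inj_on_F_map: "inj_on (F_map s) (prob_measures orthant :: (real ^ 'k) measure set)"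
proof (rule inj_onI)
  fix G G' :: "(real ^ 'k) measure"
  assume G: "G \<in> prob_measures orthant" and G': "G' \<in> prob_measures orthant" and eq: "F_map s G = F_map s G'"
  show "G = G'"
  proof (rule prob_measures_orthant_eqI[OF G G'])
    fix f :: "real ^ 'k \<Rightarrow> real" assume f: "continuous_on orthant f" "bounded (f ` orthant)"
    have "\<bar>(\<integral>c. f c \<partial>G) - (\<integral>c. f c \<partial>G')\<bar> < e" if "e > 0" for e
      by (rule F_map_controls_integral[OF G' f that]) (simp add: G eq)
    then have "\<not> 0 < \<bar>(\<integral>c. f c \<partial>G) - (\<integral>c. f c \<partial>G')\<bar>" by blast
    then show "(\<integral>c. f c \<partial>G) = (\<integral>c. f c \<partial>G')" by simp
  qed
qed

end


section \<open>The weak topology\<close>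

abbreviation weak_subbase :: "'a::topological_space set \<Rightarrow> 'a measure set set" where
  "weak_subbase E \<equiv> {{M \<in> prob_measures E. (\<integral>x. f x \<partial>M) \<in> U} | (f :: 'a \<Rightarrow> real) U.
        continuous_on E f \<and> bounded (f ` E) \<and> open U}"

lemma topspace_weak_topology [simp]: "topspace (weak_topology E) = prob_measures E"
proof -
  \<comment> \<open>The zero function exhibits the whole set as a member of the subbase.\<close>
  have "{M \<in> prob_measures E. (\<integral>x. 0 \<partial>M) \<in> UNIV} \<in> weak_subbase E"
    by (intro CollectI exI[of _ "\<lambda>_. 0"] exI[of _ UNIV]) (auto simp: bounded_iff)
  from Union_upper[OF this]
  have "prob_measures E \<subseteq> \<Union> (weak_subbase E)" by simp
  then show ?thesis unfolding weak_topology_def topology_generated_by_topspace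
    by (intro equalityI) auto
qed

lemma openin_weak_topology:
  fixes f :: "'a::topological_space \<Rightarrow> real"
  assumes "continuous_on E f" "bounded (f ` E)" "open U"
  shows "openin (weak_topology E) {M \<in> prob_measures E. (\<integral>x. f x \<partial>M) \<in> U}"
  unfolding weak_topology_def by (rule topology_generated_by_Basis) (use assms in blast)

lemma continuous_map_weak_topologyI:
  assumes "\<And>x. x \<in> topspace X \<Longrightarrow> F x \<in> prob_measures E"
    and "\<And>(f :: 'a::topological_space \<Rightarrow> real) U. continuous_on E f \<Longrightarrow> bounded (f ` E) \<Longrightarrow> open U \<Longrightarrow>
           openin X {x \<in> topspace X. (\<integral>y. f y \<partial>F x) \<in> U}"
  shows "continuous_map X (weak_topology E) F"
  unfolding weak_topology_def
proof (rule continuous_on_generated_topo)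
  fix W assume "W \<in> weak_subbase E"
  then obtain f :: "'a \<Rightarrow> real" and U where W: "W = {M \<in> prob_measures E. (\<integral>x. f x \<partial>M) \<in> U}"
    and f: "continuous_on E f" "bounded (f ` E)" "open U" by blast
  have "F -` W \<inter> topspace X = {x \<in> topspace X. (\<integral>y. f y \<partial>F x) \<in> U}" using assms(1) by (auto simp: W)
  then show "openin X (F -` W \<inter> topspace X)" using assms(2)[OF f] by simp
next
  show "F ` topspace X \<subseteq> \<Union> (weak_subbase E)"
    unfolding topspace_weak_topology[of E, unfolded weak_topology_def topology_generated_by_topspace]
    by (rule image_subsetI) (rule assms(1))
qed

section \<open>Continuity of the map and of its inverse\<close>

context kingman begin

text \<open>The adjoint of \<open>F_map s\<close> on test functions. That it preserves bounded
  continuous functions is what makes \<open>F_map s\<close> weakly continuous.\<close>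

definition angle_average :: "(real ^ 'k \<Rightarrow> real) \<Rightarrow> real ^ 'k \<Rightarrow> real" where
  "angle_average f c = (\<integral>u. f (c * u) \<partial>angle_vec s)"

lemma angle_average:
  fixes f :: "real ^ 'k \<Rightarrow> real"
  assumes f: "continuous_on UNIV f" and B: "bounded (range f)"
  shows "continuous_on A (angle_average f)" and "bounded (angle_average f ` A)"
    and "G \<in> prob_measures orthant \<Longrightarrow> (\<integral>y. f y \<partial>F_map s G) = (\<integral>c. angle_average f c \<partial>G)"
proof -
  obtain B where B: "\<And>x. norm (f x) \<le> B" using B by (auto simp: bounded_iff)
  note [measurable] = borel_measurable_continuous_onI[OF f]
  interpret prob_space "angle_vec s :: (real ^ 'k) measure" by (rule prob_space_angle_vec)
  have m: "(\<lambda>u. f (c * u)) \<in> borel_measurable (angle_vec s)" for c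
    unfolding measurable_cong_sets[OF sets_angle_vec refl]
    by (rule borel_measurable_continuous_onI[OF continuous_on_compose2[OF f continuous_on_times_vec]]) simp
  have "isCont (angle_average f) c" for c
    unfolding continuous_at_sequentially comp_def angle_average_def
  proof (intro allI impI)
    fix X assume X: "X \<longlonglongrightarrow> c"
    show "(\<lambda>n. \<integral>u. f (X n * u) \<partial>angle_vec s) \<longlonglongrightarrow> (\<integral>u. f (c * u) \<partial>angle_vec s)"
    proof (rule integral_dominated_convergence[where w = "\<lambda>_. B"])
      have "(\<lambda>n. X n * u) \<longlonglongrightarrow> c * u" for u
        by (rule vec_tendstoI) (auto intro!: tendsto_intros tendsto_vec_nth X)
      then show "AE u in angle_vec s. (\<lambda>n. f (X n * u)) \<longlonglongrightarrow> f (c * u)"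
        using f by (intro always_eventually allI isCont_tendsto_compose[of _ f]) (auto simp: continuous_on_eq_continuous_at)
    qed (use m B in auto)
  qed
  then show "continuous_on A (angle_average f)" by (simp add: continuous_at_imp_continuous_on)
  have "norm (angle_average f c) \<le> B" for c
  proof -
    have "norm (angle_average f c) \<le> (\<integral>u. norm (f (c * u)) \<partial>angle_vec s)" unfolding angle_average_def by (rule integral_norm_bound)
    also have "\<dots> \<le> (\<integral>u. B \<partial>(angle_vec s :: (real ^ 'k) measure))"
      using B integrable_bounded[OF m[of c] B] by (intro integral_mono) auto
    finally show ?thesis by (simp add: prob_space del: space_angle_vec)
  qed
  then show "bounded (angle_average f ` A)" by (auto simp: bounded_iff)
  show "(\<integral>y. f y \<partial>F_map s G) = (\<integral>c. angle_average f c \<partial>G)" if "G \<in> prob_measures orthant"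
    unfolding angle_average_def by (rule integral_F_map[OF that _ B]) simp
qed

lemma continuous_map_F_map: "continuous_map (weak_topology orthant) (weak_topology UNIV) (F_map s :: (real ^ 'k) measure \<Rightarrow> _)"
proof (rule continuous_map_weak_topologyI)
  fix f :: "real ^ 'k \<Rightarrow> real" and U :: "real set" assume f: "continuous_on UNIV f" "bounded (range f)" and U: "open U"
  have "{G \<in> topspace (weak_topology orthant). (\<integral>y. f y \<partial>F_map s G) \<in> U} = {G \<in> prob_measures orthant. (\<integral>c. angle_average f c \<partial>G) \<in> U}"
    using angle_average(3)[OF f] by auto
  then show "openin (weak_topology orthant) {G \<in> topspace (weak_topology orthant). (\<integral>y. f y \<partial>F_map s G) \<in> U}"
    using openin_weak_topology[OF angle_average(1,2)[OF f] U] by simp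
qed (simp add: F_map_prob_measures)

lemma homeomorphic_map_F_map:
  "homeomorphic_map (weak_topology orthant) (subtopology (weak_topology UNIV) (F_range s :: (real ^ 'k) measure set)) (F_map s)"
proof -
  let ?P = "prob_measures orthant :: (real ^ 'k) measure set"
  let ?Y = "subtopology (weak_topology UNIV) (F_range s :: (real ^ 'k) measure set)"
  let ?g = "inv_into ?P (F_map s)"
  have top: "topspace ?Y = F_range s" using F_range_subset by auto
  have gF: "?g (F_map s G) = G" if "G \<in> ?P" for G by (rule inv_into_f_f[OF inj_on_F_map that])
  have Fg: "F_map s (?g K) = K" "?g K \<in> ?P" if "K \<in> F_range s" for K
    using that unfolding F_range_def by (auto simp: f_inv_into_f inv_into_into)
  have "homeomorphic_maps (weak_topology orthant) ?Y (F_map s) ?g"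
    unfolding homeomorphic_maps_def
  proof (intro conjI ballI)
    show "continuous_map (weak_topology orthant) ?Y (F_map s)"
      by (rule continuous_map_into_subtopology[OF continuous_map_F_map]) (auto simp: F_range_def)
    show "continuous_map ?Y (weak_topology orthant) ?g"
    proof (rule continuous_map_weak_topologyI)
      show "?g K \<in> ?P" if "K \<in> topspace ?Y" for K using that Fg(2) unfolding top by blast
      fix f :: "real ^ 'k \<Rightarrow> real" and U :: "real set" assume f: "continuous_on orthant f" "bounded (f ` orthant)" and U: "open U"
      show "openin ?Y {K \<in> topspace ?Y. (\<integral>c. f c \<partial>?g K) \<in> U}"
      proof (subst openin_subopen, intro ballI)
        fix K0 assume "K0 \<in> {K \<in> topspace ?Y. (\<integral>c. f c \<partial>?g K) \<in> U}"
        then have K0: "K0 \<in> F_range s" "(\<integral>c. f c \<partial>?g K0) \<in> U" unfolding top by auto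
        obtain e where e: "e > 0" "\<And>y. \<bar>y - (\<integral>c. f c \<partial>?g K0)\<bar> < e \<Longrightarrow> y \<in> U"
          using U K0(2) by (auto simp: open_dist dist_real_def)
        obtain H L :: "real ^ 'k \<Rightarrow> real" and d where d: "d > 0" and H: "continuous_on UNIV H" "bounded (range H)"
          and L: "continuous_on UNIV L" "bounded (range L)" and
          c: "\<And>G. G \<in> ?P \<Longrightarrow> \<bar>(\<integral>y. H y \<partial>F_map s G) - (\<integral>y. H y \<partial>F_map s (?g K0))\<bar> < d \<Longrightarrow>
            \<bar>(\<integral>y. L y \<partial>F_map s G) - (\<integral>y. L y \<partial>F_map s (?g K0))\<bar> < d \<Longrightarrow> \<bar>(\<integral>c. f c \<partial>G) - (\<integral>c. f c \<partial>?g K0)\<bar> < e"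
          by (rule F_map_controls_integral[OF Fg(2)[OF K0(1)] f e(1)]) (rule that)
        \<comment> \<open>Closeness on the two control functions is a weak neighbourhood of
          \<open>K0\<close>; within the range, the preimages of its points keep the integral of f
          within e.\<close>
        define N where "N h = {K \<in> prob_measures UNIV. (\<integral>y. h y \<partial>K) \<in> ball (\<integral>y. h y \<partial>K0) d}" for h :: "real ^ 'k \<Rightarrow> real"
        have oN: "openin (weak_topology UNIV) (N H \<inter> N L)"
          unfolding N_def using H L by (intro openin_Int openin_weak_topology) auto
        show "\<exists>T. openin ?Y T \<and> K0 \<in> T \<and> T \<subseteq> {K \<in> topspace ?Y. (\<integral>c. f c \<partial>?g K) \<in> U}"
        proof (intro exI[of _ "(N H \<inter> N L) \<inter> F_range s"] conjI subsetI)
          show "openin ?Y (N H \<inter> N L \<inter> F_range s)" using oN by (auto simp: openin_subtopology)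
          show "K0 \<in> N H \<inter> N L \<inter> F_range s" using K0(1) F_range_subset d by (auto simp: N_def)
          fix K assume K: "K \<in> N H \<inter> N L \<inter> F_range s"
          then have KF: "K \<in> F_range s" by simp
          have "\<bar>(\<integral>c. f c \<partial>?g K) - (\<integral>c. f c \<partial>?g K0)\<bar> < e"
            by (rule c[OF Fg(2)[OF KF]]) (use K in \<open>simp_all add: Fg(1)[OF KF] Fg(1)[OF K0(1)] N_def dist_real_def abs_minus_commute\<close>)
          then show "K \<in> {K \<in> topspace ?Y. (\<integral>c. f c \<partial>?g K) \<in> U}" using KF e(2) unfolding top by blast
        qed
      qed
    qed
  qed (use gF Fg top in auto)
  then show ?thesis by (auto simp: homeomorphic_map_maps)
qed

section \<open>Closedness of the range\<close>

text \<open>The n-th neighbourhood of \<open>K0\<close> constrains the first n + 1 functions up to 1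
  / (n + 1), and every function of the family is eventually among them.\<close>

lemma closure_of_F_range_sequence:
  fixes K0 :: "(real ^ 'k) measure" and \<H> :: "(real ^ 'k \<Rightarrow> real) set"
  assumes K0: "K0 \<in> weak_topology UNIV closure_of F_range s" and \<H>: "countable \<H>"
    and cont: "\<And>h. h \<in> \<H> \<Longrightarrow> continuous_on UNIV h \<and> bounded (range h)"
  obtains G where "\<And>n. G n \<in> prob_measures orthant" "\<And>h. h \<in> \<H> \<Longrightarrow> (\<lambda>n. \<integral>y. h y \<partial>F_map s (G n)) \<longlonglongrightarrow> (\<integral>y. h y \<partial>K0)"
proof -
  \<comment> \<open>The zero function makes the set nonempty, so that it can be enumerated.\<close>
  define h where "h = from_nat_into (insert (\<lambda>_. 0) \<H>)"
  have range_h: "range h = insert (\<lambda>_. 0) \<H>" unfolding h_def using \<H> by (intro range_from_nat_into) auto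
  have hc: "continuous_on UNIV (h i)" "bounded (range (h i))" for i
    using cont[of "h i"] rangeI[of h i] unfolding range_h by (auto simp: bounded_iff)
  define N where "N i n = {K \<in> prob_measures UNIV. (\<integral>y. h i y \<partial>K) \<in> ball (\<integral>y. h i y \<partial>K0) (1 / real (Suc n))}" for i n
  have K0P: "K0 \<in> prob_measures UNIV" using K0 by (auto simp: in_closure_of)
  have "\<exists>G. G \<in> prob_measures orthant \<and> (\<forall>i\<le>n. F_map s G \<in> N i n)" for n
  proof -
    have "openin (weak_topology UNIV) (\<Inter>i\<in>{..n}. N i n)"
      unfolding N_def by (intro openin_INT2 openin_weak_topology hc) auto
    moreover have "K0 \<in> (\<Inter>i\<in>{..n}. N i n)" using K0P by (auto simp: N_def)
    ultimately have "\<exists>K \<in> F_range s. K \<in> (\<Inter>i\<in>{..n}. N i n)"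
      using K0[unfolded in_closure_of, THEN conjunct2, THEN spec, of "\<Inter>i\<in>{..n}. N i n"] by blast
    then show ?thesis by (auto simp: F_range_def)
  qed
  then have "\<exists>G. \<forall>n. G n \<in> prob_measures orthant \<and> (\<forall>i\<le>n. F_map s (G n) \<in> N i n)" by (intro choice allI)
  then obtain G where G: "\<And>n. G n \<in> prob_measures orthant" "\<And>n i. i \<le> n \<Longrightarrow> F_map s (G n) \<in> N i n" by blast
  have "(\<lambda>n. \<integral>y. f y \<partial>F_map s (G n)) \<longlonglongrightarrow> (\<integral>y. f y \<partial>K0)" if "f \<in> \<H>" for f
  proof -
    have "f \<in> range h" unfolding range_h using that by simp
    then obtain i where i: "f = h i" by (rule rangeE)
    show ?thesis unfolding i
    proof (rule Lim_null[THEN iffD2], rule Lim_null_comparison)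
      show "(\<lambda>n. 1 / real (Suc n)) \<longlonglongrightarrow> 0" by (rule LIMSEQ_Suc[OF lim_1_over_n])
      have "norm ((\<integral>y. h i y \<partial>F_map s (G n)) - (\<integral>y. h i y \<partial>K0)) \<le> 1 / real (Suc n)" if "n \<ge> i" for n
        using G(2)[OF that] by (auto simp: N_def dist_real_def abs_minus_commute)
      then show "\<forall>\<^sub>F n in sequentially. norm ((\<integral>y. h i y \<partial>F_map s (G n)) - (\<integral>y. h i y \<partial>K0)) \<le> 1 / real (Suc n)"
        by (rule eventually_sequentiallyI)
    qed
  qed
  then show thesis using that G(1) by blast
qed

lemma rayleigh_cos_0: "rayleigh_cos (0 :: real ^ 'k) = 1"
proof -
  interpret prob_space "rayleigh_vec s :: (real ^ 'k) measure" by (rule prob_measures_orthantD[OF rayleigh_vec_prob_measures])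
  show ?thesis by (simp add: rayleigh_cos_def prob_space)
qed

lemma exp_coords_log_coords: "(\<And>i. z $ i \<in> {0<..1}) \<Longrightarrow> exp_coords (log_coords z) = z"
  by (simp add: exp_coords_def log_coords_def vec_eq_iff abs_of_nonpos)

lemma measurable_log_coords: "log_coords \<in> measurable borel (borel_on orthant :: (real ^ 'k) measure)"
proof (rule measurable_restrict_space2)
  have "(\<lambda>z::real ^ 'k. sqrt \<bar>ln (z $ i)\<bar>) \<in> borel_measurable borel" for i by measurable
  then show "(log_coords :: real ^ 'k \<Rightarrow> _) \<in> borel_measurable borel"
    by (intro borel_measurable_vecI) (simp add: log_coords_def)
qed (simp add: log_coords_orthant)

text \<open>A Laplace parameter whose integrand exp(- c_j^2 / (n + 1)) is the (n + 1)-th root of the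
  cube coordinate j.\<close>

definition scale_vec :: "'k \<Rightarrow> nat \<Rightarrow> real ^ 'k" where
  "scale_vec j n = axis j (1 / real (Suc n))"

text \<open>On the image side the kernels tend to 1 as n grows, and so do their integrals because
  \<open>K0\<close> is a probability measure. On the cube the roots are at most the indicator of z_j
  > 0, so this set has full mass.\<close>

lemma limit_law_no_escape:
  fixes K0 \<nu> :: "(real ^ 'k) measure"
  assumes K0: "K0 \<in> prob_measures UNIV" and \<nu>: "\<nu> \<in> prob_measures UNIV" and cube: "AE z in \<nu>. z \<in> unit_cube"
    and eq: "\<And>n. (\<integral>z. root (Suc n) (z $ j) \<partial>\<nu>) = (\<integral>y. laplace_kernel (scale_vec j n) y \<partial>K0)"
  shows "AE z in \<nu>. z $ j > 0"
proof -
  note K0' = prob_measures_UNIVD[OF K0] and \<nu>' = prob_measures_UNIVD[OF \<nu>]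
  note [measurable_cong] = K0'(2) \<nu>'(2)
  interpret K: prob_space K0 by fact
  interpret \<nu>: prob_space \<nu> by fact
  have "(\<lambda>n. \<integral>y. laplace_kernel (scale_vec j n) y \<partial>K0) \<longlonglongrightarrow> (\<integral>y. 1 \<partial>K0)"
  proof (rule integral_dominated_convergence[where w = "\<lambda>_. 1"])
    show "laplace_kernel (scale_vec j n) \<in> borel_measurable K0" for n
      unfolding measurable_cong_sets[OF K0'(2) refl] by (rule borel_measurable_continuous_onI[OF continuous_laplace_kernel])
    have "(\<lambda>n. laplace_kernel (scale_vec j n) y) \<longlonglongrightarrow> 1" for y
    proof -
      have "(\<lambda>n. ((\<chi> i. sqrt (4 * (s + 1) * scale_vec j n $ i)) * y) $ i) \<longlonglongrightarrow> 0" for i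
      proof -
        have "(\<lambda>n. scale_vec j n $ i) \<longlonglongrightarrow> 0"
          using LIMSEQ_Suc[OF lim_1_over_n] by (cases "i = j") (simp_all add: scale_vec_def axis_def)
        then have "(\<lambda>n. sqrt (4 * (s + 1) * scale_vec j n $ i) * y $ i) \<longlonglongrightarrow> sqrt (4 * (s + 1) * 0) * y $ i"
          by (intro tendsto_intros)
        then show ?thesis by simp
      qed
      then have "(\<lambda>n. (\<chi> i. sqrt (4 * (s + 1) * scale_vec j n $ i)) * y) \<longlonglongrightarrow> 0"
        by (intro vec_tendstoI) simp
      moreover have "isCont rayleigh_cos (0 :: real ^ 'k)" using continuous_rayleigh_cos[where 'k = 'k] by (simp add: continuous_on_eq_continuous_at)
      ultimately show ?thesis
        unfolding laplace_kernel_def using isCont_tendsto_compose[of 0 rayleigh_cos] by (fastforce simp: rayleigh_cos_0)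
    qed
    then show "AE y in K0. (\<lambda>n. laplace_kernel (scale_vec j n) y) \<longlonglongrightarrow> 1" by simp
  qed (auto simp: abs_laplace_kernel_le)
  then have lim: "(\<lambda>n. \<integral>z. root (Suc n) (z $ j) \<partial>\<nu>) \<longlonglongrightarrow> 1" unfolding eq by (simp add: K.prob_space)
  have "(\<integral>z. root (Suc n) (z $ j) \<partial>\<nu>) \<le> \<nu>.prob {z. z $ j > 0}" for n
  proof -
    have rm: "(\<lambda>z::real ^ 'k. root (Suc n) (z $ j)) \<in> borel_measurable borel"
      by (intro borel_measurable_continuous_onI continuous_intros)
    have "(\<integral>z. root (Suc n) (z $ j) \<partial>\<nu>) \<le> (\<integral>z. indicator {z. z $ j > 0} z \<partial>\<nu>)"
    proof (rule integral_mono_AE)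
      show "integrable \<nu> (\<lambda>z. root (Suc n) (z $ j))"
        by (rule \<nu>.integrable_const_bound[of _ 1])
           (use cube rm in \<open>auto simp: unit_cube_def measurable_cong_sets[OF \<nu>'(2) refl] elim!: eventually_mono\<close>)
      show "integrable \<nu> (indicat_real {z. z $ j > 0})"
        by (rule \<nu>.integrable_const_bound[of _ 1]) (auto simp: indicator_def)
      show "AE z in \<nu>. root (Suc n) (z $ j) \<le> indicator {z. z $ j > 0} z"
        using cube
      proof (rule eventually_mono)
        fix z :: "real ^ 'k" assume "z \<in> unit_cube"
        then have "0 \<le> z $ j" "z $ j \<le> 1" by (auto simp: unit_cube_def)
        then show "root (Suc n) (z $ j) \<le> indicator {z. z $ j > 0} z"
          by (cases "z $ j = 0") auto
      qed
    qed
    also have "\<dots> = \<nu>.prob {z. z $ j > 0}" by (simp add: \<nu>'(3))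
    finally show ?thesis .
  qed
  then have "1 \<le> \<nu>.prob {z. z $ j > 0}" using LIMSEQ_le_const2[OF lim] by blast
  then have "\<nu>.prob {z. z $ j > 0} = 1" using \<nu>.prob_le_1 by (simp add: antisym)
  then show ?thesis by (subst (asm) \<nu>.prob_eq_1) (auto simp: \<nu>'(3))
qed

lemma closedin_F_range: "closedin (weak_topology UNIV) (F_range s :: (real ^ 'k) measure set)"
proof -
  have "K0 \<in> F_range s" if K0: "K0 \<in> weak_topology UNIV closure_of F_range s" for K0 :: "(real ^ 'k) measure"
  proof -
    have K0P: "K0 \<in> prob_measures UNIV" using K0 by (auto simp: in_closure_of)
    obtain D :: "(real ^ 'k) set" where D: "countable D" "\<And>X. open X \<Longrightarrow> X \<noteq> {} \<Longrightarrow> \<exists>d\<in>D. d \<in> X"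
      using countable_dense_exists by blast
    \<comment> \<open>The Laplace kernels exclude escape of mass; the cosines and sines at the
      frequencies in \<open>D\<close> identify \<open>K0\<close>.\<close>
    define \<H> :: "(real ^ 'k \<Rightarrow> real) set" where
      "\<H> = (\<Union>j. range (\<lambda>n. laplace_kernel (scale_vec j n))) \<union> (\<lambda>t y. cos (t \<bullet> y)) ` D \<union> (\<lambda>t y. sin (t \<bullet> y)) ` D"
    have "countable \<H>" unfolding \<H>_def using D(1) by (intro countable_Un countable_UN) auto
    moreover have \<H>c: "continuous_on UNIV h \<and> bounded (range h)" if "h \<in> \<H>" for h
      using that unfolding \<H>_def
      by (auto simp: bounded_iff abs_laplace_kernel_le intro!: continuous_laplace_kernel continuous_intros exI[of _ 1] intro: abs_laplace_kernel_le)
    ultimately obtain G where G: "\<And>n. G n \<in> prob_measures orthant"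
      and lim: "\<And>h. h \<in> \<H> \<Longrightarrow> (\<lambda>n. \<integral>y. h y \<partial>F_map s (G n)) \<longlonglongrightarrow> (\<integral>y. h y \<partial>K0)"
      using closure_of_F_range_sequence[OF K0] by blast
    define \<mu> where "\<mu> n = distr (G n) borel exp_coords" for n
    have em: "exp_coords \<in> borel_measurable (G n)" for n
      unfolding measurable_cong_sets[OF prob_measures_orthantD(2)[OF G] refl] by (rule measurable_restrict_space1[OF measurable_exp_coords])
    have \<mu>P: "\<mu> n \<in> prob_measures UNIV" for n
      unfolding \<mu>_def prob_measures_def borel_on_UNIV using em prob_measures_orthantD(1)[OF G] by (auto intro!: prob_space.prob_space_distr)
    have \<mu>cube: "AE z in \<mu> n. z \<in> unit_cube" for n
      unfolding \<mu>_def by (subst AE_distr_iff[OF em]) (auto simp: unit_cube_eq_cbox[symmetric] exp_coords_cube, simp add: unit_cube_eq_cbox)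
    obtain r \<nu> where r: "strict_mono r" and \<nu>: "\<nu> \<in> prob_measures UNIV"
      and cube: "AE z in \<nu>. z \<in> unit_cube"
      and \<nu>lim: "\<And>f :: real ^ 'k \<Rightarrow> real. continuous_on UNIV f \<Longrightarrow> (\<lambda>n. \<integral>z. f z \<partial>\<mu> (r n)) \<longlonglongrightarrow> (\<integral>z. f z \<partial>\<nu>)"
      by (rule unit_cube_convergent_subsequence[OF \<mu>P \<mu>cube]) (rule that)
    note \<nu>' = prob_measures_UNIVD[OF \<nu>]
    have int_\<mu>: "(\<integral>z. f z \<partial>\<mu> n) = (\<integral>c. f (exp_coords c) \<partial>G n)" if "continuous_on UNIV f" for f :: "real ^ 'k \<Rightarrow> real" and n
      unfolding \<mu>_def by (rule integral_distr[OF em borel_measurable_continuous_onI[OF that]])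
    have pos: "AE z in \<nu>. z $ j > 0" for j
    proof (rule limit_law_no_escape[OF K0P \<nu> cube])
      fix n
      have cr: "continuous_on UNIV (\<lambda>z::real ^ 'k. root (Suc n) (z $ j))" by (intro continuous_intros)
      have "(\<integral>z. root (Suc n) (z $ j) \<partial>\<mu> m) = (\<integral>y. laplace_kernel (scale_vec j n) y \<partial>F_map s (G m))" for m
      proof -
        have "root (Suc n) (exp_coords c $ j) = (\<Prod>i\<in>UNIV. exp (- (scale_vec j n $ i * (c $ i)\<^sup>2)))" for c :: "real ^ 'k"
        proof -
          have "(\<Prod>i\<in>UNIV. exp (- (scale_vec j n $ i * (c $ i)\<^sup>2))) = (\<Prod>i\<in>UNIV. if i = j then exp (- ((c $ i)\<^sup>2 / real (Suc n))) else 1)"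
            by (intro prod.cong refl) (simp add: scale_vec_def axis_def)
          also have "\<dots> = exp (- ((c $ j)\<^sup>2 / real (Suc n)))" by simp
          also have "\<dots> = root (Suc n) (exp_coords c $ j)"
            by (rule real_root_pos_unique[symmetric]) (simp_all add: exp_coords_def exp_of_nat_mult[symmetric] del: power_Suc of_nat_Suc)
          finally show ?thesis ..
        qed
        then show ?thesis unfolding int_\<mu>[OF cr]
          using integral_laplace_kernel[OF G, of "scale_vec j n" m] by (simp add: scale_vec_def axis_def)
      qed
      moreover have "laplace_kernel (scale_vec j n) \<in> \<H>" by (auto simp: \<H>_def)
      from LIMSEQ_subseq_LIMSEQ[OF lim[OF this] r]
      have "(\<lambda>m. \<integral>y. laplace_kernel (scale_vec j n) y \<partial>F_map s (G (r m))) \<longlonglongrightarrow> (\<integral>y. laplace_kernel (scale_vec j n) y \<partial>K0)"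
        by (simp add: comp_def)
      ultimately show "(\<integral>z. root (Suc n) (z $ j) \<partial>\<nu>) = (\<integral>y. laplace_kernel (scale_vec j n) y \<partial>K0)"
        using LIMSEQ_unique[OF \<nu>lim[OF cr]] by simp
    qed
    have inv: "AE z in \<nu>. exp_coords (log_coords z) = z"
    proof -
      have "AE z in \<nu>. \<forall>j. z $ j > 0" using pos by (simp add: AE_all_countable)
      with cube show ?thesis
        by eventually_elim (rule exp_coords_log_coords, simp add: unit_cube_def)
    qed
    \<comment> \<open>The limit law on the cube is carried by (0,1]^k up to a null set, so pulling
      it back along \<open>log_coords\<close> loses nothing. This is the weak limit of the
      sources.\<close>
    define G0 where "G0 = distr \<nu> (borel_on orthant) log_coords"
    have lm: "log_coords \<in> measurable \<nu> (borel_on orthant)"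
      unfolding measurable_cong_sets[OF \<nu>'(2) refl] by (rule measurable_log_coords)
    have G0: "G0 \<in> prob_measures orthant"
      unfolding G0_def prob_measures_def using lm \<nu>'(1) by (auto intro!: prob_space.prob_space_distr)
    have cutlim: "(\<lambda>n. \<integral>c. f c * cutoff R c \<partial>G (r n)) \<longlonglongrightarrow> (\<integral>c. f c * cutoff R c \<partial>G0)"
      if f: "continuous_on orthant f" and R: "R \<ge> 0" for f :: "real ^ 'k \<Rightarrow> real" and R
    proof -
      obtain g where g: "continuous_on UNIV g" "\<And>c. c \<in> orthant \<Longrightarrow> g (exp_coords c) = f c * cutoff R c"
        using cutoff_extension[OF f R] by blast
      have "(\<integral>z. g z \<partial>\<mu> n) = (\<integral>c. f c * cutoff R c \<partial>G n)" for n
        unfolding int_\<mu>[OF g(1)] by (intro Bochner_Integration.integral_cong refl) (simp add: g prob_measures_orthantD[OF G])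
      moreover have "(\<integral>z. g z \<partial>\<nu>) = (\<integral>c. f c * cutoff R c \<partial>G0)"
      proof -
        have fc: "(\<lambda>c. f c * cutoff R c) \<in> borel_measurable (borel_on orthant)"
          by (intro borel_measurable_continuous_on_restrict continuous_on_mult f continuous_cutoff)
        have gm: "g \<in> borel_measurable \<nu>"
          unfolding measurable_cong_sets[OF \<nu>'(2) refl] by (rule borel_measurable_continuous_onI[OF g(1)])
        have "(\<integral>z. g z \<partial>\<nu>) = (\<integral>z. f (log_coords z) * cutoff R (log_coords z) \<partial>\<nu>)"
        proof (rule integral_cong_AE[OF gm measurable_compose[OF lm fc]])
          show "AE z in \<nu>. g z = f (log_coords z) * cutoff R (log_coords z)"
            using inv g(2)[OF log_coords_orthant] by (auto elim!: eventually_mono) metis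
        qed
        also have "\<dots> = (\<integral>c. f c * cutoff R c \<partial>G0)" unfolding G0_def by (rule integral_distr[OF lm fc, symmetric])
        finally show ?thesis .
      qed
      ultimately show ?thesis using \<nu>lim[OF g(1)] by simp
    qed
    \<comment> \<open>Functions times a cutoff extend to the closed cube, so their integrals
      converge. As the limit is a probability measure on the orthant, no tail is lost and the
      convergence extends to all bounded continuous f.\<close>
    have weak: "(\<lambda>n. \<integral>c. f c \<partial>G (r n)) \<longlonglongrightarrow> (\<integral>c. f c \<partial>G0)"
      if f: "continuous_on orthant f" "bounded (f ` orthant)" for f :: "real ^ 'k \<Rightarrow> real"
    proof (rule tendstoI)
      fix e :: real assume e: "e > 0"
      obtain R d where R: "R \<ge> 0" and d: "d > 0" and
        c: "\<And>G. G \<in> prob_measures orthant \<Longrightarrow> \<bar>(\<integral>c. f c * cutoff R c \<partial>G) - (\<integral>c. f c * cutoff R c \<partial>G0)\<bar> < d \<Longrightarrow>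
          \<bar>(\<integral>c. cutoff R c \<partial>G) - (\<integral>c. cutoff R c \<partial>G0)\<bar> < d \<Longrightarrow> \<bar>(\<integral>c. f c \<partial>G) - (\<integral>c. f c \<partial>G0)\<bar> < e"
        by (rule cutoff_controls_integral[OF G0 f e]) (rule that)
      have "\<forall>\<^sub>F n in sequentially. dist (\<integral>c. f c * cutoff R c \<partial>G (r n)) (\<integral>c. f c * cutoff R c \<partial>G0) < d"
        by (rule tendstoD[OF cutlim[OF f(1) R] d])
      moreover have "\<forall>\<^sub>F n in sequentially. dist (\<integral>c. 1 * cutoff R c \<partial>G (r n)) (\<integral>c. 1 * cutoff R c \<partial>G0) < d"
        by (rule tendstoD[OF cutlim[OF continuous_on_const R] d])
      ultimately show "\<forall>\<^sub>F n in sequentially. dist (\<integral>c. f c \<partial>G (r n)) (\<integral>c. f c \<partial>G0) < e"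
        by eventually_elim (use c[OF G] in \<open>simp add: dist_real_def\<close>)
    qed
    have eq: "(\<integral>y. h y \<partial>K0) = (\<integral>y. h y \<partial>F_map s G0)" if h: "h \<in> \<H>" for h
    proof (rule LIMSEQ_unique)
      show "(\<lambda>n. \<integral>y. h y \<partial>F_map s (G (r n))) \<longlonglongrightarrow> (\<integral>y. h y \<partial>K0)"
        using LIMSEQ_subseq_LIMSEQ[OF lim[OF h] r] by (simp add: comp_def)
      have hc: "continuous_on UNIV h" "bounded (range h)" using \<H>c[OF h] by auto
      show "(\<lambda>n. \<integral>y. h y \<partial>F_map s (G (r n))) \<longlonglongrightarrow> (\<integral>y. h y \<partial>F_map s G0)"
        using weak[OF angle_average(1,2)[OF hc]] by (simp add: angle_average(3)[OF hc] G G0)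
    qed
    have FP: "F_map s G0 \<in> prob_measures UNIV" by (rule F_map_prob_measures[OF G0])
    have "K0 = F_map s G0"
    proof (rule char_fun_unique'[OF K0P FP])
      fix t
      \<comment> \<open>Both sides are continuous in t and agree on the dense set
        \<open>D\<close>.\<close>
      have ext: "(\<integral>y. g (t \<bullet> y) \<partial>K0) = (\<integral>y. g (t \<bullet> y) \<partial>F_map s G0)"
        if g: "continuous_on UNIV g" "\<And>x. \<bar>g x\<bar> \<le> 1" and gD: "\<And>t. t \<in> D \<Longrightarrow> (\<lambda>y. g (t \<bullet> y)) \<in> \<H>" for g :: "real \<Rightarrow> real"
      proof -
        have c: "continuous_on UNIV (\<lambda>t. \<integral>y. g (t \<bullet> y) \<partial>K)" if K: "K \<in> prob_measures UNIV" for K :: "(real ^ 'k) measure"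
          by (rule continuous_on_integral_inner[OF prob_measures_UNIVD(1)[OF K] _ g])
             (simp add: measurable_cong_sets[OF prob_measures_UNIVD(2)[OF K] refl])
        have dense: "closure D = UNIV"
        proof (rule ccontr)
          assume "closure D \<noteq> UNIV"
          then obtain d where "d \<in> D" "d \<in> - closure D" using D(2)[of "- closure D"] by auto
          then show False using closure_subset[of D] by auto
        qed
        have "(\<lambda>t. (\<integral>y. g (t \<bullet> y) \<partial>K0) - (\<integral>y. g (t \<bullet> y) \<partial>F_map s G0)) t = 0"
        proof (rule continuous_constant_on_closure[of D])
          show "continuous_on (closure D) (\<lambda>t. (\<integral>y. g (t \<bullet> y) \<partial>K0) - (\<integral>y. g (t \<bullet> y) \<partial>F_map s G0))"
            unfolding dense by (intro continuous_on_diff c K0P FP)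
        qed (use eq[OF gD] dense in simp_all)
        then show ?thesis by simp
      qed
      have "(\<integral>y. cos (t \<bullet> y) \<partial>K0) = (\<integral>y. cos (t \<bullet> y) \<partial>F_map s G0)"
        by (rule ext) (auto simp: \<H>_def intro!: continuous_intros)
      moreover have "(\<integral>y. sin (t \<bullet> y) \<partial>K0) = (\<integral>y. sin (t \<bullet> y) \<partial>F_map s G0)"
        by (rule ext) (auto simp: \<H>_def intro!: continuous_intros)
      ultimately show "char_fun K0 t = char_fun (F_map s G0) t"
        unfolding char_fun_cos_sin[OF K0P] char_fun_cos_sin[OF FP] by simp
    qed
    then show ?thesis using G0 by (simp add: F_range_def)
  qed
  then show ?thesis using F_range_subset by (auto simp: closure_of_subset_eq[symmetric])
qed

end


section \<open>The two convolution algebras and the embedding\<close>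

context kingman begin

text \<open>A law on the orthant is determined by its radial characteristic function, on which the
  convolution acts as multiplication; the monoid laws are inherited from the real numbers.\<close>

lemma kingman_algebra_comm_monoid: "Group.comm_monoid (kingman_algebra s :: (real ^ 'k) measure monoid)"
proof -
  note cl = kingman_conv_vec_prob_measures
  have eqI: "A = B" if "A \<in> prob_measures orthant" "B \<in> prob_measures orthant" "\<And>t. radial_char_fun s A t = radial_char_fun s B t"
    for A B :: "(real ^ 'k) measure"
  proof (rule inj_onD[OF inj_on_F_map _ that(1,2)])
    show "F_map s A = F_map s B"
      by (rule char_fun_unique') (simp_all add: F_map_prob_measures char_fun_F_map that)
  qed
  have one: "radial_char_fun s (return (borel_on orthant) 0) t = 1" for t :: "real ^ 'k"
  proof -
    have "complex_of_real (radial_char_fun s (return (borel_on orthant) 0) t) = char_fun (return borel 0) t"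
      unfolding F_map_return_0[symmetric] by (rule char_fun_F_map[OF return_orthant, symmetric])
    then show ?thesis by (simp add: char_fun_return_0)
  qed
  show ?thesis
  proof (rule comm_monoidI)
    fix x y z :: "(real ^ 'k) measure"
    assume "x \<in> carrier (kingman_algebra s)" "y \<in> carrier (kingman_algebra s)"
    then have x: "x \<in> prob_measures orthant" and y: "y \<in> prob_measures orthant" by (simp_all add: kingman_algebra_def)
    show "x \<otimes>\<^bsub>kingman_algebra s\<^esub> y \<in> carrier (kingman_algebra s)"
      using cl[OF x y] by (simp add: kingman_algebra_def)
    have "kingman_conv_vec s x y = kingman_conv_vec s y x"
      by (rule eqI) (simp_all add: cl x y radial_char_fun_kingman_conv_vec mult.commute)
    then show "x \<otimes>\<^bsub>kingman_algebra s\<^esub> y = y \<otimes>\<^bsub>kingman_algebra s\<^esub> x" by (simp add: kingman_algebra_def)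
    assume "z \<in> carrier (kingman_algebra s)"
    then have z: "z \<in> prob_measures orthant" by (simp add: kingman_algebra_def)
    have "kingman_conv_vec s (kingman_conv_vec s x y) z = kingman_conv_vec s x (kingman_conv_vec s y z)"
      by (rule eqI) (simp_all add: cl x y z radial_char_fun_kingman_conv_vec mult.assoc)
    then show "x \<otimes>\<^bsub>kingman_algebra s\<^esub> y \<otimes>\<^bsub>kingman_algebra s\<^esub> z = x \<otimes>\<^bsub>kingman_algebra s\<^esub> (y \<otimes>\<^bsub>kingman_algebra s\<^esub> z)"
      by (simp add: kingman_algebra_def)
  next
    show "\<one>\<^bsub>kingman_algebra s\<^esub> \<in> carrier (kingman_algebra s :: (real ^ 'k) measure monoid)"
      by (simp add: kingman_algebra_def return_orthant)
    fix x :: "(real ^ 'k) measure" assume "x \<in> carrier (kingman_algebra s)"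
    then have x: "x \<in> prob_measures orthant" by (simp add: kingman_algebra_def)
    have "kingman_conv_vec s (return (borel_on orthant) 0) x = x"
      by (rule eqI) (simp_all add: cl x return_orthant radial_char_fun_kingman_conv_vec one)
    then show "\<one>\<^bsub>kingman_algebra s\<^esub> \<otimes>\<^bsub>kingman_algebra s\<^esub> x = x" by (simp add: kingman_algebra_def)
  qed
qed

text \<open>The same argument with ordinary characteristic functions; the unit lies in the range as
  the image of the point mass at 0.\<close>

lemma convolution_algebra_comm_monoid: "Group.comm_monoid (convolution_algebra s :: (real ^ 'k) measure monoid)"
proof -
  have P: "K \<in> prob_measures UNIV" if "K \<in> F_range s" for K :: "(real ^ 'k) measure" using that F_range_subset by blast
  show ?thesis
  proof (rule comm_monoidI)
    fix x y z :: "(real ^ 'k) measure"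
    assume "x \<in> carrier (convolution_algebra s)" "y \<in> carrier (convolution_algebra s)"
    then have x: "x \<in> F_range s" and y: "y \<in> F_range s" by (simp_all add: convolution_algebra_def)
    show "x \<otimes>\<^bsub>convolution_algebra s\<^esub> y \<in> carrier (convolution_algebra s)"
      using convolution_F_range[OF x y] by (simp add: convolution_algebra_def)
    have "(x \<star> y) = (y \<star> x)"
      by (rule char_fun_unique') (simp_all add: convolution_prob_measures P x y char_fun_convolution mult.commute)
    then show "x \<otimes>\<^bsub>convolution_algebra s\<^esub> y = y \<otimes>\<^bsub>convolution_algebra s\<^esub> x" by (simp add: convolution_algebra_def)
    assume "z \<in> carrier (convolution_algebra s)"
    then have z: "z \<in> F_range s" by (simp add: convolution_algebra_def)
    have "((x \<star> y) \<star> z) = (x \<star> (y \<star> z))"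
      by (rule char_fun_unique') (simp_all add: convolution_prob_measures P x y z char_fun_convolution mult.assoc)
    then show "x \<otimes>\<^bsub>convolution_algebra s\<^esub> y \<otimes>\<^bsub>convolution_algebra s\<^esub> z = x \<otimes>\<^bsub>convolution_algebra s\<^esub> (y \<otimes>\<^bsub>convolution_algebra s\<^esub> z)"
      by (simp add: convolution_algebra_def)
  next
    show "\<one>\<^bsub>convolution_algebra s\<^esub> \<in> carrier (convolution_algebra s :: (real ^ 'k) measure monoid)"
      using imageI[OF return_orthant, of "F_map s"] by (simp add: convolution_algebra_def F_range_def F_map_return_0)
    fix x :: "(real ^ 'k) measure" assume "x \<in> carrier (convolution_algebra s)"
    then have x: "x \<in> F_range s" by (simp add: convolution_algebra_def)
    have "(return borel 0 \<star> x) = x"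
      by (rule char_fun_unique') (simp_all add: convolution_prob_measures P x return_0_prob_measures char_fun_convolution char_fun_return_0)
    then show "\<one>\<^bsub>convolution_algebra s\<^esub> \<otimes>\<^bsub>convolution_algebra s\<^esub> x = x" by (simp add: convolution_algebra_def)
  qed
qed

lemma F_map_mon: "F_map s \<in> mon (kingman_algebra s) (convolution_algebra s :: (real ^ 'k) measure monoid)"
  unfolding mon_def hom_def kingman_algebra_def convolution_algebra_def
  using inj_on_F_map by (auto simp: F_range_def F_map_kingman_conv_vec)

end

theorem theorem2:
  fixes s :: real
  assumes "s \<ge> -1/2"
  shows "
    (F_range s :: (real ^ 'k) measure set) \<subseteq> prob_measures UNIV \<and>
    closedin (weak_topology UNIV) (F_range s :: (real ^ 'k) measure set) \<and>
    (\<forall>K1 \<in> F_range s. \<forall>K2 \<in> F_range s. (K1 \<star> K2) \<in> (F_range s :: (real ^ 'k) measure set)) \<and>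
    (\<forall>G \<in> prob_measures orthant. \<forall>t \<in> orthant.
       complex_of_real (radial_char_fun s G t) = char_fun (F_map s (G :: (real ^ 'k) measure)) t) \<and>
    (\<forall>G1 \<in> prob_measures orthant. \<forall>G2 \<in> prob_measures orthant.
       (F_map s G1 \<star> F_map s G2) = F_map s (kingman_conv_vec s G1 (G2 :: (real ^ 'k) measure))) \<and>
    (\<forall>n a (G :: nat \<Rightarrow> (real ^ 'k) measure).
       (\<forall>i<n. 0 \<le> a i \<and> G i \<in> prob_measures orthant) \<and> (\<Sum>i<n. a i) = 1 \<longrightarrow>
       F_map s (convex_combination orthant n a G) = convex_combination UNIV n a (\<lambda>i. F_map s (G i))) \<and>
    (\<forall>c > 0. \<forall>G \<in> prob_measures orthant.
       F_map s (dilate c G) = dilate c (F_map s (G :: (real ^ 'k) measure))) \<and>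
    F_map s (rayleigh_vec s :: (real ^ 'k) measure) = centred_normal (mat (1 / (2 * (s + 1)))) \<and>
    Group.comm_monoid (kingman_algebra s :: (real ^ 'k) measure monoid) \<and>
    Group.comm_monoid (convolution_algebra s :: (real ^ 'k) measure monoid) \<and>
    F_map s \<in> mon (kingman_algebra s) (convolution_algebra s :: (real ^ 'k) measure monoid) \<and>
    F_map s (one (kingman_algebra s)) = one (convolution_algebra s :: (real ^ 'k) measure monoid) \<and>
    homeomorphic_map (weak_topology orthant)
      (subtopology (weak_topology UNIV) (F_range s :: (real ^ 'k) measure set)) (F_map s)"
proof -
  interpret kingman s by standard (rule assms)
  show ?thesis
  proof (intro conjI)
    show "F_map s (one (kingman_algebra s)) = one (convolution_algebra s :: (real ^ 'k) measure monoid)"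
      by (simp add: kingman_algebra_def convolution_algebra_def F_map_return_0)
    show "\<forall>n a (G :: nat \<Rightarrow> (real ^ 'k) measure).
       (\<forall>i<n. 0 \<le> a i \<and> G i \<in> prob_measures orthant) \<and> (\<Sum>i<n. a i) = 1 \<longrightarrow>
       F_map s (convex_combination orthant n a G) = convex_combination UNIV n a (\<lambda>i. F_map s (G i))"
      using F_map_convex_combination by blast
    show "\<forall>G \<in> prob_measures orthant. \<forall>t \<in> orthant.
       complex_of_real (radial_char_fun s G t) = char_fun (F_map s (G :: (real ^ 'k) measure)) t"
      by (simp add: char_fun_F_map)
  qed (intro allI ballI impI F_range_subset closedin_F_range convolution_F_range F_map_kingman_conv_vec F_map_dilate
      F_map_rayleigh_vec kingman_algebra_comm_monoid convolution_algebra_comm_monoid F_map_mon homeomorphic_map_F_map; assumption)+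
qed

end
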